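(* Let $(R,\mathfrak m,k)$ be a commutative Noetherian local ring with $\mathfrak m\neq 0$. Then $\operatorname{ld}_R(\mathfrak m^n)\le\operatorname{ld}_R(k)$ for all integers $n\ge 0$.
   Context: Linearity defect. Let $M$ be a finitely generated $R$-module and $F$ a minimal free resolution of $M$ with differential $\partial$ (so $\partial F\subseteq \mathfrak mF$). For a finitely generated module $N$ write $N^{\mathsf g}=\bigoplus_{n\ge 0}\mathfrak m^nN/\mathfrak m^{n+1}N$, a graded module over $R^{\mathsf g}=\bigoplus_{n\ge0}\mathfrak m^n/\mathfrak m^{n+1}$. The complex $\operatorname{lin}^R(F)$ of graded $R^{\mathsf g}$-modules has $F_i^{\mathsf g}(-i)$ in homological degree $i$, with differential induced by $\partial$: the class of $x\in\mathfrak m^nF_i$ modulo $\mathfrak m^{n+1}F_i$ is sent to the class of $\partial x\in \mathfrak m^{n+1}F_{i-1}$ modulo $\mathfrak m^{n+2}F_{i-1}$. The linearity defect of $M$ is $\operatorname{ld}_R(M)=\sup\{i\in\mathbb Z\mid \operatorname{H}_i(\operatorname{lin}^R(F))\neq 0\}$ (possibly $\infty$), with the convention $\operatorname{ld}_R(0)=0$. *)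

theory Defs
  imports "HOL-Algebra.Algebra" "HOL-Library.Extended_Nat"
begin

section \<open>Local rings and their modules\<close>

locale noetherian_local_ring = R?: cring R + noetherian_ring R + max?: maximalideal \<mm> R
  for R (structure) and \<mm> +
  assumes maximal_unique: "\<And>J. maximalideal J R \<Longrightarrow> J = \<mm>"

abbreviation ideal_pow :: "('a, 'm) ring_scheme \<Rightarrow> 'a set \<Rightarrow> nat \<Rightarrow> 'a set" where
  "ideal_pow R I n \<equiv> I [^]\<^bsub>ideals_set R\<^esub> n"

text \<open>A ring \<open>S\<close> as a module over \<open>R\<close>, by restriction of scalars along
  a ring homomorphism \<open>h\<close> from \<open>R\<close> to \<open>S\<close>.\<close>

definition restrict_scalars :: "('a \<Rightarrow> 's) \<Rightarrow> ('s, 'm) ring_scheme \<Rightarrow> ('a, 's) module" where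
  "restrict_scalars h S =
    \<lparr>carrier = carrier S, monoid.mult = monoid.mult S, one = \<one>\<^bsub>S\<^esub>, ring.zero = \<zero>\<^bsub>S\<^esub>, ring.add = ring.add S,
     smult = (\<lambda>a x. h a \<otimes>\<^bsub>S\<^esub> x)\<rparr>"

definition ideal_module :: "('a, 'm) ring_scheme \<Rightarrow> 'a set \<Rightarrow> ('a, 'a) module" where
  "ideal_module R I = (restrict_scalars (\<lambda>a. a) R)\<lparr>carrier := I\<rparr>"

definition quotient_module :: "('a, 'm) ring_scheme \<Rightarrow> 'a set \<Rightarrow> ('a, 'a set) module" where
  "quotient_module R I = restrict_scalars (\<lambda>a. I +>\<^bsub>R\<^esub> a) (R Quot I)"

definition module_hom ::
  "('a, 'm) ring_scheme \<Rightarrow> ('a, 'b) module \<Rightarrow> ('a, 'c) module \<Rightarrow> ('b \<Rightarrow> 'c) set" where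
  "module_hom R M N = {f \<in> hom (add_monoid M) (add_monoid N).
     \<forall>a\<in>carrier R. \<forall>x\<in>carrier M. f (a \<odot>\<^bsub>M\<^esub> x) = a \<odot>\<^bsub>N\<^esub> f x}"

text \<open>The submodule \<open>I M\<close>, for an ideal \<open>I\<close> (compare \<^const>\<open>ideal_prod\<close>).\<close>

inductive_set ideal_smult :: "'a set \<Rightarrow> ('a, 'b) module \<Rightarrow> 'b set" for I and M where
  smult: "\<lbrakk> a \<in> I; x \<in> carrier M \<rbrakk> \<Longrightarrow> a \<odot>\<^bsub>M\<^esub> x \<in> ideal_smult I M"
| sum: "\<lbrakk> x \<in> ideal_smult I M; y \<in> ideal_smult I M \<rbrakk> \<Longrightarrow> x \<oplus>\<^bsub>M\<^esub> y \<in> ideal_smult I M"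

definition finite_basis :: "('a, 'm) ring_scheme \<Rightarrow> ('a, 'b) module \<Rightarrow> 'b set \<Rightarrow> bool" where
  "finite_basis R M B \<longleftrightarrow> finite B \<and> B \<subseteq> carrier M \<and>
     (\<forall>x\<in>carrier M. \<exists>!c. c \<in> B \<rightarrow>\<^sub>E carrier R \<and> x = (\<Oplus>\<^bsub>M\<^esub>b\<in>B. c b \<odot>\<^bsub>M\<^esub> b))"


section \<open>Minimal free resolutions\<close>

text \<open>The differential \<open>d i\<close> goes from \<open>F (i + 1)\<close> to \<open>F i\<close>; the map \<open>\<epsilon>\<close> is
  the augmentation from \<open>F 0\<close> to \<open>M\<close>.\<close>

locale minimal_free_resolution =
  fixes R :: "('a, 'm) ring_scheme" and \<mm> :: "'a set" and M :: "('a, 'b) module"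
    and F :: "nat \<Rightarrow> ('a, 'f) module" and d :: "nat \<Rightarrow> 'f \<Rightarrow> 'f" and \<epsilon> :: "'f \<Rightarrow> 'b"
  assumes module: "\<And>i. module R (F i)"
    and free: "\<And>i. \<exists>B. finite_basis R (F i) B"
    and d_hom: "\<And>i. d i \<in> module_hom R (F (Suc i)) (F i)"
    and aug_hom: "\<epsilon> \<in> module_hom R (F 0) M"
    and aug_surj: "\<epsilon> ` carrier (F 0) = carrier M"
    and exact_0: "a_kernel (F 0) M \<epsilon> = d 0 ` carrier (F 1)"
    and exact_Suc: "\<And>i. a_kernel (F (Suc i)) (F i) (d i) = d (Suc i) ` carrier (F (Suc (Suc i)))"
    and minimal: "\<And>i. d i ` carrier (F (Suc i)) \<subseteq> ideal_smult \<mm> (F i)"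


section \<open>Associated graded modules and the linear part\<close>

definition adic_part ::
  "('a, 'm) ring_scheme \<Rightarrow> 'a set \<Rightarrow> ('a, 'b) module \<Rightarrow> nat \<Rightarrow> 'b set" where
  "adic_part R \<mm> N n = ideal_smult (ideal_pow R \<mm> n) N"

definition gr_part ::
  "('a, 'm) ring_scheme \<Rightarrow> 'a set \<Rightarrow> ('a, 'b) module \<Rightarrow> nat \<Rightarrow> 'b set monoid" where
  "gr_part R \<mm> N n = (N\<lparr>carrier := adic_part R \<mm> N n\<rparr>) A_Mod (adic_part R \<mm> N (Suc n))"

text \<open>Only the additive group of the associated graded module is recorded: neither the
  action of the associated graded ring nor the shifts of the internal degree in the linear part
  of a resolution have any influence on whether its homology vanishes.\<close>

definition gr :: "('a, 'm) ring_scheme \<Rightarrow> 'a set \<Rightarrow> ('a, 'b) module \<Rightarrow> (nat \<Rightarrow> 'b set) monoid" where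
  "gr R \<mm> N = sum_group UNIV (gr_part R \<mm> N)"

text \<open>The map induced on associated graded groups by a homomorphism \<open>f\<close> with values in
  \<open>\<mm> N\<close>. It sends the class of \<open>x\<close> modulo \<open>\<mm>\<^sup>j\<^sup>+\<^sup>1\<close> to the class
  of \<open>f x\<close> modulo \<open>\<mm>\<^sup>j\<^sup>+\<^sup>2\<close>; the union below is over representatives
  \<open>x\<close> of one class, which all yield the same coset.\<close>

definition lin_map ::
  "('a, 'm) ring_scheme \<Rightarrow> 'a set \<Rightarrow> ('a, 'c) module \<Rightarrow> ('b \<Rightarrow> 'c) \<Rightarrow> (nat \<Rightarrow> 'b set)
    \<Rightarrow> (nat \<Rightarrow> 'c set)"
  where
  "lin_map R \<mm> N f u n = (case n of
     0 \<Rightarrow> \<one>\<^bsub>gr_part R \<mm> N 0\<^esub>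
   | Suc j \<Rightarrow> (\<Union>x\<in>u j. adic_part R \<mm> N (Suc (Suc j)) +>\<^bsub>N\<^esub> f x))"

definition lin_cycles ::
  "('a, 'm) ring_scheme \<Rightarrow> 'a set \<Rightarrow> (nat \<Rightarrow> ('a, 'f) module) \<Rightarrow> (nat \<Rightarrow> 'f \<Rightarrow> 'f) \<Rightarrow> nat
    \<Rightarrow> (nat \<Rightarrow> 'f set) set" where
  "lin_cycles R \<mm> F d i = (case i of
     0 \<Rightarrow> carrier (gr R \<mm> (F 0))
   | Suc j \<Rightarrow> kernel (gr R \<mm> (F (Suc j))) (gr R \<mm> (F j)) (lin_map R \<mm> (F j) (d j)))"

definition lin_homology ::
  "('a, 'm) ring_scheme \<Rightarrow> 'a set \<Rightarrow> (nat \<Rightarrow> ('a, 'f) module) \<Rightarrow> (nat \<Rightarrow> 'f \<Rightarrow> 'f) \<Rightarrow> nat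
    \<Rightarrow> (nat \<Rightarrow> 'f set) set monoid" where
  "lin_homology R \<mm> F d i =
     (gr R \<mm> (F i))\<lparr>carrier := lin_cycles R \<mm> F d i\<rparr>
       Mod (lin_map R \<mm> (F i) (d i) ` carrier (gr R \<mm> (F (Suc i))))"


section \<open>Linearity defect\<close>

text \<open>Minimal free resolutions are unique up to isomorphism, so any choice will do. The type
  \<^typ>\<open>nat \<Rightarrow> 'a\<close> of the elements of the free modules is large enough, as it
  accommodates the modules \<open>{..<b} \<rightarrow>\<^sub>E carrier R\<close>. The supremum of the empty set in
  \<^typ>\<open>enat\<close> is \<open>0\<close>, which gives the zero module linearity defect \<open>0\<close>.\<close>

definition linearity_defect ::
  "('a, 'm) ring_scheme \<Rightarrow> 'a set \<Rightarrow> ('a, 'b) module \<Rightarrow> enat" where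
  "linearity_defect R \<mm> M =
    (let (F, d) = (SOME (F :: nat \<Rightarrow> ('a, nat \<Rightarrow> 'a) module, d).
                     \<exists>\<epsilon>. minimal_free_resolution R \<mm> M F d \<epsilon>)
     in Sup {enat i | i. \<not> trivial_group (lin_homology R \<mm> F d i)})"

end

theory Submission
  imports Defs
begin

text \<open>
  Let \<open>D = ld(k)\<close> be finite, let \<open>K\<close> be a minimal free resolution of \<open>k\<close>, and let \<open>F\<close> be one of
  \<open>\<mm>\<^sup>n\<close>. The linear part of \<open>F\<close> has no homology above degree \<open>D\<close> if and only if for all \<open>i \<ge> D\<close> the
  differential \<open>d\<close> from \<open>F\<^sub>i\<^sub>+\<^sub>1\<close> to \<open>F\<^sub>i\<close> satisfies \<open>d(F\<^sub>i\<^sub>+\<^sub>1) \<inter> \<mm>\<^sup>q\<^sup>+\<^sup>1F\<^sub>i = d(\<mm>\<^sup>qF\<^sub>i\<^sub>+\<^sub>1)\<close> for all \<open>q\<close>.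
  This lifting property is proved by induction on \<open>n\<close>; for \<open>n = 0\<close> the resolution splits.

  For the step let \<open>F'\<close> resolve \<open>\<mm>\<^sup>n\<^sup>+\<^sup>1\<close> and let \<open>\<phi>\<close> from \<open>F'\<close> to \<open>F\<close> lift the inclusion. The lifting
  property of \<open>K\<close> in degree \<open>i\<close> says that \<open>Tor\<^sub>i(\<mm>\<^sup>n\<^sup>+\<^sup>1, k)\<close> is mapped to zero in \<open>Tor\<^sub>i(\<mm>\<^sup>n, k)\<close>, and
  a zigzag through \<open>F' \<otimes> K\<close> turns this into \<open>\<phi>(F'\<^sub>i) \<subseteq> \<mm>F\<^sub>i\<close>. The cone of \<open>\<phi>\<close> resolves
  \<open>\<mm>\<^sup>n/\<mm>\<^sup>n\<^sup>+\<^sup>1\<close>, a direct sum of copies of \<open>k\<close>, and so inherits the lifting property of \<open>K\<close>. If now \<open>y\<close>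
  in \<open>F'\<^sub>i\<^sub>+\<^sub>1\<close> has \<open>d'y\<close> in \<open>\<mm>\<^sup>q\<^sup>+\<^sup>1F'\<^sub>i\<close>, then \<open>d(\<phi>y) = \<phi>(d'y)\<close> lies in \<open>\<mm>\<^sup>q\<^sup>+\<^sup>2F\<^sub>i\<close>. By induction \<open>\<phi>y\<close>
  is congruent to an element of \<open>\<mm>\<^sup>q\<^sup>+\<^sup>1F\<^sub>i\<^sub>+\<^sub>1\<close> modulo some \<open>dx\<close>, and the lifting property of the cone,
  applied to \<open>(x, y)\<close>, replaces \<open>y\<close> by an element of \<open>\<mm>\<^sup>qF'\<^sub>i\<^sub>+\<^sub>1\<close>.
\<close>

section \<open>Linear maps\<close>

text \<open>The lifting property kills Tor for the following reason. As \<open>K\<close> is free, a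
  cycle of m^(n+1) tensor K in degree i is a cycle of K lying in m^(n+1)K_i. It is a boundary of K:
  for i > 0 by exactness, for i = 0 because the boundaries in degree 0 are mK_0. Lifting with q = n
  makes it the boundary of an element of m^nK_(i+1), that is, a boundary of m^n tensor K. On the
  other side F and F' are minimal, so Tor_i(m^n, k) is F_i/mF_i, and the vanishing of the map is the
  inclusion of phi(F'_i) in mF_i. The zigzag compares these two ways of computing Tor. The obstacle
  is that the cone need not be minimal in degrees where this inclusion is not known, so its linear
  part is not at hand; the lifting property, by contrast, passes along chain homotopies, because the
  homotopies are linear and so respect the m-adic filtration.\<close>

locale linear_map = dom: module R M + cod: module R N
  for R :: "('a, 'm) ring_scheme" (structure) and M :: "('a, 'b) module" and N :: "('a, 'c) module" +
  fixes f :: "'b \<Rightarrow> 'c"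
  assumes mem: "f \<in> module_hom R M N"
begin

lemma closed [simp]: "x \<in> carrier M \<Longrightarrow> f x \<in> carrier N"
  using mem by (auto simp: module_hom_def hom_def)

lemma add [simp]: "x \<in> carrier M \<Longrightarrow> y \<in> carrier M \<Longrightarrow> f (x \<oplus>\<^bsub>M\<^esub> y) = f x \<oplus>\<^bsub>N\<^esub> f y"
  using mem by (auto simp: module_hom_def hom_def)

lemma smult [simp]: "a \<in> carrier R \<Longrightarrow> x \<in> carrier M \<Longrightarrow> f (a \<odot>\<^bsub>M\<^esub> x) = a \<odot>\<^bsub>N\<^esub> f x"
  using mem by (auto simp: module_hom_def)

lemma zero [simp]: "f \<zero>\<^bsub>M\<^esub> = \<zero>\<^bsub>N\<^esub>"
  using smult[of \<zero> "\<zero>\<^bsub>M\<^esub>"] by simp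

lemma neg [simp]: "x \<in> carrier M \<Longrightarrow> f (\<ominus>\<^bsub>M\<^esub> x) = \<ominus>\<^bsub>N\<^esub> f x"
  by (metis add cod.add.inv_equality closed dom.a_inv_closed dom.l_neg zero)

lemma minus [simp]: "x \<in> carrier M \<Longrightarrow> y \<in> carrier M \<Longrightarrow> f (x \<ominus>\<^bsub>M\<^esub> y) = f x \<ominus>\<^bsub>N\<^esub> f y"
  by (simp add: a_minus_def)

lemma finsum: "g \<in> A \<rightarrow> carrier M \<Longrightarrow> f (\<Oplus>\<^bsub>M\<^esub>i\<in>A. g i) = (\<Oplus>\<^bsub>N\<^esub>i\<in>A. f (g i))"
  by (induct A rule: infinite_finite_induct) (auto simp: Pi_def)

lemma image_submodule: assumes "submodule H R M" shows "submodule (f ` H) R N"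
proof (rule cod.submoduleI)
  note H = dom.submoduleE[OF assms]
  show "f ` H \<subseteq> carrier N" using H(1) by auto
  show "\<zero>\<^bsub>N\<^esub> \<in> f ` H"
    using H(1,2,3,5) zero by (metis dom.r_neg ex_in_conv image_eqI subsetD)
  have c: "x \<in> carrier M" if "x \<in> H" for x using that H(1) by blast
  show "\<ominus>\<^bsub>N\<^esub> a \<in> f ` H" if "a \<in> f ` H" for a
  proof -
    from that obtain x where x: "x \<in> H" "a = f x" by blast
    then show ?thesis using c by (intro image_eqI[of _ f "\<ominus>\<^bsub>M\<^esub> x"]) (auto simp: H(3))
  qed
  show "a \<oplus>\<^bsub>N\<^esub> b \<in> f ` H" if "a \<in> f ` H" "b \<in> f ` H" for a b
  proof -
    from that obtain x y where x: "x \<in> H" "a = f x" "y \<in> H" "b = f y" by blast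
    then show ?thesis using c by (intro image_eqI[of _ f "x \<oplus>\<^bsub>M\<^esub> y"]) (auto simp: H(5))
  qed
  show "a \<odot>\<^bsub>N\<^esub> y \<in> f ` H" if "a \<in> carrier R" "y \<in> f ` H" for a y
  proof -
    from that obtain x where x: "x \<in> H" "y = f x" by blast
    then show ?thesis using c that(1) by (intro image_eqI[of _ f "a \<odot>\<^bsub>M\<^esub> x"]) (auto simp: H(4))
  qed
qed

lemma vimage_submodule: assumes "submodule H R N" shows "submodule {x \<in> carrier M. f x \<in> H} R M"
proof -
  note H = cod.submoduleE[OF assms]
  have z: "\<zero>\<^bsub>N\<^esub> \<in> H" using H by (metis cod.r_neg ex_in_conv subsetD)
  show ?thesis by (rule dom.submoduleI) (auto simp: H z)
qed

end

lemma linear_mapI: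
  fixes R (structure)
  assumes "module R M" "module R N" "\<And>x. x \<in> carrier M \<Longrightarrow> f x \<in> carrier N"
    "\<And>x y. \<lbrakk>x \<in> carrier M; y \<in> carrier M\<rbrakk> \<Longrightarrow> f (x \<oplus>\<^bsub>M\<^esub> y) = f x \<oplus>\<^bsub>N\<^esub> f y"
    "\<And>a x. \<lbrakk>a \<in> carrier R; x \<in> carrier M\<rbrakk> \<Longrightarrow> f (a \<odot>\<^bsub>M\<^esub> x) = a \<odot>\<^bsub>N\<^esub> f x"
  shows "linear_map R M N f"
  using assms by (auto simp: linear_map_def linear_map_axioms_def module_hom_def hom_def)

lemma linear_map_iff:
  "linear_map R M N f \<longleftrightarrow> module R M \<and> module R N \<and> f \<in> module_hom R M N"
  by (auto simp: linear_map_def linear_map_axioms_def)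

lemma linear_map_cong:
  assumes "linear_map R M N f" "\<And>x. x \<in> carrier M \<Longrightarrow> f x = g x"
  shows "linear_map R M N g"
proof -
  interpret f: linear_map R M N f by fact
  show ?thesis
    by (rule linear_mapI) (simp_all add: assms(2)[symmetric] f.dom.module_axioms f.cod.module_axioms)
qed

lemma linear_map_id: "module R M \<Longrightarrow> linear_map R M M (\<lambda>x. x)"
  by (rule linear_mapI) auto

lemma linear_map_comp:
  assumes "linear_map R M N f" "linear_map R N P g"
  shows "linear_map R M P (\<lambda>x. g (f x))"
proof -
  interpret f: linear_map R M N f by fact
  interpret g: linear_map R N P g by fact
  show ?thesis by (rule linear_mapI) (auto simp: f.dom.module_axioms g.cod.module_axioms)
qed

lemma linear_map_zero: assumes "module R M" "module R N" shows "linear_map R M N (\<lambda>x. \<zero>\<^bsub>N\<^esub>)"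
proof -
  interpret N: module R N by fact
  show ?thesis by (rule linear_mapI) (auto simp: assms)
qed

lemma linear_map_add:
  assumes "linear_map R M N f" "linear_map R M N g"
  shows "linear_map R M N (\<lambda>x. f x \<oplus>\<^bsub>N\<^esub> g x)"
proof -
  interpret f: linear_map R M N f by fact
  interpret g: linear_map R M N g by fact
  show ?thesis
    by (rule linear_mapI) (auto simp: f.dom.module_axioms f.cod.module_axioms f.cod.a_ac f.cod.smult_r_distr)
qed

lemma linear_map_neg:
  assumes "linear_map R M N f"
  shows "linear_map R M N (\<lambda>x. \<ominus>\<^bsub>N\<^esub> f x)"
proof -
  interpret f: linear_map R M N f by fact
  show ?thesis
    by (rule linear_mapI)
      (auto simp: f.dom.module_axioms f.cod.module_axioms f.cod.minus_add f.cod.smult_r_minus)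
qed

lemma linear_map_minus:
  assumes "linear_map R M N f" "linear_map R M N g"
  shows "linear_map R M N (\<lambda>x. f x \<ominus>\<^bsub>N\<^esub> g x)"
  using linear_map_add[OF assms(1) linear_map_neg[OF assms(2)]] by (simp add: a_minus_def)

lemma linear_map_finsum:
  assumes "module R M" "module R N" "finite A" "\<And>i. i \<in> A \<Longrightarrow> linear_map R M N (f i)"
  shows "linear_map R M N (\<lambda>x. \<Oplus>\<^bsub>N\<^esub>i\<in>A. f i x)"
  using assms(3,4)
proof (induct A rule: finite_induct)
  case empty
  interpret N: module R N by fact
  show ?case using linear_map_zero[OF assms(1,2)] by simp
next
  case (insert a A)
  interpret N: module R N by fact
  have cl: "f i x \<in> carrier N" if "i \<in> insert a A" "x \<in> carrier M" for i x
    using insert(4)[OF that(1)] that(2) by (rule linear_map.closed)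
  have "linear_map R M N (\<lambda>x. f a x \<oplus>\<^bsub>N\<^esub> (\<Oplus>\<^bsub>N\<^esub>i\<in>A. f i x))"
    using insert by (intro linear_map_add) auto
  then show ?case
    by (rule linear_map_cong) (use insert(1,2) cl in \<open>simp add: Pi_def\<close>)
qed

lemma (in module) finsum_mem_submodule:
  assumes "submodule H R M" "\<And>i. i \<in> A \<Longrightarrow> g i \<in> H"
  shows "(\<Oplus>\<^bsub>M\<^esub>i\<in>A. g i) \<in> H"
proof -
  note H = submoduleE[OF assms(1)]
  have z: "\<zero>\<^bsub>M\<^esub> \<in> H" using H by (metis M.r_neg ex_in_conv subsetD)
  show ?thesis using assms(2)
  proof (induct A rule: infinite_finite_induct)
    case (insert a A)
    then have "g i \<in> carrier M" if "i \<in> insert a A" for i using that H(1) by blast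
    then show ?case using insert H(5) by (simp add: Pi_def)
  qed (auto simp: z)
qed

lemma (in module) submodule_zero: "submodule H R M \<Longrightarrow> \<zero>\<^bsub>M\<^esub> \<in> H"
  using submoduleE by (metis M.r_neg ex_in_conv subsetD)

lemma (in module) submodule_minus:
  assumes "submodule H R M" "x \<in> H" "y \<in> H" shows "x \<ominus>\<^bsub>M\<^esub> y \<in> H"
  using submoduleE(3,5)[OF assms(1)] assms(2,3) by (simp add: a_minus_def)

section \<open>Ideals as modules, products of modules\<close>

lemma ideal_module_simps [simp]:
  "carrier (ideal_module R I) = I"
  "x \<oplus>\<^bsub>ideal_module R I\<^esub> y = x \<oplus>\<^bsub>R\<^esub> y"
  "\<zero>\<^bsub>ideal_module R I\<^esub> = \<zero>\<^bsub>R\<^esub>"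
  "a \<odot>\<^bsub>ideal_module R I\<^esub> x = a \<otimes>\<^bsub>R\<^esub> x"
  by (auto simp: ideal_module_def restrict_scalars_def)

lemma (in cring) module_ideal_module: assumes "ideal I R" shows "module R (ideal_module R I)"
proof -
  interpret I: ideal I R by fact
  show ?thesis
  proof (rule moduleI)
    show "abelian_group (ideal_module R I)"
      by (rule abelian_groupI)
        (auto simp: a_ac I.Icarr intro: I.a_closed intro!: bexI[of _ "\<ominus> x" for x] r_neg l_neg)
  qed (auto simp: is_cring I.I_l_closed l_distr r_distr m_assoc)
qed

abbreviation self_module :: "('a, 'm) ring_scheme \<Rightarrow> ('a, 'a) module" where
  "self_module R \<equiv> ideal_module R (carrier R)"

lemma (in cring) module_self: "module R (self_module R)"
  by (rule module_ideal_module[OF oneideal])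

text \<open>Modules are ring records, so that a multiplication and a unit, which mean nothing, have to be
  given.\<close>

definition prod_module :: "('a, 'b) module \<Rightarrow> ('a, 'c) module \<Rightarrow> ('a, 'b \<times> 'c) module" where
  "prod_module M N = \<lparr>carrier = carrier M \<times> carrier N, monoid.mult = (\<lambda>x y. x), one = (\<zero>\<^bsub>M\<^esub>, \<zero>\<^bsub>N\<^esub>),
    ring.zero = (\<zero>\<^bsub>M\<^esub>, \<zero>\<^bsub>N\<^esub>), ring.add = (\<lambda>x y. (fst x \<oplus>\<^bsub>M\<^esub> fst y, snd x \<oplus>\<^bsub>N\<^esub> snd y)),
    smult = (\<lambda>a x. (a \<odot>\<^bsub>M\<^esub> fst x, a \<odot>\<^bsub>N\<^esub> snd x))\<rparr>"

lemma prod_module_simps [simp]: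
  "carrier (prod_module M N) = carrier M \<times> carrier N"
  "\<zero>\<^bsub>prod_module M N\<^esub> = (\<zero>\<^bsub>M\<^esub>, \<zero>\<^bsub>N\<^esub>)"
  "x \<oplus>\<^bsub>prod_module M N\<^esub> y = (fst x \<oplus>\<^bsub>M\<^esub> fst y, snd x \<oplus>\<^bsub>N\<^esub> snd y)"
  "a \<odot>\<^bsub>prod_module M N\<^esub> x = (a \<odot>\<^bsub>M\<^esub> fst x, a \<odot>\<^bsub>N\<^esub> snd x)"
  by (auto simp: prod_module_def)

lemma module_prod: assumes "module R M" "module R N" shows "module R (prod_module M N)"
proof -
  interpret M: module R M by fact
  interpret N: module R N by fact
  show ?thesis
  proof (rule moduleI)
    show "abelian_group (prod_module M N)"
      by (rule abelian_groupI)
        (auto simp: M.a_ac N.a_ac intro: bexI[of _ "\<ominus>\<^bsub>M\<^esub> x" for x] bexI[of _ "\<ominus>\<^bsub>N\<^esub> x" for x] M.l_neg N.l_neg)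
  qed (auto simp: M.is_cring M.smult_l_distr N.smult_l_distr M.smult_r_distr N.smult_r_distr
        M.smult_assoc1 N.smult_assoc1)
qed

lemma linear_map_fst: "module R M \<Longrightarrow> module R N \<Longrightarrow> linear_map R (prod_module M N) M fst"
  by (rule linear_mapI) (auto simp: module_prod)

lemma linear_map_snd: "module R M \<Longrightarrow> module R N \<Longrightarrow> linear_map R (prod_module M N) N snd"
  by (rule linear_mapI) (auto simp: module_prod)

lemma linear_map_Pair:
  "linear_map R P M f \<Longrightarrow> linear_map R P N g \<Longrightarrow> linear_map R P (prod_module M N) (\<lambda>x. (f x, g x))"
  by (auto simp: linear_map_iff module_prod module_hom_def hom_def)

section \<open>Finite free modules\<close>

text \<open>The coordinates are given as linear functionals, a dual basis. A linear map out of
  \<open>M\<close> can then be written down as a combination of functionals, so that its linearity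
  is automatic, and coordinates inherit all facts about functionals, such as compatibility with
  powers of an ideal.\<close>

definition free_basis ::
  "('a, 'm) ring_scheme \<Rightarrow> ('a, 'b) module \<Rightarrow> 'i set \<Rightarrow> ('i \<Rightarrow> 'b) \<Rightarrow> ('i \<Rightarrow> 'b \<Rightarrow> 'a) \<Rightarrow> bool" where
  "free_basis R M I e c \<longleftrightarrow> finite I \<and>
     (\<forall>i\<in>I. e i \<in> carrier M \<and> linear_map R M (self_module R) (c i)) \<and>
     (\<forall>x\<in>carrier M. x = (\<Oplus>\<^bsub>M\<^esub>i\<in>I. c i x \<odot>\<^bsub>M\<^esub> e i)) \<and>
     (\<forall>i\<in>I. \<forall>j\<in>I. c i (e j) = (if i = j then \<one>\<^bsub>R\<^esub> else \<zero>\<^bsub>R\<^esub>))"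

lemma free_basisD:
  assumes "free_basis R M I e c"
  shows "finite I" "i \<in> I \<Longrightarrow> e i \<in> carrier M" "i \<in> I \<Longrightarrow> linear_map R M (self_module R) (c i)"
    "x \<in> carrier M \<Longrightarrow> (\<Oplus>\<^bsub>M\<^esub>i\<in>I. c i x \<odot>\<^bsub>M\<^esub> e i) = x"
    "i \<in> I \<Longrightarrow> j \<in> I \<Longrightarrow> c i (e j) = (if i = j then \<one>\<^bsub>R\<^esub> else \<zero>\<^bsub>R\<^esub>)"
    "i \<in> I \<Longrightarrow> x \<in> carrier M \<Longrightarrow> c i x \<in> carrier R"
  using assms linear_map.closed[of R M "self_module R" "c i" x] by (auto simp: free_basis_def)

definition lin_comb :: "('a, 'b) module \<Rightarrow> 'i set \<Rightarrow> ('i \<Rightarrow> 'a) \<Rightarrow> ('i \<Rightarrow> 'b) \<Rightarrow> 'b" where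
  "lin_comb M I a x = (\<Oplus>\<^bsub>M\<^esub>i\<in>I. a i \<odot>\<^bsub>M\<^esub> x i)"

lemma linear_map_lin_comb:
  assumes "module R M" "module R N" "finite I" "\<And>i. i \<in> I \<Longrightarrow> linear_map R M (self_module R) (c i)"
    "\<And>i. i \<in> I \<Longrightarrow> y i \<in> carrier N"
  shows "linear_map R M N (\<lambda>x. lin_comb N I (\<lambda>i. c i x) y)"
  unfolding lin_comb_def
proof (rule linear_map_finsum[OF assms(1-3)])
  fix i assume i: "i \<in> I"
  interpret c: linear_map R M "self_module R" "c i" by (rule assms(4)[OF i])
  interpret N: module R N by fact
  show "linear_map R M N (\<lambda>x. c i x \<odot>\<^bsub>N\<^esub> y i)"
    using c.closed assms(5)[OF i]
    by (intro linear_mapI) (auto simp: assms N.smult_l_distr N.smult_assoc1)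
qed

lemma (in linear_map) lin_comb:
  assumes "\<And>i. i \<in> I \<Longrightarrow> a i \<in> carrier R" "\<And>i. i \<in> I \<Longrightarrow> x i \<in> carrier M"
  shows "f (lin_comb M I a x) = lin_comb N I a (\<lambda>i. f (x i))"
  unfolding lin_comb_def using assms by (subst finsum) (auto intro!: cod.finsum_cong' simp: Pi_def)

lemma lin_comb_cong:
  assumes "module R M" "\<And>i. i \<in> I \<Longrightarrow> a i = b i" "\<And>i. i \<in> I \<Longrightarrow> x i = y i"
    "\<And>i. i \<in> I \<Longrightarrow> b i \<in> carrier R" "\<And>i. i \<in> I \<Longrightarrow> y i \<in> carrier M"
  shows "lin_comb M I a x = lin_comb M I b y"
proof -
  interpret M: module R M by fact
  show ?thesis unfolding lin_comb_def using assms by (intro M.finsum_cong') auto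
qed

lemma lin_comb_closed [intro]:
  assumes "module R M" "\<And>i. i \<in> I \<Longrightarrow> a i \<in> carrier R" "\<And>i. i \<in> I \<Longrightarrow> x i \<in> carrier M"
  shows "lin_comb M I a x \<in> carrier M"
proof -
  interpret M: module R M by fact
  show ?thesis unfolding lin_comb_def using assms by (intro M.finsum_closed) auto
qed

lemma free_basis_expand:
  "free_basis R M I e c \<Longrightarrow> x \<in> carrier M \<Longrightarrow> lin_comb M I (\<lambda>i. c i x) e = x"
  by (simp add: free_basisD(4) lin_comb_def)

lemma lin_comb_kronecker:
  assumes "module R M" "finite I" "j \<in> I" "\<And>i. i \<in> I \<Longrightarrow> x i \<in> carrier M"
  shows "lin_comb M I (\<lambda>i. if i = j then \<one>\<^bsub>R\<^esub> else \<zero>\<^bsub>R\<^esub>) x = x j"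
proof -
  interpret M: module R M by fact
  have "lin_comb M I (\<lambda>i. if i = j then \<one>\<^bsub>R\<^esub> else \<zero>\<^bsub>R\<^esub>) x = (\<Oplus>\<^bsub>M\<^esub>i\<in>I. if j = i then x i else \<zero>\<^bsub>M\<^esub>)"
    unfolding lin_comb_def using assms by (intro M.finsum_cong') auto
  then show ?thesis using assms by (simp add: M.finsum_singleton Pi_def)
qed

lemma free_basis_coord:
  assumes "free_basis R M I e c" "module R M" "j \<in> I" "\<And>i. i \<in> I \<Longrightarrow> a i \<in> carrier R"
  shows "c j (lin_comb M I a e) = a j"
proof -
  note fb = free_basisD[OF assms(1)]
  interpret c: linear_map R M "self_module R" "c j" by (rule fb(3)[OF assms(3)])
  have "c j (lin_comb M I a e) = lin_comb (self_module R) I a (\<lambda>i. c j (e i))"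
    using fb assms(4) by (intro c.lin_comb) auto
  also have "\<dots> = lin_comb (self_module R) I (\<lambda>i. if i = j then \<one>\<^bsub>R\<^esub> else \<zero>\<^bsub>R\<^esub>) a"
    using assms fb(5) unfolding lin_comb_def by (intro c.cod.finsum_cong') (auto simp: Pi_def)
  also have "\<dots> = a j"
    using fb(1) assms by (intro lin_comb_kronecker c.cod.module_axioms) auto
  finally show ?thesis .
qed

text \<open>Projectivity: preimages under \<open>g\<close> are chosen for the values of
  \<open>f\<close> on the basis vectors, and the coordinate functionals extend this choice
  linearly.\<close>

lemma free_basis_lift:
  assumes "free_basis R P I e c" "linear_map R P N f" "linear_map R Q N g"
    and im: "f ` carrier P \<subseteq> g ` carrier Q"
  obtains h where "linear_map R P Q h" "\<And>x. x \<in> carrier P \<Longrightarrow> g (h x) = f x"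
proof -
  note fb = free_basisD[OF assms(1)]
  interpret f: linear_map R P N f by fact
  interpret g: linear_map R Q N g by fact
  have "\<forall>i\<in>I. \<exists>q\<in>carrier Q. g q = f (e i)" using im fb(2) by fastforce
  then obtain q where q: "\<And>i. i \<in> I \<Longrightarrow> q i \<in> carrier Q" "\<And>i. i \<in> I \<Longrightarrow> g (q i) = f (e i)"
    by metis
  let ?h = "\<lambda>x. lin_comb Q I (\<lambda>i. c i x) q"
  have "linear_map R P Q ?h"
    by (rule linear_map_lin_comb) (auto simp: f.dom.module_axioms g.dom.module_axioms fb q)
  moreover have "g (?h x) = f x" if x: "x \<in> carrier P" for x
  proof -
    have "g (?h x) = lin_comb N I (\<lambda>i. c i x) (\<lambda>i. g (q i))"
      using fb x q by (intro g.lin_comb) auto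
    also have "\<dots> = lin_comb N I (\<lambda>i. c i x) (\<lambda>i. f (e i))"
      using fb x q by (intro lin_comb_cong[OF f.cod.module_axioms]) auto
    also have "\<dots> = f (lin_comb P I (\<lambda>i. c i x) e)"
      using fb x by (intro f.lin_comb[symmetric]) auto
    finally show ?thesis by (simp add: free_basis_expand[OF assms(1) x])
  qed
  ultimately show ?thesis by (rule that)
qed

lemma free_basis_reindex:
  assumes "free_basis R M I e c" "module R M" "bij_betw h J I"
  shows "free_basis R M J (\<lambda>j. e (h j)) (\<lambda>j. c (h j))"
proof -
  note fb = free_basisD[OF assms(1)]
  interpret M: module R M by fact
  have hJ: "h ` J = I" "inj_on h J" "finite J" using assms(3) fb(1)
    by (auto simp: bij_betw_def dest: finite_imageD)
  have "(\<Oplus>\<^bsub>M\<^esub>j\<in>J. c (h j) x \<odot>\<^bsub>M\<^esub> e (h j)) = x" if x: "x \<in> carrier M" for x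
    using M.finsum_reindex[of "\<lambda>i. c i x \<odot>\<^bsub>M\<^esub> e i" h J] fb(2,4,6) x hJ by (auto simp: Pi_def)
  then show ?thesis
    using hJ fb unfolding free_basis_def by (auto simp: inj_on_def)
qed

text \<open>The index type is fixed to \<open>nat\<close> because a type cannot be quantified over;
  \<open>fin_freeI\<close> renumbers any other finite basis.\<close>

definition fin_free :: "('a, 'm) ring_scheme \<Rightarrow> ('a, 'b) module \<Rightarrow> bool" where
  "fin_free R M \<longleftrightarrow> module R M \<and> (\<exists>(n::nat) e c. free_basis R M {..<n} e c)"

lemma fin_freeI: assumes "module R M" "free_basis R M I e c" shows "fin_free R M"
proof -
  obtain h where "bij_betw h {..<card I} I"
    using ex_bij_betw_nat_finite[OF free_basisD(1)[OF assms(2)]] by (auto simp: atLeast0LessThan)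
  then show ?thesis
    using free_basis_reindex[OF assms(2,1)] assms(1) unfolding fin_free_def by fast
qed

lemma fin_free_lift:
  assumes "fin_free R P" "linear_map R P N f" "linear_map R Q N g"
    and "f ` carrier P \<subseteq> g ` carrier Q"
  obtains h where "linear_map R P Q h" "\<And>x. x \<in> carrier P \<Longrightarrow> g (h x) = f x"
  using assms free_basis_lift unfolding fin_free_def by metis

text \<open>Uniqueness of coefficients gives both the linearity of the coordinates and the Kronecker
  relations: in each case an evident expansion has to be the chosen one.\<close>

lemma finite_basis_imp_fin_free:
  assumes "module R M" "finite_basis R M B" shows "fin_free R M"
proof -
  interpret M: module R M by fact
  have B: "finite B" "B \<subseteq> carrier M" and
    ex: "\<And>x. x \<in> carrier M \<Longrightarrow> \<exists>!c. c \<in> B \<rightarrow>\<^sub>E carrier R \<and> x = (\<Oplus>\<^bsub>M\<^esub>b\<in>B. c b \<odot>\<^bsub>M\<^esub> b)"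
    using assms(2) by (auto simp: finite_basis_def)
  define k where "k x = (THE c. c \<in> B \<rightarrow>\<^sub>E carrier R \<and> x = (\<Oplus>\<^bsub>M\<^esub>b\<in>B. c b \<odot>\<^bsub>M\<^esub> b))" for x
  have k: "k x \<in> B \<rightarrow>\<^sub>E carrier R" "(\<Oplus>\<^bsub>M\<^esub>b\<in>B. k x b \<odot>\<^bsub>M\<^esub> b) = x" if "x \<in> carrier M" for x
    using theI'[OF ex[OF that]] by (auto simp: k_def[symmetric])
  have kk: "k x b \<in> carrier R" if "x \<in> carrier M" "b \<in> B" for x b
    using k(1)[OF that(1)] that(2) by auto
  have uniq: "k x b = c b"
    if "b \<in> B" "\<And>b. b \<in> B \<Longrightarrow> c b \<in> carrier R" "x = (\<Oplus>\<^bsub>M\<^esub>b\<in>B. c b \<odot>\<^bsub>M\<^esub> b)" for x b c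
  proof -
    have x: "x \<in> carrier M" unfolding that(3) using that(2) B(2) by (intro M.finsum_closed) auto
    \<comment> \<open>Uniqueness in \<open>finite_basis\<close> speaks of extensional coefficient
      functions, so an arbitrary one is first cut down to \<open>B\<close>.\<close>
    have "x = (\<Oplus>\<^bsub>M\<^esub>b\<in>B. restrict c B b \<odot>\<^bsub>M\<^esub> b)"
      unfolding that(3) using that(2) B(2) by (intro M.finsum_cong') auto
    moreover have "restrict c B \<in> B \<rightarrow>\<^sub>E carrier R" using that(2) by auto
    ultimately have "k x = restrict c B" using ex1E[OF ex[OF x]] k(1)[OF x] k(2)[OF x, symmetric] by blast
    then show ?thesis using that(1) by simp
  qed
  have lin: "linear_map R M (self_module R) (\<lambda>x. k x b)" if b: "b \<in> B" for b
  proof (rule linear_mapI)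
    show "module R (self_module R)" by (rule M.module_self)
    show "k (x \<oplus>\<^bsub>M\<^esub> y) b = k x b \<oplus>\<^bsub>self_module R\<^esub> k y b" if "x \<in> carrier M" "y \<in> carrier M" for x y
    proof -
      have "x \<oplus>\<^bsub>M\<^esub> y = (\<Oplus>\<^bsub>M\<^esub>b\<in>B. k x b \<odot>\<^bsub>M\<^esub> b) \<oplus>\<^bsub>M\<^esub> (\<Oplus>\<^bsub>M\<^esub>b\<in>B. k y b \<odot>\<^bsub>M\<^esub> b)"
        using k that by simp
      also have "\<dots> = (\<Oplus>\<^bsub>M\<^esub>b\<in>B. k x b \<odot>\<^bsub>M\<^esub> b \<oplus>\<^bsub>M\<^esub> k y b \<odot>\<^bsub>M\<^esub> b)"
        using kk that B(2) by (intro M.finsum_addf[symmetric]) auto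
      also have "\<dots> = (\<Oplus>\<^bsub>M\<^esub>b\<in>B. (k x b \<oplus>\<^bsub>R\<^esub> k y b) \<odot>\<^bsub>M\<^esub> b)"
        using kk that B(2) by (intro M.finsum_cong') (auto simp: M.smult_l_distr)
      finally show ?thesis using uniq[OF b, of "\<lambda>b. k x b \<oplus>\<^bsub>R\<^esub> k y b"] kk that by auto
    qed
    show "k (a \<odot>\<^bsub>M\<^esub> x) b = a \<odot>\<^bsub>self_module R\<^esub> k x b" if "a \<in> carrier R" "x \<in> carrier M" for a x
    proof -
      have "a \<odot>\<^bsub>M\<^esub> x = a \<odot>\<^bsub>M\<^esub> (\<Oplus>\<^bsub>M\<^esub>b\<in>B. k x b \<odot>\<^bsub>M\<^esub> b)" using k that by simp
      also have "\<dots> = (\<Oplus>\<^bsub>M\<^esub>b\<in>B. a \<odot>\<^bsub>M\<^esub> (k x b \<odot>\<^bsub>M\<^esub> b))"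
        using kk that B by (intro M.finsum_smult_ldistr) auto
      also have "\<dots> = (\<Oplus>\<^bsub>M\<^esub>b\<in>B. (a \<otimes>\<^bsub>R\<^esub> k x b) \<odot>\<^bsub>M\<^esub> b)"
        using kk that B(2) by (intro M.finsum_cong') (auto simp: M.smult_assoc1)
      finally show ?thesis using uniq[OF b, of "\<lambda>b. a \<otimes>\<^bsub>R\<^esub> k x b"] kk that by auto
    qed
  qed (use assms kk b in auto)
  have kron: "k j i = (if i = j then \<one>\<^bsub>R\<^esub> else \<zero>\<^bsub>R\<^esub>)" if "i \<in> B" "j \<in> B" for i j
  proof (rule uniq[OF that(1)])
    show "j = (\<Oplus>\<^bsub>M\<^esub>b\<in>B. (if b = j then \<one>\<^bsub>R\<^esub> else \<zero>\<^bsub>R\<^esub>) \<odot>\<^bsub>M\<^esub> b)"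
      using lin_comb_kronecker[OF assms(1) B(1) that(2) subsetD[OF B(2)]]
      unfolding lin_comb_def by (rule sym)
  qed auto
  have "free_basis R M B (\<lambda>b. b) (\<lambda>b x. k x b)"
    unfolding free_basis_def using B lin k(2) kron by auto
  then show ?thesis by (rule fin_freeI[OF assms(1)])
qed

lemma fin_free_prod:
  assumes "fin_free R M" "fin_free R N" shows "fin_free R (prod_module M N)"
proof -
  obtain m e c n e' c' where b: "free_basis R M {..<m::nat} e c" "free_basis R N {..<n::nat} e' c'"
    and mods: "module R M" "module R N"
    using assms by (auto simp: fin_free_def)
  note fb = free_basisD[OF b(1)] and fb' = free_basisD[OF b(2)]
  let ?P = "prod_module M N" and ?I = "{..<m} <+> {..<n}"
  interpret M: module R M by fact
  interpret N: module R N by fact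
  interpret P: module R ?P by (rule module_prod) fact+
  have i1: "linear_map R M ?P (\<lambda>x. (x, \<zero>\<^bsub>N\<^esub>))"
    by (intro linear_map_Pair linear_map_id linear_map_zero mods)
  have i2: "linear_map R N ?P (\<lambda>x. (\<zero>\<^bsub>M\<^esub>, x))"
    by (intro linear_map_Pair linear_map_id linear_map_zero mods)
  define E where "E = case_sum (\<lambda>i. (e i, \<zero>\<^bsub>N\<^esub>)) (\<lambda>i. (\<zero>\<^bsub>M\<^esub>, e' i))"
  define C where "C = case_sum (\<lambda>i p. c i (fst p)) (\<lambda>i p. c' i (snd p))"
  have exp: "(\<Oplus>\<^bsub>?P\<^esub>i\<in>?I. C i x \<odot>\<^bsub>?P\<^esub> E i) = x" if "x \<in> carrier ?P" for x
  proof -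
    obtain u v where x: "x = (u, v)" "u \<in> carrier M" "v \<in> carrier N" using \<open>x \<in> carrier ?P\<close> by auto
    let ?g = "\<lambda>i. C i x \<odot>\<^bsub>?P\<^esub> E i"
    have cl: "?g \<in> Inl ` {..<m} \<rightarrow> carrier ?P" "?g \<in> Inr ` {..<n} \<rightarrow> carrier ?P"
      using fb(2,6) fb'(2,6) x by (auto simp: E_def C_def)
    have "(\<Oplus>\<^bsub>?P\<^esub>i\<in>?I. ?g i) = (\<Oplus>\<^bsub>?P\<^esub>i\<in>Inl ` {..<m}. ?g i) \<oplus>\<^bsub>?P\<^esub> (\<Oplus>\<^bsub>?P\<^esub>i\<in>Inr ` {..<n}. ?g i)"
      unfolding Plus_def by (rule P.finsum_Un_disjoint) (use cl in auto)
    also have "(\<Oplus>\<^bsub>?P\<^esub>i\<in>Inl ` {..<m}. ?g i) = (\<Oplus>\<^bsub>?P\<^esub>i\<in>{..<m}. ?g (Inl i))"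
      by (rule P.finsum_reindex[OF cl(1)]) auto
    also have "\<dots> = (\<Oplus>\<^bsub>?P\<^esub>i\<in>{..<m}. (c i u \<odot>\<^bsub>M\<^esub> e i, \<zero>\<^bsub>N\<^esub>))"
      using fb(2,6) x by (intro P.finsum_cong') (simp_all add: E_def C_def Pi_def)
    also have "\<dots> = (u, \<zero>\<^bsub>N\<^esub>)" using linear_map.finsum[OF i1, of "\<lambda>i. c i u \<odot>\<^bsub>M\<^esub> e i" "{..<m}"] fb(2,4,6) x by (simp add: Pi_def)
    also have "(\<Oplus>\<^bsub>?P\<^esub>i\<in>Inr ` {..<n}. ?g i) = (\<Oplus>\<^bsub>?P\<^esub>i\<in>{..<n}. ?g (Inr i))"
      by (rule P.finsum_reindex[OF cl(2)]) auto
    also have "\<dots> = (\<Oplus>\<^bsub>?P\<^esub>i\<in>{..<n}. (\<zero>\<^bsub>M\<^esub>, c' i v \<odot>\<^bsub>N\<^esub> e' i))"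
      using fb'(2,6) x by (intro P.finsum_cong') (simp_all add: E_def C_def Pi_def)
    also have "\<dots> = (\<zero>\<^bsub>M\<^esub>, v)" using linear_map.finsum[OF i2, of "\<lambda>i. c' i v \<odot>\<^bsub>N\<^esub> e' i" "{..<n}"] fb'(2,4,6) x by (simp add: Pi_def)
    finally show ?thesis using x by simp
  qed
  have l1: "linear_map R ?P (self_module R) (\<lambda>p. g (fst p))"
    if "linear_map R M (self_module R) g" for g
    by (rule linear_map_comp[OF linear_map_fst[OF mods] that])
  have l2: "linear_map R ?P (self_module R) (\<lambda>p. g (snd p))"
    if "linear_map R N (self_module R) g" for g
    by (rule linear_map_comp[OF linear_map_snd[OF mods] that])
  have lin: "E i \<in> carrier ?P \<and> linear_map R ?P (self_module R) (C i)" if "i \<in> ?I" for i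
    using that
    by (elim PlusE) (simp_all add: E_def C_def l1[OF fb(3)] l2[OF fb'(3)] fb(2) fb'(2))
  have kron: "C i (E j) = (if i = j then \<one>\<^bsub>R\<^esub> else \<zero>\<^bsub>R\<^esub>)" if "i \<in> ?I" "j \<in> ?I" for i j
    using that fb(5) fb'(5) linear_map.zero[OF fb(3)] linear_map.zero[OF fb'(3)]
    by (auto simp: E_def C_def split: if_splits)
  have "free_basis R ?P ?I E C"
    unfolding free_basis_def
  proof (intro conjI ballI)
    show "x = (\<Oplus>\<^bsub>?P\<^esub>i\<in>?I. C i x \<odot>\<^bsub>?P\<^esub> E i)" if "x \<in> carrier ?P" for x
      using exp[OF that] by (rule sym)
    show "finite ?I" by simp
  qed (use lin kron in blast)+
  then show ?thesis by (rule fin_freeI[OF P.module_axioms])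
qed

lemma fin_free_zero: assumes "module R M" "carrier M = {\<zero>\<^bsub>M\<^esub>}" shows "fin_free R M"
proof -
  interpret M: module R M by fact
  have "free_basis R M ({}::nat set) (\<lambda>i. \<zero>\<^bsub>M\<^esub>) (\<lambda>i x. \<zero>\<^bsub>R\<^esub>)"
    using assms(2) by (simp add: free_basis_def)
  then show ?thesis by (rule fin_freeI[OF assms(1)])
qed

section \<open>The adic filtration\<close>

locale cring_ideal = R?: cring R + I?: ideal I R for R (structure) and I
begin

abbreviation pow :: "nat \<Rightarrow> 'a set" where "pow n \<equiv> ideal_pow R I n"

abbreviation adic :: "nat \<Rightarrow> ('a, 'c) module \<Rightarrow> 'c set" where "adic n M \<equiv> adic_part R I M n"

section \<open>Powers of an ideal\<close>

lemma pow_0: "pow 0 = carrier R"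
  by (simp add: nat_pow_def ideals_set_def)

lemma pow_Suc: "pow (Suc n) = pow n \<cdot> I"
  by (simp add: nat_pow_def ideals_set_def)

lemma pow_ideal: "ideal (pow n) R"
  by (induct n) (simp_all only: pow_0 pow_Suc oneideal ideal_prod_is_ideal I.ideal_axioms)

lemma pow_1: "pow (Suc 0) = I"
  using ideal_prod_commute[OF oneideal I.ideal_axioms] ideal_prod_one[OF I.ideal_axioms]
  by (simp only: pow_Suc pow_0)

lemma pow_Suc_subset: "pow (Suc n) \<subseteq> pow n"
  using ideal_prod_inter[OF pow_ideal I.ideal_axioms] by (auto simp only: pow_Suc)

lemma pow_carr: "a \<in> pow n \<Longrightarrow> a \<in> carrier R"
  using ideal.Icarr[OF pow_ideal] .

lemma pow_add: "a \<in> pow n \<Longrightarrow> b \<in> pow n \<Longrightarrow> a \<oplus> b \<in> pow n"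
  using additive_subgroup.a_closed[OF ideal.axioms(1)[OF pow_ideal]] .

lemma pow_mult: "a \<in> pow p \<Longrightarrow> b \<in> pow q \<Longrightarrow> a \<otimes> b \<in> pow (p + q)"
proof (induct q arbitrary: b)
  case 0
  then show ?case using ideal.I_r_closed[OF pow_ideal, of a p b] by (simp only: pow_0 add_0_right)
next
  case (Suc q)
  from Suc(3) have "b \<in> pow q \<cdot> I" by (simp only: pow_Suc)
  then have "b \<in> carrier R \<and> a \<otimes> b \<in> pow (p + q) \<cdot> I"
  proof (induct b rule: ideal_prod.induct)
    case (prod i j)
    have "a \<otimes> (i \<otimes> j) = (a \<otimes> i) \<otimes> j"
      using prod Suc(2) by (simp add: m_assoc pow_carr I.Icarr)
    then show ?case using Suc(1)[OF Suc(2) prod(1)] prod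
      by (auto intro: ideal_prod.prod simp: pow_carr I.Icarr)
  next
    case (sum b c)
    then show ?case using pow_carr[OF Suc(2)] by (auto simp: r_distr intro: ideal_prod.sum)
  qed
  then show ?case by (simp only: pow_Suc add_Suc_right)
qed

section \<open>The filtration of a module by the powers of an ideal\<close>

context
  fixes M :: "('a, 'c) module"
  assumes M: "module R M"
begin

interpretation M: module R M by (rule M)

lemma adic_subset: "adic q M \<subseteq> carrier M"
proof
  fix x assume "x \<in> adic q M"
  then have "x \<in> ideal_smult (pow q) M" by (simp only: adic_part_def)
  then show "x \<in> carrier M" by (induct rule: ideal_smult.induct) (auto dest: pow_carr)
qed

lemma adic_carr: "x \<in> adic q M \<Longrightarrow> x \<in> carrier M"
  using adic_subset by blast

lemma adic_smultI: "a \<in> pow q \<Longrightarrow> x \<in> carrier M \<Longrightarrow> a \<odot>\<^bsub>M\<^esub> x \<in> adic q M"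
  unfolding adic_part_def by (rule ideal_smult.smult)

lemma adic_add: "x \<in> adic q M \<Longrightarrow> y \<in> adic q M \<Longrightarrow> x \<oplus>\<^bsub>M\<^esub> y \<in> adic q M"
  unfolding adic_part_def by (rule ideal_smult.sum)

lemma adic_induct [consumes 1, case_names smult add]:
  assumes "x \<in> adic q M"
    and "\<And>a x. a \<in> pow q \<Longrightarrow> x \<in> carrier M \<Longrightarrow> Q (a \<odot>\<^bsub>M\<^esub> x)"
    and "\<And>x y. x \<in> adic q M \<Longrightarrow> Q x \<Longrightarrow> y \<in> adic q M \<Longrightarrow> Q y \<Longrightarrow> Q (x \<oplus>\<^bsub>M\<^esub> y)"
  shows "Q x"
  using assms unfolding adic_part_def by (rule ideal_smult.induct)

lemma adic_smult: "a \<in> pow p \<Longrightarrow> x \<in> adic q M \<Longrightarrow> a \<odot>\<^bsub>M\<^esub> x \<in> adic (p + q) M"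
proof -
  assume a: "a \<in> pow p" and x: "x \<in> adic q M"
  note ca = pow_carr[OF a]
  from x show "a \<odot>\<^bsub>M\<^esub> x \<in> adic (p + q) M"
  proof (induct rule: adic_induct)
    case (smult b x)
    then show ?case
      using adic_smultI[OF pow_mult[OF a smult(1)] smult(2)] ca pow_carr by (simp add: M.smult_assoc1)
  next
    case (add x y)
    then show ?case using ca adic_add adic_carr by (simp add: M.smult_r_distr)
  qed
qed

lemma adic_submodule: "submodule (adic q M) R M"
proof (rule M.submoduleI[OF adic_subset])
  show sm: "a \<odot>\<^bsub>M\<^esub> x \<in> adic q M" if "a \<in> carrier R" "x \<in> adic q M" for a x
    using adic_smult[of a 0 x q] that by (simp only: pow_0 add_0)
  \<comment> \<open>The inductive definition of \<open>ideal_smult\<close> has no clause for zero,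
    so zero is exhibited as a multiple.\<close>
  have "\<zero> \<odot>\<^bsub>M\<^esub> \<zero>\<^bsub>M\<^esub> \<in> adic q M"
    using additive_subgroup.zero_closed[OF ideal.axioms(1)[OF pow_ideal]] by (rule adic_smultI) simp
  then show "\<zero>\<^bsub>M\<^esub> \<in> adic q M" by simp
  show "\<ominus>\<^bsub>M\<^esub> x \<in> adic q M" if "x \<in> adic q M" for x
    using sm[of "\<ominus> \<one>" x] that adic_carr[OF that] by (simp add: M.smult_l_minus)
qed (rule adic_add)

lemma adic_zero: "\<zero>\<^bsub>M\<^esub> \<in> adic q M"
  by (rule M.submodule_zero[OF adic_submodule])

lemma adic_neg: "x \<in> adic q M \<Longrightarrow> \<ominus>\<^bsub>M\<^esub> x \<in> adic q M"
  by (rule M.submoduleE(3)[OF adic_submodule])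

lemma adic_minus: "x \<in> adic q M \<Longrightarrow> y \<in> adic q M \<Longrightarrow> x \<ominus>\<^bsub>M\<^esub> y \<in> adic q M"
  by (rule M.submodule_minus[OF adic_submodule])

lemma adic_0: "adic 0 M = carrier M"
proof
  show "carrier M \<subseteq> adic 0 M"
  proof
    fix x assume x: "x \<in> carrier M"
    have "\<one> \<odot>\<^bsub>M\<^esub> x \<in> adic 0 M" using x by (intro adic_smultI) (auto simp only: pow_0 one_closed)
    then show "x \<in> adic 0 M" using x by simp
  qed
qed (rule adic_subset)

lemma adic_1: "adic (Suc 0) M = ideal_smult I M"
  by (simp only: adic_part_def pow_1)

lemma adic_Suc_subset: "adic (Suc q) M \<subseteq> adic q M"
proof
  fix x assume "x \<in> adic (Suc q) M"
  then show "x \<in> adic q M"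
    by (induct rule: adic_induct) (use pow_Suc_subset adic_smultI adic_add in blast)+
qed

lemma adic_antimono: "p \<le> q \<Longrightarrow> adic q M \<subseteq> adic p M"
  by (induct q rule: dec_induct) (use adic_Suc_subset in blast)+

end

section \<open>Behaviour of the filtration under linear maps\<close>

lemma linear_map_adic_shift:
  assumes "linear_map R M N f" "\<And>x. x \<in> carrier M \<Longrightarrow> f x \<in> adic p N" "x \<in> adic q M"
  shows "f x \<in> adic (q + p) N"
proof -
  interpret f: linear_map R M N f by fact
  show ?thesis using assms(3)
  proof (induct rule: adic_induct[OF f.dom.module_axioms, consumes 1, case_names smult add])
    case (smult a x)
    then show ?case
      using adic_smult[OF f.cod.module_axioms smult(1) assms(2)[OF smult(2)]] pow_carr by simp
  next
    case (add x y)
    then show ?case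
      using adic_add[OF f.cod.module_axioms] adic_carr[OF f.dom.module_axioms] by simp
  qed
qed

lemma linear_map_adic:
  assumes "linear_map R M N f" "x \<in> adic q M" shows "f x \<in> adic q N"
proof -
  interpret f: linear_map R M N f by fact
  show ?thesis
    using linear_map_adic_shift[OF assms(1) _ assms(2), of 0]
    by (simp add: adic_0[OF f.cod.module_axioms])
qed

text \<open>The filtration is generated by multiples, and preimages can be taken multiple by
  multiple. Applied to an augmentation onto I^n, this finds preimages inside I F_0 for the elements
  of I^(n+1).\<close>

lemma linear_map_adic_surj:
  assumes "linear_map R M N f" "f ` carrier M = carrier N" "y \<in> adic q N"
  shows "\<exists>x\<in>adic q M. f x = y"
proof -
  interpret f: linear_map R M N f by fact
  note mods = f.dom.module_axioms f.cod.module_axioms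
  show ?thesis using assms(3)
  proof (induct rule: adic_induct[OF mods(2), consumes 1, case_names smult add])
    case (smult a y)
    have "y \<in> f ` carrier M" using smult(2) by (simp only: assms(2))
    then obtain x where "x \<in> carrier M" "f x = y" by (elim imageE) simp
    then show ?case
      using pow_carr[OF smult(1)] adic_smultI[OF mods(1) smult(1)]
      by (intro bexI[of _ "a \<odot>\<^bsub>M\<^esub> x"]) simp_all
  next
    case (add y y')
    from add(2,4) obtain x x' where x: "x \<in> adic q M" "x' \<in> adic q M" "f x = y" "f x' = y'" by (elim bexE) simp
    then show ?case
      using adic_add[OF mods(1) x(1,2)] adic_carr[OF mods(1) x(1)] adic_carr[OF mods(1) x(2)]
      by (intro bexI[of _ "x \<oplus>\<^bsub>M\<^esub> x'"]) simp_all
  qed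
qed

lemma adic_self: assumes "x \<in> adic q (self_module R)" shows "x \<in> pow q"
  using assms
proof (induct rule: adic_induct[OF module_self, consumes 1, case_names smult add])
  case (smult a x)
  then show ?case using ideal.I_r_closed[OF pow_ideal] by simp
next
  case (add x y)
  then show ?case by (simp only: ideal_module_simps pow_add)
qed

lemma adic_functional:
  "linear_map R M (self_module R) c \<Longrightarrow> x \<in> adic q M \<Longrightarrow> c x \<in> pow q"
  by (rule adic_self[OF linear_map_adic])

lemma adic_lin_comb:
  assumes "module R M" "\<And>i. i \<in> A \<Longrightarrow> a i \<in> pow p" "\<And>i. i \<in> A \<Longrightarrow> x i \<in> adic q M"
  shows "lin_comb M A a x \<in> adic (p + q) M"
  unfolding lin_comb_def
  by (rule module.finsum_mem_submodule[OF assms(1) adic_submodule[OF assms(1)]])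
    (rule adic_smult[OF assms(1-3)])

lemma adic_prod:
  assumes M: "module R M" and N: "module R N"
  shows "p \<in> adic q (prod_module M N) \<longleftrightarrow> fst p \<in> adic q M \<and> snd p \<in> adic q N"
proof
  assume "p \<in> adic q (prod_module M N)"
  then show "fst p \<in> adic q M \<and> snd p \<in> adic q N"
    using linear_map_adic[OF linear_map_fst[OF assms]] linear_map_adic[OF linear_map_snd[OF assms]]
    by blast
next
  interpret M: module R M by fact
  interpret N: module R N by fact
  assume p: "fst p \<in> adic q M \<and> snd p \<in> adic q N"
  have "(fst p, \<zero>\<^bsub>N\<^esub>) \<in> adic q (prod_module M N)"
    by (rule linear_map_adic[OF linear_map_Pair[OF linear_map_id[OF M] linear_map_zero[OF M N]]])
      (use p in blast)
  moreover have "(\<zero>\<^bsub>M\<^esub>, snd p) \<in> adic q (prod_module M N)"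
    by (rule linear_map_adic[OF linear_map_Pair[OF linear_map_zero[OF N M] linear_map_id[OF N]]])
      (use p in blast)
  ultimately have "(fst p, \<zero>\<^bsub>N\<^esub>) \<oplus>\<^bsub>prod_module M N\<^esub> (\<zero>\<^bsub>M\<^esub>, snd p) \<in> adic q (prod_module M N)"
    by (rule adic_add[OF module_prod[OF assms]])
  then show "p \<in> adic q (prod_module M N)"
    using adic_carr[OF M, of "fst p" q] adic_carr[OF N, of "snd p" q] p by simp
qed

text \<open>Here two consecutive powers meet: the multiples of I inside the module I^n are exactly
  what the resolution of I^(n+1) covers. The boundaries of the cone in degree 0 are computed from
  this.\<close>

lemma adic_ideal_module: "adic (Suc 0) (ideal_module R (pow n)) = pow (Suc n)"
proof
  note mod = module_ideal_module[OF pow_ideal[of n]]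
  show "adic (Suc 0) (ideal_module R (pow n)) \<subseteq> pow (Suc n)"
  proof
    fix x assume "x \<in> adic (Suc 0) (ideal_module R (pow n))"
    then show "x \<in> pow (Suc n)"
    proof (induct rule: adic_induct[OF mod, consumes 1, case_names smult add])
      case (smult a x)
      then show ?case using pow_mult[of a "Suc 0" x n] by (simp only: ideal_module_simps add_Suc add_0)
    next
      case (add x y)
      then show ?case by (simp only: ideal_module_simps pow_add)
    qed
  qed
  show "pow (Suc n) \<subseteq> adic (Suc 0) (ideal_module R (pow n))"
  proof
    fix x assume "x \<in> pow (Suc n)"
    then have "x \<in> pow n \<cdot> I" by (simp only: pow_Suc)
    then show "x \<in> adic (Suc 0) (ideal_module R (pow n))"
    proof (induct x rule: ideal_prod.induct)
      case (prod i j)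
      have "j \<odot>\<^bsub>ideal_module R (pow n)\<^esub> i \<in> adic (Suc 0) (ideal_module R (pow n))"
        by (rule adic_smultI[OF mod]) (use prod in \<open>simp_all only: pow_1 ideal_module_simps\<close>)
      then show ?case using prod by (simp add: m_comm pow_carr I.Icarr)
    next
      case (sum x y)
      then show ?case using adic_add[OF mod] by simp
    qed
  qed
qed

text \<open>For the differentials of a minimal free resolution, this property in all degrees from \<open>i\<close> on
  means that the linear part has no homology above degree \<open>i\<close>. Unlike the homology itself, it makes
  sense for complexes that are not minimal.\<close>

definition adic_lifting :: "('a, 'c) module \<Rightarrow> ('a, 'd) module \<Rightarrow> ('c \<Rightarrow> 'd) \<Rightarrow> bool" where
  "adic_lifting M N d \<longleftrightarrow>
     (\<forall>q. \<forall>y\<in>carrier M. d y \<in> adic (Suc q) N \<longrightarrow> (\<exists>z\<in>adic q M. d z = d y))"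

lemma adic_liftingD:
  "adic_lifting M N d \<Longrightarrow> y \<in> carrier M \<Longrightarrow> d y \<in> adic (Suc q) N \<Longrightarrow> \<exists>z\<in>adic q M. d z = d y"
  by (simp only: adic_lifting_def)

end

section \<open>Free acyclic complexes\<close>

locale free_acyclic =
  fixes R :: "('a, 'm) ring_scheme" (structure) and P :: "nat \<Rightarrow> ('a, 'p) module" and d :: "nat \<Rightarrow> 'p \<Rightarrow> 'p"
  assumes free: "fin_free R (P i)"
    and d_linear: "linear_map R (P (Suc i)) (P i) (d i)"
    and exact: "a_kernel (P (Suc i)) (P i) (d i) = d (Suc i) ` carrier (P (Suc (Suc i)))"
begin

lemma mod: "module R (P i)"
  using free[of i] by (simp add: fin_free_def)

lemma d_d: "x \<in> carrier (P (Suc (Suc i))) \<Longrightarrow> d i (d (Suc i) x) = \<zero>\<^bsub>P i\<^esub>"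
  using exact[of i] by (auto simp: a_kernel_def')

lemma cycle_is_boundary:
  "x \<in> carrier (P (Suc i)) \<Longrightarrow> d i x = \<zero>\<^bsub>P i\<^esub> \<Longrightarrow> \<exists>y\<in>carrier (P (Suc (Suc i))). d (Suc i) y = x"
proof -
  assume "x \<in> carrier (P (Suc i))" "d i x = \<zero>\<^bsub>P i\<^esub>"
  then have "x \<in> d (Suc i) ` carrier (P (Suc (Suc i)))" by (simp add: exact[symmetric] a_kernel_def')
  then show ?thesis by blast
qed

text \<open>The usual null homotopy of the identity minus \<open>\<theta>\<close>:
  \<open>x - \<theta> x - h (d x)\<close> is a cycle, and lifting it gives the next
  \<open>h\<close>. Only the effect on boundaries is recorded. There the summand
  \<open>h (d x)\<close> disappears, and the lifting property involves nothing else.\<close>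

lemma boundary_homotopy:
  assumes lin: "\<And>i. linear_map R (P i) (P i) (\<theta> i)"
    and chain: "\<And>i x. x \<in> carrier (P (Suc i)) \<Longrightarrow> d i (\<theta> (Suc i) x) = \<theta> i (d i x)"
    and start: "\<And>x. x \<in> carrier (P 0) \<Longrightarrow> x \<ominus>\<^bsub>P 0\<^esub> \<theta> 0 x \<in> d 0 ` carrier (P (Suc 0))"
  shows "\<exists>h. linear_map R (P i) (P (Suc i)) h \<and>
    (\<forall>c\<in>carrier (P (Suc i)). d i (h (d i c)) = d i c \<ominus>\<^bsub>P i\<^esub> \<theta> i (d i c))"
proof (induct i)
  case 0
  have l: "linear_map R (P 0) (P 0) (\<lambda>x. x \<ominus>\<^bsub>P 0\<^esub> \<theta> 0 x)"
    by (rule linear_map_minus[OF linear_map_id[OF mod] lin])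
  obtain h where h: "linear_map R (P 0) (P (Suc 0)) h"
    "\<And>x. x \<in> carrier (P 0) \<Longrightarrow> d 0 (h x) = x \<ominus>\<^bsub>P 0\<^esub> \<theta> 0 x"
    by (rule fin_free_lift[OF free l d_linear]) (use start in auto)
  then show ?case using linear_map.closed[OF d_linear] by blast
next
  case (Suc i)
  then obtain h where h: "linear_map R (P i) (P (Suc i)) h"
    "\<And>c. c \<in> carrier (P (Suc i)) \<Longrightarrow> d i (h (d i c)) = d i c \<ominus>\<^bsub>P i\<^esub> \<theta> i (d i c)" by blast
  interpret h: linear_map R "P i" "P (Suc i)" h by (rule h(1))
  interpret d: linear_map R "P (Suc i)" "P i" "d i" by (rule d_linear)
  interpret d': linear_map R "P (Suc (Suc i))" "P (Suc i)" "d (Suc i)" by (rule d_linear)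
  interpret t: linear_map R "P (Suc i)" "P (Suc i)" "\<theta> (Suc i)" by (rule lin)
  interpret t0: linear_map R "P i" "P i" "\<theta> i" by (rule lin)
  let ?f = "\<lambda>c. c \<ominus>\<^bsub>P (Suc i)\<^esub> \<theta> (Suc i) c \<ominus>\<^bsub>P (Suc i)\<^esub> h (d i c)"
  have lf: "linear_map R (P (Suc i)) (P (Suc i)) ?f"
    by (intro linear_map_minus linear_map_id mod lin linear_map_comp[OF d_linear h(1)])
  have "?f c \<in> d (Suc i) ` carrier (P (Suc (Suc i)))" if c: "c \<in> carrier (P (Suc i))" for c
  proof -
    have "d i (?f c) = d i c \<ominus>\<^bsub>P i\<^esub> \<theta> i (d i c) \<ominus>\<^bsub>P i\<^esub> (d i c \<ominus>\<^bsub>P i\<^esub> \<theta> i (d i c))"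
      using c by (simp add: chain h(2))
    also have "\<dots> = \<zero>\<^bsub>P i\<^esub>" using c by (simp add: h.dom.r_neg a_minus_def)
    finally have "\<exists>y\<in>carrier (P (Suc (Suc i))). d (Suc i) y = ?f c"
      using c by (intro cycle_is_boundary) auto
    then show ?thesis by (elim bexE) (auto intro: rev_image_eqI)
  qed
  then obtain h' where h': "linear_map R (P (Suc i)) (P (Suc (Suc i))) h'"
    "\<And>x. x \<in> carrier (P (Suc i)) \<Longrightarrow> d (Suc i) (h' x) = ?f x"
    by (rule_tac fin_free_lift[OF free lf d_linear]) auto
  have "d (Suc i) (h' (d (Suc i) c)) = d (Suc i) c \<ominus>\<^bsub>P (Suc i)\<^esub> \<theta> (Suc i) (d (Suc i) c)"
    if c: "c \<in> carrier (P (Suc (Suc i)))" for c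
    using c by (simp add: h'(2) d_d a_minus_def)
  then show ?case using h'(1) by blast
qed

text \<open>A chain map \<open>g\<close> over a given map is built degree by degree, from projectivity of the source and
  acyclicity of the target.\<close>

lemma comparison:
  assumes Q: "free_acyclic R Q \<delta>"
    and g0: "linear_map R (P 0) (Q 0) g0"
    and im: "\<And>x. x \<in> carrier (P (Suc 0)) \<Longrightarrow> g0 (d 0 x) \<in> \<delta> 0 ` carrier (Q (Suc 0))"
  obtains g where "g 0 = g0" "\<And>i. linear_map R (P i) (Q i) (g i)"
    "\<And>i x. x \<in> carrier (P (Suc i)) \<Longrightarrow> \<delta> i (g (Suc i) x) = g i (d i x)"
proof -
  interpret Q: free_acyclic R Q \<delta> by (rule Q)
  \<comment> \<open>That boundaries go to boundaries has to be carried along, since it is what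
    allows the next map to be lifted. The last conjunct ties the sequence to
    \<open>g0\<close>.\<close>
  let ?inv = "\<lambda>i f. linear_map R (P i) (Q i) f \<and>
    (\<forall>x\<in>carrier (P (Suc i)). f (d i x) \<in> \<delta> i ` carrier (Q (Suc i))) \<and> (i = 0 \<longrightarrow> f = g0)"
  let ?rel = "\<lambda>i f f'. \<forall>x\<in>carrier (P (Suc i)). \<delta> i (f' x) = f (d i x)"
  have "\<exists>g. \<forall>i. ?inv i (g i) \<and> ?rel i (g i) (g (Suc i))"
  proof (rule dependent_nat_choice)
    show "\<exists>f. ?inv 0 f" using g0 im by blast
    fix f i assume f: "?inv i f"
    then have lf: "linear_map R (P i) (Q i) f" by blast
    have l: "linear_map R (P (Suc i)) (Q i) (\<lambda>x. f (d i x))"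
      by (rule linear_map_comp[OF d_linear lf])
    obtain f' where f': "linear_map R (P (Suc i)) (Q (Suc i)) f'"
      "\<And>x. x \<in> carrier (P (Suc i)) \<Longrightarrow> \<delta> i (f' x) = f (d i x)"
      by (rule fin_free_lift[OF free l Q.d_linear]) (use f in auto)
    have "f' (d (Suc i) x) \<in> \<delta> (Suc i) ` carrier (Q (Suc (Suc i)))"
      if x: "x \<in> carrier (P (Suc (Suc i)))" for x
    proof -
      have c: "d (Suc i) x \<in> carrier (P (Suc i))" using x by (rule linear_map.closed[OF d_linear])
      have "\<delta> i (f' (d (Suc i) x)) = \<zero>\<^bsub>Q i\<^esub>"
        using f'(2)[OF c] d_d[OF x] linear_map.zero[OF lf] by simp
      then show ?thesis using Q.cycle_is_boundary[OF linear_map.closed[OF f'(1) c]] by (metis imageI)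
    qed
    then show "\<exists>f'. ?inv (Suc i) f' \<and> ?rel i f f'" using f' by blast
  qed
  then obtain g where "\<forall>i. ?inv i (g i) \<and> ?rel i (g i) (g (Suc i))" by blast
  then show ?thesis by (intro that[of g]) blast+
qed

end

section \<open>Homotopy invariance of the lifting property\<close>

locale free_acyclic_adic = cring_ideal R I + free_acyclic R P d
  for R :: "('a, 'm) ring_scheme" (structure) and I and P :: "nat \<Rightarrow> ('a, 'p) module" and d
begin

text \<open>On a boundary \<open>b\<close> of filtration q + 1 the homotopy gives
  \<open>b = \<theta> b + d (h b)\<close>. Being linear, \<open>h\<close> does not lower the
  filtration, so \<open>h b\<close> is a good preimage of the second summand, and only
  \<open>\<theta> b\<close> remains to be lifted.\<close>

lemma adic_lifting_if_homotopic:
  assumes lin: "\<And>i. linear_map R (P i) (P i) (\<theta> i)"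
    and chain: "\<And>i x. x \<in> carrier (P (Suc i)) \<Longrightarrow> d i (\<theta> (Suc i) x) = \<theta> i (d i x)"
    and start: "\<And>x. x \<in> carrier (P 0) \<Longrightarrow> x \<ominus>\<^bsub>P 0\<^esub> \<theta> 0 x \<in> d 0 ` carrier (P (Suc 0))"
    and lift: "\<And>q c. c \<in> carrier (P (Suc i)) \<Longrightarrow> d i c \<in> adic (Suc q) (P i) \<Longrightarrow>
      \<exists>z\<in>adic q (P (Suc i)). d i z = \<theta> i (d i c)"
  shows "adic_lifting (P (Suc i)) (P i) (d i)"
  unfolding adic_lifting_def
proof (intro allI ballI impI)
  fix q c assume c: "c \<in> carrier (P (Suc i))" and dc: "d i c \<in> adic (Suc q) (P i)"
  obtain h where h: "linear_map R (P i) (P (Suc i)) h"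
    "d i (h (d i c)) = d i c \<ominus>\<^bsub>P i\<^esub> \<theta> i (d i c)"
    using boundary_homotopy[OF lin chain start] c by blast
  obtain z where z: "z \<in> adic q (P (Suc i))" "d i z = \<theta> i (d i c)" using lift[OF c dc] by blast
  interpret d: linear_map R "P (Suc i)" "P i" "d i" by (rule d_linear)
  interpret t: linear_map R "P i" "P i" "\<theta> i" by (rule lin)
  have hd: "h (d i c) \<in> adic q (P (Suc i))"
    using linear_map_adic[OF h(1)] dc adic_Suc_subset[OF mod] by blast
  note car = adic_carr[OF mod z(1)] adic_carr[OF mod hd]
  have "d i (z \<oplus>\<^bsub>P (Suc i)\<^esub> h (d i c)) = \<theta> i (d i c) \<oplus>\<^bsub>P i\<^esub> (d i c \<ominus>\<^bsub>P i\<^esub> \<theta> i (d i c))"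
    using car z(2) h(2) by simp
  also have "\<dots> = d i c" using c by (simp add: a_minus_def d.cod.a_ac d.cod.r_neg)
  finally show "\<exists>z\<in>adic q (P (Suc i)). d i z = d i c" using adic_add[OF mod z(1) hd] by blast
qed

text \<open>The augmentation is split by sending 1 to \<open>s\<close>, so up to homotopy the
  complex is concentrated in degree 0. The corresponding \<open>\<theta>\<close> kills all
  boundaries, and zero lifts them.\<close>

lemma adic_lifting_split:
  assumes aug: "linear_map R (P 0) (self_module R) \<epsilon>" "s \<in> carrier (P 0)" "\<epsilon> s = \<one>"
    and ker: "a_kernel (P 0) (self_module R) \<epsilon> = d 0 ` carrier (P (Suc 0))"
  shows "adic_lifting (P (Suc i)) (P i) (d i)"
proof -
  interpret e: linear_map R "P 0" "self_module R" \<epsilon> by (rule aug)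
  interpret d: linear_map R "P (Suc j)" "P j" "d j" for j by (rule d_linear)
  have ker': "x \<in> d 0 ` carrier (P (Suc 0)) \<longleftrightarrow> x \<in> carrier (P 0) \<and> \<epsilon> x = \<zero>" for x
    by (simp add: ker[symmetric] a_kernel_def')
  have ecl: "\<epsilon> x \<in> carrier R" if "x \<in> carrier (P 0)" for x using e.closed[OF that] by simp
  define \<theta> where "\<theta> i x = (if i = 0 then \<epsilon> x \<odot>\<^bsub>P 0\<^esub> s else \<zero>\<^bsub>P i\<^esub>)" for i x
  have lin: "linear_map R (P i) (P i) (\<theta> i)" for i
  proof (cases "i = 0")
    case True
    then show ?thesis
      by (intro linear_mapI) (simp_all add: \<theta>_def ecl aug(2) e.dom.smult_l_distr e.dom.smult_assoc1 mod)
  next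
    case False
    then have "\<theta> i = (\<lambda>x. \<zero>\<^bsub>P i\<^esub>)" by (simp add: \<theta>_def fun_eq_iff)
    then show ?thesis using linear_map_zero[OF mod mod, of i i] by simp
  qed
  have td: "\<theta> i (d i c) = \<zero>\<^bsub>P i\<^esub>" if c: "c \<in> carrier (P (Suc i))" for i c
  proof (cases "i = 0")
    case True
    have "\<epsilon> (d 0 c) = \<zero>" using ker'[of "d 0 c"] c True by auto
    then show ?thesis using True aug(2) by (simp add: \<theta>_def)
  qed (simp add: \<theta>_def)
  show ?thesis
  proof (rule adic_lifting_if_homotopic[of \<theta>, OF lin])
    show "d i (\<theta> (Suc i) x) = \<theta> i (d i x)" if "x \<in> carrier (P (Suc i))" for i x
      using td[OF that] by (simp add: \<theta>_def)
    show "x \<ominus>\<^bsub>P 0\<^esub> \<theta> 0 x \<in> d 0 ` carrier (P (Suc 0))" if x: "x \<in> carrier (P 0)" for x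
      using x aug(2,3) ecl[OF x] e.cod.r_neg[of "\<epsilon> x"] by (simp add: ker' \<theta>_def a_minus_def)
    show "\<exists>z\<in>adic q (P (Suc i)). d i z = \<theta> i (d i c)" if "c \<in> carrier (P (Suc i))" for q c
      using adic_zero[OF mod, of "Suc i" q] td[OF that] d.zero by (intro bexI[of _ "\<zero>\<^bsub>P (Suc i)\<^esub>"]) auto
  qed
qed

text \<open>Both complexes resolve direct sums of copies of the residue field, so \<open>P\<close> is up to homotopy a
  direct summand of a power of \<open>Q\<close>.\<close>

lemma adic_lifting_transfer:
  assumes Q: "free_acyclic R Q \<delta>"
    and P0: "d 0 ` carrier (P (Suc 0)) = adic (Suc 0) (P 0)"
    and Q0: "\<delta> 0 ` carrier (Q (Suc 0)) = adic (Suc 0) (Q 0)"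
    and g: "g \<in> carrier (Q 0)" and \<rho>: "linear_map R (Q 0) (self_module R) \<rho>" "\<rho> g = \<one>"
    and Qi: "adic_lifting (Q (Suc i)) (Q i) (\<delta> i)"
  shows "adic_lifting (P (Suc i)) (P i) (d i)"
proof -
  interpret Q: free_acyclic R Q \<delta> by (rule Q)
  obtain n e c where fb: "free_basis R (P 0) {..<n::nat} e c"
    using free[of 0] by (auto simp: fin_free_def)
  note b = free_basisD[OF fb]
  interpret d: linear_map R "P (Suc j)" "P j" "d j" for j by (rule d_linear)
  interpret del: linear_map R "Q (Suc j)" "Q j" "\<delta> j" for j by (rule Q.d_linear)
  interpret rho: linear_map R "Q 0" "self_module R" \<rho> by (rule \<rho>)
  have rcl: "\<rho> x \<in> carrier R" if "x \<in> carrier (Q 0)" for x using rho.closed[OF that] by simp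
  \<comment> \<open>One chain map for each basis vector of \<open>P 0\<close>: in degree 0 it is the
    coordinate \<open>c k\<close> followed by 1 |-> g. It extends to all degrees because on both
    sides the boundaries in degree 0 are the multiples of I, which linear maps preserve.\<close>
  have "\<exists>a. a 0 = (\<lambda>x. c k x \<odot>\<^bsub>Q 0\<^esub> g) \<and> (\<forall>i. linear_map R (P i) (Q i) (a i)) \<and>
    (\<forall>i. \<forall>x\<in>carrier (P (Suc i)). \<delta> i (a (Suc i) x) = a i (d i x))" if k: "k < n" for k
  proof -
    interpret ck: linear_map R "P 0" "self_module R" "c k" using b(3) k by auto
    have l: "linear_map R (P 0) (Q 0) (\<lambda>x. c k x \<odot>\<^bsub>Q 0\<^esub> g)"
      using ck.closed
      by (intro linear_mapI) (auto simp: mod Q.mod g del.cod.smult_l_distr del.cod.smult_assoc1)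
    have "c k (d 0 x) \<odot>\<^bsub>Q 0\<^esub> g \<in> \<delta> 0 ` carrier (Q (Suc 0))" if "x \<in> carrier (P (Suc 0))" for x
      unfolding Q0
      by (rule linear_map_adic[OF l]) (use P0 that in blast)
    then show ?thesis by (rule comparison[OF Q l]) blast+
  qed
  then obtain \<alpha> where \<alpha>: "\<And>k. k < n \<Longrightarrow> \<alpha> k 0 = (\<lambda>x. c k x \<odot>\<^bsub>Q 0\<^esub> g)"
    "\<And>k i. k < n \<Longrightarrow> linear_map R (P i) (Q i) (\<alpha> k i)"
    "\<And>k i x. k < n \<Longrightarrow> x \<in> carrier (P (Suc i)) \<Longrightarrow> \<delta> i (\<alpha> k (Suc i) x) = \<alpha> k i (d i x)"
    by metis
  \<comment> \<open>The way back: since \<open>\<rho> g = \<one>\<close>, the map in degree 0 sends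
    \<open>g\<close> to \<open>e k\<close>.\<close>
  have "\<exists>a. a 0 = (\<lambda>x. \<rho> x \<odot>\<^bsub>P 0\<^esub> e k) \<and> (\<forall>i. linear_map R (Q i) (P i) (a i)) \<and>
    (\<forall>i. \<forall>x\<in>carrier (Q (Suc i)). d i (a (Suc i) x) = a i (\<delta> i x))" if k: "k < n" for k
  proof -
    have l: "linear_map R (Q 0) (P 0) (\<lambda>x. \<rho> x \<odot>\<^bsub>P 0\<^esub> e k)"
      using rcl b(2) k
      by (intro linear_mapI) (auto simp: mod Q.mod d.cod.smult_l_distr d.cod.smult_assoc1)
    have "\<rho> (\<delta> 0 x) \<odot>\<^bsub>P 0\<^esub> e k \<in> d 0 ` carrier (P (Suc 0))" if "x \<in> carrier (Q (Suc 0))" for x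
      unfolding P0
      by (rule linear_map_adic[OF l]) (use Q0 that in blast)
    then show ?thesis by (rule Q.comparison[OF free_acyclic_axioms l]) blast+
  qed
  then obtain \<beta> where \<beta>: "\<And>k. k < n \<Longrightarrow> \<beta> k 0 = (\<lambda>x. \<rho> x \<odot>\<^bsub>P 0\<^esub> e k)"
    "\<And>k i. k < n \<Longrightarrow> linear_map R (Q i) (P i) (\<beta> k i)"
    "\<And>k i x. k < n \<Longrightarrow> x \<in> carrier (Q (Suc i)) \<Longrightarrow> d i (\<beta> k (Suc i) x) = \<beta> k i (\<delta> i x)"
    by metis
  have acl: "\<alpha> k i x \<in> carrier (Q i)" if "k < n" "x \<in> carrier (P i)" for k i x
    using linear_map.closed[OF \<alpha>(2)] that by blast
  have bcl: "\<beta> k i x \<in> carrier (P i)" if "k < n" "x \<in> carrier (Q i)" for k i x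
    using linear_map.closed[OF \<beta>(2)] that by blast
  define \<theta> where "\<theta> i x = (\<Oplus>\<^bsub>P i\<^esub>k\<in>{..<n}. \<beta> k i (\<alpha> k i x))" for i x
  have lin: "linear_map R (P i) (P i) (\<theta> i)" for i
    unfolding \<theta>_def[abs_def]
    by (intro linear_map_finsum mod) (auto intro: linear_map_comp[OF \<alpha>(2) \<beta>(2)])
  show ?thesis
  proof (rule adic_lifting_if_homotopic[of \<theta>, OF lin])
    show "d i (\<theta> (Suc i) x) = \<theta> i (d i x)" if x: "x \<in> carrier (P (Suc i))" for i x
      unfolding \<theta>_def using x acl bcl
      by (subst d.finsum) (auto intro!: d.cod.finsum_cong' simp: \<beta>(3) \<alpha>(3))
    show "x \<ominus>\<^bsub>P 0\<^esub> \<theta> 0 x \<in> d 0 ` carrier (P (Suc 0))" if x: "x \<in> carrier (P 0)" for x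
    proof -
      \<comment> \<open>In degree 0 the sum over \<open>k\<close> reassembles \<open>x\<close> from
        its coordinates, so \<open>\<theta> 0\<close> is the identity.\<close>
      have "\<theta> 0 x = (\<Oplus>\<^bsub>P 0\<^esub>k\<in>{..<n}. c k x \<odot>\<^bsub>P 0\<^esub> e k)"
        unfolding \<theta>_def
        using x b(2,6) g by (intro d.cod.finsum_cong') (auto simp: \<alpha>(1) \<beta>(1) \<rho>(2))
      also have "\<dots> = x" using b(4) x by blast
      finally have "x \<ominus>\<^bsub>P 0\<^esub> \<theta> 0 x = \<zero>\<^bsub>P 0\<^esub>" using x by (simp add: d.cod.r_neg a_minus_def)
      then show ?thesis using adic_zero[OF mod] P0 by simp
    qed
    show "\<exists>z\<in>adic q (P (Suc i)). d i z = \<theta> i (d i x)"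
      if x: "x \<in> carrier (P (Suc i))" and dx: "d i x \<in> adic (Suc q) (P i)" for q x
    proof -
      have "\<exists>z\<in>adic q (Q (Suc i)). \<delta> i z = \<alpha> k i (d i x)" if k: "k < n" for k
      proof -
        have a: "\<alpha> k (Suc i) x \<in> carrier (Q (Suc i))" by (rule acl[OF k x])
        have b: "\<delta> i (\<alpha> k (Suc i) x) \<in> adic (Suc q) (Q i)"
          unfolding \<alpha>(3)[OF k x] by (rule linear_map_adic[OF \<alpha>(2)[OF k] dx])
        show ?thesis using adic_liftingD[OF Qi a b] by (simp only: \<alpha>(3)[OF k x])
      qed
      then obtain z where z: "\<And>k. k < n \<Longrightarrow> z k \<in> adic q (Q (Suc i))"
        "\<And>k. k < n \<Longrightarrow> \<delta> i (z k) = \<alpha> k i (d i x)" by metis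
      have zc: "z k \<in> carrier (Q (Suc i))" if "k < n" for k by (rule adic_carr[OF Q.mod z(1)[OF that]])
      let ?z = "\<Oplus>\<^bsub>P (Suc i)\<^esub>k\<in>{..<n}. \<beta> k (Suc i) (z k)"
      have "?z \<in> adic q (P (Suc i))"
        by (rule d.dom.finsum_mem_submodule[OF adic_submodule[OF mod]])
          (use linear_map_adic[OF \<beta>(2) z(1)] in blast)
      moreover have "d i ?z = \<theta> i (d i x)"
        unfolding \<theta>_def using x acl bcl zc
        by (subst d.finsum) (auto intro!: d.cod.finsum_cong' simp: \<beta>(3) z(2))
      ultimately show ?thesis by blast
    qed
  qed
qed

end

section \<open>The mapping cone of consecutive powers\<close>

lemma (in minimal_free_resolution) complex: "free_acyclic R F d"
proof (rule free_acyclic.intro)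
  show "fin_free R (F i)" for i using finite_basis_imp_fin_free[OF module] free by blast
qed (use module d_hom exact_Suc in \<open>auto simp: linear_map_iff\<close>)

lemma (in minimal_free_resolution) aug_linear: "module R M \<Longrightarrow> linear_map R (F 0) M \<epsilon>"
  using module aug_hom by (simp add: linear_map_iff)

text \<open>It turns the augmentations of the resolutions of powers into functionals with values in
  \<open>R\<close>, to which the results on functionals apply.\<close>

lemma (in cring) linear_map_ideal_module_self:
  assumes "linear_map R M (ideal_module R J) f" "J \<subseteq> carrier R"
  shows "linear_map R M (self_module R) f"
  using assms module_self unfolding linear_map_iff module_hom_def hom_def by auto

locale power_resolutions = cring_ideal R I +
  F: minimal_free_resolution R I "ideal_module R (ideal_pow R I n)" F d \<epsilon> +
  F': minimal_free_resolution R I "ideal_module R (ideal_pow R I (Suc n))" F' d' \<epsilon>'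
  for R :: "('a, 'm) ring_scheme" (structure) and I n F d \<epsilon> F' d' \<epsilon>' +
  fixes \<phi>
  assumes \<phi>_linear: "linear_map R (F' i) (F i) (\<phi> i)"
    and \<phi>_chain: "y \<in> carrier (F' (Suc i)) \<Longrightarrow> d i (\<phi> (Suc i) y) = \<phi> i (d' i y)"
    and \<phi>_aug: "y \<in> carrier (F' 0) \<Longrightarrow> \<epsilon> (\<phi> 0 y) = \<epsilon>' y"
begin

sublocale F: free_acyclic_adic R I F d
  by (intro free_acyclic_adic.intro cring_ideal_axioms F.complex)

sublocale F': free_acyclic_adic R I F' d'
  by (intro free_acyclic_adic.intro cring_ideal_axioms F'.complex)

sublocale d: linear_map R "F (Suc j)" "F j" "d j" for j by (rule F.d_linear)
sublocale d': linear_map R "F' (Suc j)" "F' j" "d' j" for j by (rule F'.d_linear)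
sublocale \<phi>: linear_map R "F' j" "F j" "\<phi> j" for j by (rule \<phi>_linear)

lemma eps: "linear_map R (F 0) (ideal_module R (pow n)) \<epsilon>"
  by (rule F.aug_linear[OF module_ideal_module[OF pow_ideal]])

lemma eps': "linear_map R (F' 0) (ideal_module R (pow (Suc n))) \<epsilon>'"
  by (rule F'.aug_linear[OF module_ideal_module[OF pow_ideal]])

sublocale \<epsilon>: linear_map R "F 0" "self_module R" \<epsilon>
  by (rule linear_map_ideal_module_self[OF eps]) (use pow_carr in blast)

sublocale \<epsilon>': linear_map R "F' 0" "self_module R" \<epsilon>'
  by (rule linear_map_ideal_module_self[OF eps']) (use pow_carr in blast)

lemma eps_image: "\<epsilon> ` carrier (F 0) = pow n" "\<epsilon>' ` carrier (F' 0) = pow (Suc n)"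
  using F.aug_surj F'.aug_surj by (simp_all only: ideal_module_simps)

lemma eps_kernel: "x \<in> carrier (F 0) \<Longrightarrow> \<epsilon> x = \<zero> \<Longrightarrow> \<exists>y\<in>carrier (F (Suc 0)). d 0 y = x"
proof -
  assume "x \<in> carrier (F 0)" "\<epsilon> x = \<zero>"
  then have "x \<in> d 0 ` carrier (F 1)" unfolding F.exact_0[symmetric] by (simp add: a_kernel_def')
  then show ?thesis by auto
qed

lemma eps'_kernel: "x \<in> carrier (F' 0) \<Longrightarrow> \<epsilon>' x = \<zero> \<Longrightarrow> \<exists>y\<in>carrier (F' (Suc 0)). d' 0 y = x"
proof -
  assume "x \<in> carrier (F' 0)" "\<epsilon>' x = \<zero>"
  then have "x \<in> d' 0 ` carrier (F' 1)" unfolding F'.exact_0[symmetric] by (simp add: a_kernel_def')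
  then show ?thesis by auto
qed

lemma eps_d: "x \<in> carrier (F (Suc 0)) \<Longrightarrow> \<epsilon> (d 0 x) = \<zero>"
  using F.exact_0 by (auto simp: a_kernel_def')

lemma eps'_d: "x \<in> carrier (F' (Suc 0)) \<Longrightarrow> \<epsilon>' (d' 0 x) = \<zero>"
  using F'.exact_0 by (auto simp: a_kernel_def')

lemma d_adic: "x \<in> carrier (F (Suc i)) \<Longrightarrow> d i x \<in> adic (Suc 0) (F i)"
  using F.minimal by (auto simp: adic_1[OF F.mod])

lemma d'_adic: "x \<in> carrier (F' (Suc i)) \<Longrightarrow> d' i x \<in> adic (Suc 0) (F' i)"
  using F'.minimal by (auto simp: adic_1[OF F'.mod])

section \<open>The mapping cone of \<open>\<phi>\<close>\<close>

definition shifted where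
  "shifted i = (case i of 0 \<Rightarrow> (F' 0)\<lparr>carrier := {\<zero>\<^bsub>F' 0\<^esub>}\<rparr> | Suc j \<Rightarrow> F' j)"

definition cone where "cone i = prod_module (F i) (shifted i)"

text \<open>The sign in the second component makes the differential square to zero. For index 0 the
  second component is the only element of \<open>shifted 0\<close>.\<close>

definition cone_d where
  "cone_d i p = (d i (fst p) \<oplus>\<^bsub>F i\<^esub> \<phi> i (snd p),
     case i of 0 \<Rightarrow> \<zero>\<^bsub>F' 0\<^esub> | Suc j \<Rightarrow> \<ominus>\<^bsub>F' j\<^esub> d' j (snd p))"

lemma shifted_simps [simp]:
  "shifted (Suc i) = F' i" "carrier (shifted 0) = {\<zero>\<^bsub>F' 0\<^esub>}" "\<zero>\<^bsub>shifted 0\<^esub> = \<zero>\<^bsub>F' 0\<^esub>"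
  by (simp_all add: shifted_def)

text \<open>In degree 0 the shifted complex is the zero module. It is cut out of \<open>F' 0\<close>
  because the elements of a complex have the same type in all degrees, and it is free on the empty
  basis.\<close>

lemma fin_free_shifted: "fin_free R (shifted i)"
proof (cases i)
  case 0
  have "submodule {\<zero>\<^bsub>F' 0\<^esub>} R (F' 0)" by (rule d'.cod.submoduleI) auto
  then have "module R (shifted 0)"
    unfolding shifted_def using submodule.submodule_is_module[OF _ F'.mod] by simp
  then have "fin_free R (shifted 0)" by (rule fin_free_zero) simp
  then show ?thesis by (simp add: 0)
qed (simp add: F'.free)

lemma shifted_mod: "module R (shifted i)"
  using fin_free_shifted by (simp add: fin_free_def)

lemma linear_cone_d: "linear_map R (cone (Suc i)) (cone i) (cone_d i)"
proof -
  let ?P = "prod_module (F (Suc i)) (F' i)"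
  have f: "linear_map R ?P (F (Suc i)) fst" and s: "linear_map R ?P (F' i) snd"
    by (intro linear_map_fst linear_map_snd F.mod F'.mod)+
  have 1: "linear_map R ?P (F i) (\<lambda>p. d i (fst p) \<oplus>\<^bsub>F i\<^esub> \<phi> i (snd p))"
    by (intro linear_map_add linear_map_comp[OF f F.d_linear] linear_map_comp[OF s \<phi>_linear])
  have 2: "linear_map R ?P (shifted i) (\<lambda>p. case i of 0 \<Rightarrow> \<zero>\<^bsub>F' 0\<^esub> | Suc j \<Rightarrow> \<ominus>\<^bsub>F' j\<^esub> d' j (snd p))"
  proof (cases i)
    case 0
    then show ?thesis using linear_map_zero[OF f[THEN linear_map.axioms(1)] shifted_mod[of 0]] by simp
  next
    case (Suc j)
    have "linear_map R ?P (F' j) (\<lambda>p. \<ominus>\<^bsub>F' j\<^esub> d' j (snd p))"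
      using s unfolding Suc by (intro linear_map_neg linear_map_comp[OF _ F'.d_linear])
    then show ?thesis by (simp add: Suc)
  qed
  show ?thesis
    using linear_map_Pair[OF 1 2] unfolding cone_def cone_d_def[abs_def] by simp
qed

lemma cone_Suc: "carrier (cone (Suc i)) = carrier (F (Suc i)) \<times> carrier (F' i)"
  by (simp add: cone_def)

lemma cone_d_d:
  assumes x: "x \<in> carrier (F (Suc (Suc i)))" and y: "y \<in> carrier (F' (Suc i))"
  shows "cone_d i (cone_d (Suc i) (x, y)) = \<zero>\<^bsub>cone i\<^esub>"
proof -
  have "d i (d (Suc i) x \<oplus>\<^bsub>F (Suc i)\<^esub> \<phi> (Suc i) y) \<oplus>\<^bsub>F i\<^esub> \<phi> i (\<ominus>\<^bsub>F' i\<^esub> d' i y) = \<zero>\<^bsub>F i\<^esub>"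
    using x y by (simp add: F.d_d \<phi>_chain d.cod.r_neg)
  moreover have "d' j (\<ominus>\<^bsub>F' (Suc j)\<^esub> d' (Suc j) y) = \<zero>\<^bsub>F' j\<^esub>" if "i = Suc j" for j
    using y that by (simp add: F'.d_d)
  ultimately show ?thesis
    by (cases i) (simp_all add: cone_d_def cone_def)
qed

text \<open>A diagram chase: \<open>y\<close> is some \<open>d' i v\<close>, then x + phi(v) is a
  cycle of \<open>F\<close> and hence some \<open>d u\<close>, and (u, -v) is the required
  preimage.\<close>

lemma cone_cycle:
  assumes x: "x \<in> carrier (F (Suc i))" and y: "y \<in> carrier (F' i)"
    and xy: "cone_d i (x, y) = \<zero>\<^bsub>cone i\<^esub>"
  shows "\<exists>u\<in>carrier (F (Suc (Suc i))). \<exists>v\<in>carrier (F' (Suc i)). cone_d (Suc i) (u, v) = (x, y)"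
proof -
  have 1: "d i x \<oplus>\<^bsub>F i\<^esub> \<phi> i y = \<zero>\<^bsub>F i\<^esub>" using xy by (simp add: cone_d_def cone_def)
  have "\<exists>v\<in>carrier (F' (Suc i)). d' i v = y"
  proof (cases i)
    case 0
    \<comment> \<open>In degree 0 the second component of the boundary carries no information. The
      augmentations replace it: \<open>\<epsilon>\<close> kills \<open>d i x\<close> and sends
      \<open>\<phi> i y\<close> to \<open>\<epsilon>' y\<close>, so \<open>\<epsilon>' y\<close>
      vanishes. This is the injectivity of the inclusion of one power in the other.\<close>
    have "\<epsilon> (d i x \<oplus>\<^bsub>F i\<^esub> \<phi> i y) = \<epsilon>' y"
      using x y \<epsilon>'.closed[of y] by (simp add: 0 eps_d \<phi>_aug)
    then have "\<epsilon>' y = \<zero>" using 1[unfolded 0] \<epsilon>.zero by (simp add: 0)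
    then show ?thesis using eps'_kernel y 0 by simp
  next
    case (Suc j)
    have "\<ominus>\<^bsub>F' j\<^esub> d' j y = \<zero>\<^bsub>F' j\<^esub>" using xy by (simp add: Suc cone_d_def cone_def)
    then have "d' j y = \<zero>\<^bsub>F' j\<^esub>"
      using y d'.cod.minus_minus[of "d' j y" j] Suc by simp
    then show ?thesis using F'.cycle_is_boundary y Suc by simp
  qed
  then obtain v where v: "v \<in> carrier (F' (Suc i))" "d' i v = y" by blast
  have "d i (x \<oplus>\<^bsub>F (Suc i)\<^esub> \<phi> (Suc i) v) = \<zero>\<^bsub>F i\<^esub>"
    using x v 1 by (simp add: \<phi>_chain)
  then obtain u where u: "u \<in> carrier (F (Suc (Suc i)))" "d (Suc i) u = x \<oplus>\<^bsub>F (Suc i)\<^esub> \<phi> (Suc i) v"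
    using F.cycle_is_boundary[of "x \<oplus>\<^bsub>F (Suc i)\<^esub> \<phi> (Suc i) v" i] x v by auto
  have "cone_d (Suc i) (u, \<ominus>\<^bsub>F' (Suc i)\<^esub> v) = (x, y)"
    using u v x y by (simp add: cone_d_def d.dom.a_assoc d.dom.r_neg d'.cod.minus_minus)
  then show ?thesis using u(1) v(1) by blast
qed

sublocale cone: free_acyclic_adic R I cone cone_d
proof (intro free_acyclic_adic.intro cring_ideal_axioms free_acyclic.intro)
  show "fin_free R (cone i)" for i
    unfolding cone_def by (rule fin_free_prod[OF F.free fin_free_shifted])
  show "linear_map R (cone (Suc i)) (cone i) (cone_d i)" for i by (rule linear_cone_d)
  show "a_kernel (cone (Suc i)) (cone i) (cone_d i) = cone_d (Suc i) ` carrier (cone (Suc (Suc i)))" for i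
  proof
    show "a_kernel (cone (Suc i)) (cone i) (cone_d i) \<subseteq> cone_d (Suc i) ` carrier (cone (Suc (Suc i)))"
    proof
      fix p assume p: "p \<in> a_kernel (cone (Suc i)) (cone i) (cone_d i)"
      obtain x y where xy: "p = (x, y)" by (cases p)
      have "\<exists>u\<in>carrier (F (Suc (Suc i))). \<exists>v\<in>carrier (F' (Suc i)). cone_d (Suc i) (u, v) = p"
        using p unfolding xy by (intro cone_cycle) (auto simp: a_kernel_def' cone_Suc)
      then obtain u v where "u \<in> carrier (F (Suc (Suc i)))" "v \<in> carrier (F' (Suc i))"
        "cone_d (Suc i) (u, v) = p" by blast
      then show "p \<in> cone_d (Suc i) ` carrier (cone (Suc (Suc i)))"
        by (intro image_eqI[of _ _ "(u, v)"]) (simp_all add: cone_Suc)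
    qed
    show "cone_d (Suc i) ` carrier (cone (Suc (Suc i))) \<subseteq> a_kernel (cone (Suc i)) (cone i) (cone_d i)"
    proof
      fix p assume "p \<in> cone_d (Suc i) ` carrier (cone (Suc (Suc i)))"
      then obtain x y where xy: "x \<in> carrier (F (Suc (Suc i)))" "y \<in> carrier (F' (Suc i))"
        "p = cone_d (Suc i) (x, y)" by (auto simp: cone_Suc)
      have "p \<in> carrier (cone (Suc i))"
        unfolding xy(3) by (rule linear_map.closed[OF linear_cone_d]) (simp add: cone_Suc xy)
      then show "p \<in> a_kernel (cone (Suc i)) (cone i) (cone_d i)"
        using cone_d_d[OF xy(1,2)] by (simp add: a_kernel_def' xy(3))
    qed
  qed
qed

text \<open>The cone resolves I^n/I^(n+1), which I annihilates, so the multiples of I in degree 0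
  are boundaries; conversely \<open>d 0\<close> and \<open>\<phi> 0\<close> both take values in I
  F_0. This is the hypothesis on \<open>P\<close> in \<open>adic_lifting_transfer\<close>.\<close>

lemma cone_start: "cone_d 0 ` carrier (cone (Suc 0)) = adic (Suc 0) (cone 0)"
proof
  show "cone_d 0 ` carrier (cone (Suc 0)) \<subseteq> adic (Suc 0) (cone 0)"
  proof
    fix p assume "p \<in> cone_d 0 ` carrier (cone (Suc 0))"
    then obtain x y where xy: "x \<in> carrier (F (Suc 0))" "y \<in> carrier (F' 0)" "p = cone_d 0 (x, y)"
      by (auto simp: cone_Suc)
    have "\<epsilon>' y \<in> pow (Suc n)" using eps_image(2) xy(2) by blast
    then have "\<epsilon>' y \<in> adic (Suc 0) (ideal_module R (pow n))" by (simp only: adic_ideal_module)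
    \<comment> \<open>To place \<open>\<phi> 0 y\<close> in I F_0, it is compared with an element
      \<open>w\<close> of I F_0 having the same augmentation. The difference is a boundary, so it
      lies in I F_0 by minimality.\<close>
    then obtain w where w: "w \<in> adic (Suc 0) (F 0)" "\<epsilon> w = \<epsilon>' y"
      using linear_map_adic_surj[OF eps F.aug_surj] by blast
    note wc = adic_carr[OF F.mod w(1)]
    have e0: "\<epsilon> (\<phi> 0 y \<ominus>\<^bsub>F 0\<^esub> w) = \<zero>"
      using wc xy(2) w(2) \<epsilon>.cod.r_neg[of "\<epsilon>' y"] \<epsilon>'.closed[OF xy(2)] by (simp add: \<phi>_aug a_minus_def)
    obtain z where z: "z \<in> carrier (F (Suc 0))" "d 0 z = \<phi> 0 y \<ominus>\<^bsub>F 0\<^esub> w"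
      using eps_kernel[OF _ e0] wc xy(2) by auto
    have "d 0 z \<oplus>\<^bsub>F 0\<^esub> w = \<phi> 0 y"
      unfolding z(2) a_minus_def using wc xy(2) by (simp add: d.cod.a_assoc d.cod.l_neg)
    then have "\<phi> 0 y \<in> adic (Suc 0) (F 0)" using adic_add[OF F.mod d_adic[OF z(1)] w(1)] by simp
    then have "d 0 x \<oplus>\<^bsub>F 0\<^esub> \<phi> 0 y \<in> adic (Suc 0) (F 0)" by (rule adic_add[OF F.mod d_adic[OF xy(1)]])
    then show "p \<in> adic (Suc 0) (cone 0)"
      unfolding cone_def adic_prod[OF F.mod shifted_mod]
      using xy(3) adic_zero[OF shifted_mod, of 0 "Suc 0"] by (simp add: cone_d_def)
  qed
  show "adic (Suc 0) (cone 0) \<subseteq> cone_d 0 ` carrier (cone (Suc 0))"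
  proof
    fix p assume "p \<in> adic (Suc 0) (cone 0)"
    then have p: "fst p \<in> adic (Suc 0) (F 0)" "snd p \<in> adic (Suc 0) (shifted 0)"
      unfolding cone_def adic_prod[OF F.mod shifted_mod] by auto
    have p2: "snd p = \<zero>\<^bsub>F' 0\<^esub>" using adic_carr[OF shifted_mod p(2)] by simp
    note pc = adic_carr[OF F.mod p(1)]
    have "\<epsilon> (fst p) \<in> adic (Suc 0) (ideal_module R (pow n))" by (rule linear_map_adic[OF eps p(1)])
    then have "\<epsilon> (fst p) \<in> \<epsilon>' ` carrier (F' 0)" by (simp only: adic_ideal_module eps_image)
    then obtain y where y: "y \<in> carrier (F' 0)" "\<epsilon>' y = \<epsilon> (fst p)" by (elim imageE) simp
    have e0: "\<epsilon> (fst p \<ominus>\<^bsub>F 0\<^esub> \<phi> 0 y) = \<zero>"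
      using pc y \<epsilon>.cod.r_neg[of "\<epsilon> (fst p)"] \<epsilon>.closed[OF pc] by (simp add: \<phi>_aug a_minus_def)
    obtain z where z: "z \<in> carrier (F (Suc 0))" "d 0 z = fst p \<ominus>\<^bsub>F 0\<^esub> \<phi> 0 y"
      using eps_kernel[OF _ e0] pc y by auto
    have "d 0 z \<oplus>\<^bsub>F 0\<^esub> \<phi> 0 y = fst p"
      unfolding z(2) a_minus_def using pc y(1) by (simp add: d.cod.a_assoc d.cod.l_neg)
    then have "p = cone_d 0 (z, y)" using p2 by (simp add: cone_d_def prod_eq_iff)
    then show "p \<in> cone_d 0 ` carrier (cone (Suc 0))" using z(1) y(1) by (auto simp: cone_Suc)
  qed
qed

text \<open>The module \<open>F' (Suc i)\<close> is a factor of the cone in degree i + 2, so the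
  cone is required one degree higher than \<open>F\<close>.\<close>

lemma adic_lifting_step:
  assumes \<phi>_adic: "\<And>y. y \<in> carrier (F' i) \<Longrightarrow> \<phi> i y \<in> adic (Suc 0) (F i)"
    and F: "adic_lifting (F (Suc i)) (F i) (d i)"
    and C: "adic_lifting (cone (Suc (Suc i))) (cone (Suc i)) (cone_d (Suc i))"
  shows "adic_lifting (F' (Suc i)) (F' i) (d' i)"
  unfolding adic_lifting_def
proof (intro allI ballI impI)
  fix q y assume y: "y \<in> carrier (F' (Suc i))" and dy: "d' i y \<in> adic (Suc q) (F' i)"
  \<comment> \<open>Two liftings follow, first in \<open>F\<close> and then in the cone, and each
    costs one power. The power gained here pays for the first of them.\<close>
  have "\<phi> i (d' i y) \<in> adic (Suc q + Suc 0) (F i)"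
    by (rule linear_map_adic_shift[OF \<phi>_linear \<phi>_adic dy])
  then have "d i (\<phi> (Suc i) y) \<in> adic (Suc (Suc q)) (F i)" using y by (simp add: \<phi>_chain)
  then obtain w where w: "w \<in> adic (Suc q) (F (Suc i))" "d i w = d i (\<phi> (Suc i) y)"
    using adic_liftingD[OF F] y \<phi>.closed by blast
  note wc = adic_carr[OF F.mod w(1)]
  have "d i (w \<ominus>\<^bsub>F (Suc i)\<^esub> \<phi> (Suc i) y) = \<zero>\<^bsub>F i\<^esub>"
    using wc y w(2) by (simp add: d.cod.r_neg a_minus_def)
  then obtain x where x: "x \<in> carrier (F (Suc (Suc i)))" "d (Suc i) x = w \<ominus>\<^bsub>F (Suc i)\<^esub> \<phi> (Suc i) y"
    using F.cycle_is_boundary[of "w \<ominus>\<^bsub>F (Suc i)\<^esub> \<phi> (Suc i) y" i] wc y by auto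
  have "d (Suc i) x \<oplus>\<^bsub>F (Suc i)\<^esub> \<phi> (Suc i) y = w"
    unfolding x(2) a_minus_def using wc y by (simp add: d.dom.a_assoc d.dom.l_neg)
  then have dxy: "cone_d (Suc i) (x, y) = (w, \<ominus>\<^bsub>F' i\<^esub> d' i y)" by (simp add: cone_d_def)
  have "cone_d (Suc i) (x, y) \<in> adic (Suc q) (cone (Suc i))"
    unfolding dxy cone_def adic_prod[OF F.mod shifted_mod]
    using w(1) adic_neg[OF F'.mod dy] by simp
  moreover have "(x, y) \<in> carrier (cone (Suc (Suc i)))" using x(1) y by (simp add: cone_Suc)
  ultimately obtain p where p: "p \<in> adic q (cone (Suc (Suc i)))"
    "cone_d (Suc i) p = cone_d (Suc i) (x, y)"
    using adic_liftingD[OF C] by blast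
  have s: "snd p \<in> adic q (F' (Suc i))"
    using p(1) unfolding cone_def adic_prod[OF F.mod shifted_mod] by simp
  have sc: "snd p \<in> carrier (F' (Suc i))" by (rule adic_carr[OF F'.mod s])
  have "\<ominus>\<^bsub>F' i\<^esub> d' i (snd p) = \<ominus>\<^bsub>F' i\<^esub> d' i y" using p(2) by (simp add: cone_d_def)
  then have "d' i (snd p) = d' i y"
    using d'.cod.minus_minus[of "d' i y" i] d'.cod.minus_minus[of "d' i (snd p)" i] y sc by simp
  then show "\<exists>z\<in>adic q (F' (Suc i)). d' i z = d' i y" using s by blast
qed

end

section \<open>Tensoring with a free complex\<close>

text \<open>With respect to a basis of \<open>K l\<close> with \<open>r l\<close> elements, an element of \<open>M \<otimes> K l\<close> is
  represented by a function from \<open>{..<r l}\<close> to \<open>M\<close>. The differential of \<open>M \<otimes> K\<close> becomes \<open>tensor_d\<close>,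
  and \<open>total l\<close> is the identification of \<open>R \<otimes> K l\<close> with \<open>K l\<close>.\<close>

locale based_complex = free_acyclic_adic R I K \<delta>
  for R :: "('a, 'm) ring_scheme" (structure) and I and K :: "nat \<Rightarrow> ('a, 'k) module" and \<delta> +
  fixes r :: "nat \<Rightarrow> nat" and e :: "nat \<Rightarrow> nat \<Rightarrow> 'k" and c :: "nat \<Rightarrow> nat \<Rightarrow> 'k \<Rightarrow> 'a"
  assumes basis: "free_basis R (K l) {..<r l} (e l) (c l)"
begin

definition total :: "nat \<Rightarrow> (nat \<Rightarrow> 'a) \<Rightarrow> 'k" where
  "total l a = lin_comb (K l) {..<r l} a (e l)"

definition tensor_d :: "('a, 'x) module \<Rightarrow> nat \<Rightarrow> (nat \<Rightarrow> 'x) \<Rightarrow> nat \<Rightarrow> 'x" where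
  "tensor_d M l U b = lin_comb M {..<r (Suc l)} (\<lambda>b'. c l b (\<delta> l (e (Suc l) b'))) U"

lemma e_closed: "b < r l \<Longrightarrow> e l b \<in> carrier (K l)"
  using free_basisD(2)[OF basis] by simp

lemma c_linear: "b < r l \<Longrightarrow> linear_map R (K l) (self_module R) (c l b)"
  using free_basisD(3)[OF basis] by simp

lemma c_closed: "b < r l \<Longrightarrow> x \<in> carrier (K l) \<Longrightarrow> c l b x \<in> carrier R"
  using linear_map.closed[OF c_linear] by simp

lemma delta_closed: "x \<in> carrier (K (Suc l)) \<Longrightarrow> \<delta> l x \<in> carrier (K l)"
  using linear_map.closed[OF d_linear] by simp

lemma coeff_closed: "b < r l \<Longrightarrow> b' < r (Suc l) \<Longrightarrow> c l b (\<delta> l (e (Suc l) b')) \<in> carrier R"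
  by (intro c_closed delta_closed e_closed)

lemma total_closed: "(\<And>b. b < r l \<Longrightarrow> a b \<in> carrier R) \<Longrightarrow> total l a \<in> carrier (K l)"
  unfolding total_def by (rule lin_comb_closed[OF mod]) (auto simp: e_closed)

lemma total_coord: "x \<in> carrier (K l) \<Longrightarrow> total l (\<lambda>b. c l b x) = x"
  unfolding total_def by (rule free_basis_expand[OF basis])

lemma coord_total: "(\<And>b. b < r l \<Longrightarrow> a b \<in> carrier R) \<Longrightarrow> b < r l \<Longrightarrow> c l b (total l a) = a b"
  unfolding total_def by (rule free_basis_coord[OF basis mod]) auto

lemma total_cong:
  "(\<And>b. b < r l \<Longrightarrow> a b = a' b) \<Longrightarrow> (\<And>b. b < r l \<Longrightarrow> a' b \<in> carrier R) \<Longrightarrow> total l a = total l a'"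
  unfolding total_def by (rule lin_comb_cong[OF mod]) (auto simp: e_closed)

lemma total_add:
  assumes "\<And>b. b < r l \<Longrightarrow> a b \<in> carrier R" "\<And>b. b < r l \<Longrightarrow> a' b \<in> carrier R"
  shows "total l (\<lambda>b. a b \<oplus> a' b) = total l a \<oplus>\<^bsub>K l\<^esub> total l a'"
proof -
  interpret K: module R "K l" by (rule mod)
  have "(\<Oplus>\<^bsub>K l\<^esub>b\<in>{..<r l}. (a b \<oplus> a' b) \<odot>\<^bsub>K l\<^esub> e l b)
    = (\<Oplus>\<^bsub>K l\<^esub>b\<in>{..<r l}. a b \<odot>\<^bsub>K l\<^esub> e l b \<oplus>\<^bsub>K l\<^esub> a' b \<odot>\<^bsub>K l\<^esub> e l b)"
    using assms e_closed by (intro K.finsum_cong') (auto simp: K.smult_l_distr)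
  also have "\<dots> = (\<Oplus>\<^bsub>K l\<^esub>b\<in>{..<r l}. a b \<odot>\<^bsub>K l\<^esub> e l b) \<oplus>\<^bsub>K l\<^esub> (\<Oplus>\<^bsub>K l\<^esub>b\<in>{..<r l}. a' b \<odot>\<^bsub>K l\<^esub> e l b)"
    using assms e_closed by (intro K.finsum_addf) auto
  finally show ?thesis by (simp add: total_def lin_comb_def)
qed

lemma tensor_d_closed:
  "module R M \<Longrightarrow> (\<And>b. b < r (Suc l) \<Longrightarrow> U b \<in> carrier M) \<Longrightarrow> b < r l \<Longrightarrow> tensor_d M l U b \<in> carrier M"
  unfolding tensor_d_def by (rule lin_comb_closed) (auto simp: coeff_closed)

lemma tensor_d_natural:
  assumes "linear_map R M N f" "\<And>b. b < r (Suc l) \<Longrightarrow> U b \<in> carrier M" "b < r l"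
  shows "f (tensor_d M l U b) = tensor_d N l (\<lambda>b. f (U b)) b"
  unfolding tensor_d_def using assms by (intro linear_map.lin_comb) (auto simp: coeff_closed)

text \<open>\<open>R\<close> tensor \<open>K\<close> is \<open>K\<close> again: read off in
  coordinates, \<open>tensor_d\<close> is the matrix of \<open>\<delta>\<close> applied to a vector
  of scalars.\<close>

lemma tensor_d_self:
  assumes a: "\<And>b. b < r (Suc l) \<Longrightarrow> a b \<in> carrier R" and b: "b < r l"
  shows "tensor_d (self_module R) l a b = c l b (\<delta> l (total (Suc l) a))"
proof -
  interpret S: module R "self_module R" by (rule module_self)
  have l: "linear_map R (K (Suc l)) (self_module R) (\<lambda>x. c l b (\<delta> l x))"
    by (rule linear_map_comp[OF d_linear c_linear[OF b]])
  have "c l b (\<delta> l (total (Suc l) a))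
    = lin_comb (self_module R) {..<r (Suc l)} a (\<lambda>b'. c l b (\<delta> l (e (Suc l) b')))"
    unfolding total_def using a by (intro linear_map.lin_comb[OF l]) (auto simp: e_closed)
  also have "\<dots> = tensor_d (self_module R) l a b"
    unfolding tensor_d_def lin_comb_def using a coeff_closed[OF b]
    by (intro S.finsum_cong') (auto simp: m_comm)
  finally show ?thesis ..
qed

lemma total_tensor_d:
  assumes a: "\<And>b. b < r (Suc l) \<Longrightarrow> a b \<in> carrier R"
  shows "total l (tensor_d (self_module R) l a) = \<delta> l (total (Suc l) a)"
proof -
  have x: "\<delta> l (total (Suc l) a) \<in> carrier (K l)" by (intro delta_closed total_closed a)
  have "total l (tensor_d (self_module R) l a) = total l (\<lambda>b. c l b (\<delta> l (total (Suc l) a)))"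
    by (rule total_cong) (auto simp: tensor_d_self[OF a] c_closed x)
  then show ?thesis by (simp add: total_coord[OF x])
qed

text \<open>The coordinates already separate points. In \<open>zigzag\<close> this transfers a
  computation from N tensor K to \<open>K\<close>.\<close>

lemma fin_free_eqI:
  assumes "fin_free R N" "x \<in> carrier N" "y \<in> carrier N"
    "\<And>f. linear_map R N (self_module R) f \<Longrightarrow> f x = f y"
  shows "x = y"
proof -
  obtain n u \<xi> where b: "free_basis R N {..<n::nat} u \<xi>" and N: "module R N"
    using assms(1) by (auto simp: fin_free_def)
  have "lin_comb N {..<n} (\<lambda>i. \<xi> i x) u = lin_comb N {..<n} (\<lambda>i. \<xi> i y) u"
    using assms(2-4) free_basisD[OF b] by (intro lin_comb_cong[OF N]) auto
  then show ?thesis using free_basis_expand[OF b] assms(2,3) by simp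
qed

text \<open>Exactness of \<open>N \<otimes> K\<close> for a free module \<open>N\<close> is reduced to exactness of \<open>K\<close> by linear functionals
  on \<open>N\<close>, which avoids choosing bases of two modules at once.\<close>

lemma tensor_boundary:
  assumes N: "fin_free R N" and Y: "\<And>b. b < r l \<Longrightarrow> Y b \<in> carrier N"
    and f: "\<And>f. linear_map R N (self_module R) f \<Longrightarrow>
      total l (\<lambda>b. f (Y b)) \<in> \<delta> l ` carrier (K (Suc l))"
  shows "\<exists>U. (\<forall>b<r (Suc l). U b \<in> carrier N) \<and> (\<forall>b<r l. Y b = tensor_d N l U b)"
proof -
  obtain n u \<xi> where b: "free_basis R N {..<n::nat} u \<xi>" and mX: "module R N"
    using N by (auto simp: fin_free_def)
  note fb = free_basisD[OF b]
  have "\<exists>z. z \<in> carrier (K (Suc l)) \<and> \<delta> l z = total l (\<lambda>b. \<xi> j (Y b))" if "j < n" for j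
    using f[of "\<xi> j"] fb(3) that by (metis imageE lessThan_iff)
  then obtain z where z: "\<And>j. j < n \<Longrightarrow> z j \<in> carrier (K (Suc l))"
    "\<And>j. j < n \<Longrightarrow> \<delta> l (z j) = total l (\<lambda>b. \<xi> j (Y b))" by metis
  \<comment> \<open>The coordinates of the \<open>z j\<close> form a matrix of scalars; its row at
    \<open>b\<close>, combined with the basis \<open>u\<close>, gives the component of
    \<open>U\<close> at \<open>b\<close>.\<close>
  define U where "U b = lin_comb N {..<n} (\<lambda>j. c (Suc l) b (z j)) u" for b
  have Uc: "U b \<in> carrier N" if "b < r (Suc l)" for b
    unfolding U_def using that z(1) fb(2) by (intro lin_comb_closed[OF mX]) (auto simp: c_closed)
  have "tensor_d N l U b = Y b" if bl: "b < r l" for b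
  proof -
    have tc: "tensor_d N l U b \<in> carrier N" by (rule tensor_d_closed[OF mX Uc bl])
    have "\<xi> j (tensor_d N l U b) = \<xi> j (Y b)" if j: "j < n" for j
    proof -
      have j': "j \<in> {..<n}" using j by simp
      have "\<xi> j (tensor_d N l U b) = tensor_d (self_module R) l (\<lambda>b. \<xi> j (U b)) b"
        by (rule tensor_d_natural[OF fb(3)[OF j'] Uc bl])
      also have "\<dots> = c l b (\<delta> l (total (Suc l) (\<lambda>b. \<xi> j (U b))))"
        by (rule tensor_d_self[OF fb(6)[OF j' Uc] bl])
      also have "total (Suc l) (\<lambda>b. \<xi> j (U b)) = total (Suc l) (\<lambda>b. c (Suc l) b (z j))"
      proof (rule total_cong)
        show "\<xi> j (U b) = c (Suc l) b (z j)" if "b < r (Suc l)" for b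
          unfolding U_def using that z(1) by (intro free_basis_coord[OF b mX j']) (auto simp: c_closed)
      qed (use z(1)[OF j] c_closed in blast)
      also have "\<dots> = z j" by (rule total_coord[OF z(1)[OF j]])
      also have "c l b (\<delta> l (z j)) = \<xi> j (Y b)"
        unfolding z(2)[OF j] by (rule coord_total[OF fb(6)[OF j' Y] bl])
      finally show ?thesis .
    qed
    then have "lin_comb N {..<n} (\<lambda>j. \<xi> j (tensor_d N l U b)) u = lin_comb N {..<n} (\<lambda>j. \<xi> j (Y b)) u"
      using fb(2) fb(6)[OF _ Y[OF bl]] by (intro lin_comb_cong[OF mX]) auto
    then show ?thesis using free_basis_expand[OF b] tc Y[OF bl] by simp
  qed
  then show ?thesis using Uc by (intro exI[of _ U]) simp
qed

text \<open>A functional on \<open>N\<close> induces a chain map from N tensor K to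
  \<open>K\<close>. It takes a cycle of positive degree to a cycle of \<open>K\<close>, hence to a
  boundary, as \<open>tensor_boundary\<close> asks.\<close>

lemma functional_cycle:
  assumes f: "linear_map R N (self_module R) f" and Y: "\<And>b. b < r (Suc l) \<Longrightarrow> Y b \<in> carrier N"
    and 0: "\<And>b. b < r l \<Longrightarrow> f (tensor_d N l Y b) = \<zero>"
  shows "total (Suc l) (\<lambda>b. f (Y b)) \<in> \<delta> (Suc l) ` carrier (K (Suc (Suc l)))"
proof -
  interpret f: linear_map R N "self_module R" f by (rule f)
  interpret K: module R "K l" by (rule mod)
  have fY: "f (Y b) \<in> carrier R" if "b < r (Suc l)" for b using f.closed[OF Y[OF that]] by simp
  have "\<delta> l (total (Suc l) (\<lambda>b. f (Y b))) = total l (tensor_d (self_module R) l (\<lambda>b. f (Y b)))"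
    by (rule total_tensor_d[symmetric, OF fY])
  also have "\<dots> = total l (\<lambda>b. \<zero>)"
    by (rule total_cong) (simp_all add: tensor_d_natural[OF f Y, symmetric] 0)
  also have "\<dots> = \<zero>\<^bsub>K l\<^esub>"
    unfolding total_def lin_comb_def by (rule K.add.finprod_one_eqI) (simp add: e_closed)
  finally have "\<exists>z\<in>carrier (K (Suc (Suc l))). \<delta> (Suc l) z = total (Suc l) (\<lambda>b. f (Y b))"
    by (intro cycle_is_boundary total_closed fY)
  then show ?thesis by (elim bexE) (rule image_eqI[OF sym])
qed

end

locale tensor_resolutions = power_resolutions R I n F d \<epsilon> F' d' \<epsilon>' \<phi> + K: based_complex R I K \<delta> r e c
  for R :: "('a, 'm) ring_scheme" (structure) and I n
    and F :: "nat \<Rightarrow> ('a, 'f) module" and d \<epsilon> and F' :: "nat \<Rightarrow> ('a, 'g) module" and d' \<epsilon>' \<phi>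
    and K :: "nat \<Rightarrow> ('a, 'k) module" and \<delta> r e c +
  assumes K_start: "\<delta> 0 ` carrier (K (Suc 0)) = adic (Suc 0) (K 0)"
begin

text \<open>The condition that \<open>Y\<close> in \<open>F' j \<otimes> K l\<close> can be completed to a cycle of the total complex of
  \<open>F' \<otimes> K\<close> by components with smaller \<open>j\<close>; only the first of them has to be given. Signs are
  irrelevant, since the components are treated one at a time.\<close>

definition extends where
  "extends j l Y \<longleftrightarrow> (case j of
     0 \<Rightarrow> K.total l (\<lambda>b. \<epsilon>' (Y b)) \<in> \<delta> l ` carrier (K (Suc l))
   | Suc i \<Rightarrow> \<exists>Z. (\<forall>b<r (Suc l). Z b \<in> carrier (F' i)) \<and>
       (\<forall>b<r l. d' i (Y b) = K.tensor_d (F' i) l Z b))"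

section \<open>Comparison of the two computations of Tor\<close>

lemma eps_closed: "x \<in> carrier (F 0) \<Longrightarrow> \<epsilon> x \<in> carrier R" "y \<in> carrier (F' 0) \<Longrightarrow> \<epsilon>' y \<in> carrier R"
  using \<epsilon>.closed \<epsilon>'.closed by simp_all

text \<open>Here the lifting property of \<open>K\<close> acts, with q = n. The total of the
  \<open>\<epsilon>' (Y b)\<close> is a boundary lying in I^(n+1)K_l, so it is the boundary of some
  \<open>w\<close> in I^nK_(l+1). The coordinates of \<open>w\<close> lie in I^n, the image of
  \<open>\<epsilon>\<close>, and are lifted to \<open>U\<close>. What remains is killed by
  \<open>\<epsilon>\<close> and yields \<open>V\<close>.\<close>

lemma zigzag_0:
  assumes K: "adic_lifting (K (Suc l)) (K l) (\<delta> l)"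
    and Y: "\<And>b. b < r l \<Longrightarrow> Y b \<in> carrier (F' 0)"
    and ext: "K.total l (\<lambda>b. \<epsilon>' (Y b)) \<in> \<delta> l ` carrier (K (Suc l))"
  shows "\<exists>U V. (\<forall>b<r (Suc l). U b \<in> carrier (F 0)) \<and> (\<forall>b<r l. V b \<in> carrier (F (Suc 0)) \<and>
    \<phi> 0 (Y b) = K.tensor_d (F 0) l U b \<oplus>\<^bsub>F 0\<^esub> d 0 (V b))"
proof -
  have eY: "\<epsilon>' (Y b) \<in> carrier R" if "b < r l" for b by (rule eps_closed(2)[OF Y[OF that]])
  have "K.total l (\<lambda>b. \<epsilon>' (Y b)) \<in> adic (Suc n + 0) (K l)"
    unfolding K.total_def
  proof (rule adic_lin_comb[OF K.mod])
    show "\<epsilon>' (Y b) \<in> pow (Suc n)" if "b \<in> {..<r l}" for b using Y[of b] that eps_image(2) by blast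
    show "e l b \<in> adic 0 (K l)" if "b \<in> {..<r l}" for b
      using K.e_closed[of b l] that by (simp add: adic_0[OF K.mod])
  qed
  moreover from ext obtain z where "z \<in> carrier (K (Suc l))" "\<delta> l z = K.total l (\<lambda>b. \<epsilon>' (Y b))"
    by (elim imageE) simp
  ultimately obtain w where w: "w \<in> adic n (K (Suc l))" "\<delta> l w = K.total l (\<lambda>b. \<epsilon>' (Y b))"
    using adic_liftingD[OF K, of z n] by auto
  have wc: "w \<in> carrier (K (Suc l))" by (rule adic_carr[OF K.mod w(1)])
  have "\<exists>u. u \<in> carrier (F 0) \<and> \<epsilon> u = c (Suc l) b w" if "b < r (Suc l)" for b
  proof -
    have "c (Suc l) b w \<in> pow n" by (rule adic_functional[OF K.c_linear[OF that] w(1)])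
    then have "c (Suc l) b w \<in> \<epsilon> ` carrier (F 0)" by (simp only: eps_image)
    then show ?thesis by (elim imageE) auto
  qed
  then obtain U where U: "\<And>b. b < r (Suc l) \<Longrightarrow> U b \<in> carrier (F 0)"
    "\<And>b. b < r (Suc l) \<Longrightarrow> \<epsilon> (U b) = c (Suc l) b w" by metis
  have "\<exists>v. v \<in> carrier (F (Suc 0)) \<and> \<phi> 0 (Y b) = K.tensor_d (F 0) l U b \<oplus>\<^bsub>F 0\<^esub> d 0 v"
    if b: "b < r l" for b
  proof -
    have tc: "K.tensor_d (F 0) l U b \<in> carrier (F 0)" by (rule K.tensor_d_closed[OF F.mod U(1) b])
    have "\<epsilon> (K.tensor_d (F 0) l U b) = K.tensor_d (self_module R) l (\<lambda>b. \<epsilon> (U b)) b"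
      by (rule K.tensor_d_natural[OF \<epsilon>.linear_map_axioms U(1) b])
    also have "\<dots> = c l b (\<delta> l (K.total (Suc l) (\<lambda>b. \<epsilon> (U b))))"
      by (rule K.tensor_d_self[OF eps_closed(1)[OF U(1)] b])
    also have "K.total (Suc l) (\<lambda>b. \<epsilon> (U b)) = K.total (Suc l) (\<lambda>b. c (Suc l) b w)"
      by (rule K.total_cong) (auto simp: U(2) K.c_closed wc)
    also have "\<dots> = w" by (rule K.total_coord[OF wc])
    also have "c l b (\<delta> l w) = \<epsilon>' (Y b)" unfolding w(2) by (rule K.coord_total[OF eY b])
    finally have "\<epsilon> (\<phi> 0 (Y b) \<ominus>\<^bsub>F 0\<^esub> K.tensor_d (F 0) l U b) = \<zero>"
      using tc Y[OF b] eY[OF b] \<epsilon>.cod.r_neg[of "\<epsilon>' (Y b)"] by (simp add: \<phi>_aug a_minus_def)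
    then obtain v where v: "v \<in> carrier (F (Suc 0))" "d 0 v = \<phi> 0 (Y b) \<ominus>\<^bsub>F 0\<^esub> K.tensor_d (F 0) l U b"
      using eps_kernel[of "\<phi> 0 (Y b) \<ominus>\<^bsub>F 0\<^esub> K.tensor_d (F 0) l U b"] tc Y[OF b] by auto
    have "K.tensor_d (F 0) l U b \<oplus>\<^bsub>F 0\<^esub> d 0 v = \<phi> 0 (Y b)"
      unfolding v(2) a_minus_def using tc Y[OF b] by (simp add: d.cod.a_ac d.cod.r_neg)
    then show ?thesis using v(1) by metis
  qed
  then obtain V where "\<And>b. b < r l \<Longrightarrow> V b \<in> carrier (F (Suc 0)) \<and>
    \<phi> 0 (Y b) = K.tensor_d (F 0) l U b \<oplus>\<^bsub>F 0\<^esub> d 0 (V b)" by metis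
  then show ?thesis using U(1) by blast
qed

text \<open>The next component always exists, which is why \<open>extends\<close> mentions only one.
  The differential of \<open>K\<close> takes d'Z to d'(d'Y) = 0, so d'Z is a cycle of positive
  degree in F'_i tensor K, which is acyclic there. At the end, \<open>\<epsilon>'\<close> takes the
  place of d'.\<close>

lemma extends_descend:
  assumes Z: "\<And>b. b < r (Suc l) \<Longrightarrow> Z b \<in> carrier (F' j)"
    and Y: "\<And>b. b < r l \<Longrightarrow> Y b \<in> carrier (F' (Suc j))"
    and YZ: "\<And>b. b < r l \<Longrightarrow> d' j (Y b) = K.tensor_d (F' j) l Z b"
  shows "extends j (Suc l) Z"
proof (cases j)
  case 0
  have "K.total (Suc l) (\<lambda>b. \<epsilon>' (Z b)) \<in> \<delta> (Suc l) ` carrier (K (Suc (Suc l)))"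
  proof (rule K.functional_cycle[OF \<epsilon>'.linear_map_axioms])
    show "\<epsilon>' (K.tensor_d (F' 0) l Z b) = \<zero>" if "b < r l" for b
      using eps'_d[of "Y b"] Y[OF that] YZ[OF that] by (simp add: 0)
  qed (use Z 0 in simp)
  then show ?thesis by (simp add: extends_def 0)
next
  case (Suc i)
  have dZ: "d' i (Z b) \<in> carrier (F' i)" if "b < r (Suc l)" for b using Z[OF that] by (simp add: Suc)
  have "\<exists>U. (\<forall>b<r (Suc (Suc l)). U b \<in> carrier (F' i)) \<and>
    (\<forall>b<r (Suc l). d' i (Z b) = K.tensor_d (F' i) (Suc l) U b)"
  proof (rule K.tensor_boundary[OF F'.free dZ])
    fix f assume f: "linear_map R (F' i) (self_module R) f"
    show "K.total (Suc l) (\<lambda>b. f (d' i (Z b))) \<in> \<delta> (Suc l) ` carrier (K (Suc (Suc l)))"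
    proof (rule K.functional_cycle[OF f dZ])
      fix b assume b: "b < r l"
      have "K.tensor_d (F' i) l (\<lambda>b. d' i (Z b)) b = d' i (K.tensor_d (F' (Suc i)) l Z b)"
        by (rule K.tensor_d_natural[OF F'.d_linear Z[unfolded Suc] b, symmetric])
      also have "\<dots> = \<zero>\<^bsub>F' i\<^esub>" using YZ[OF b] Y[OF b] F'.d_d[of "Y b" i] by (simp add: Suc)
      finally show "f (K.tensor_d (F' i) l (\<lambda>b. d' i (Z b)) b) = \<zero>"
        using linear_map.zero[OF f] by simp
    qed
  qed
  then show ?thesis by (simp only: extends_def Suc nat.case)
qed

text \<open>The induction is on \<open>j\<close>, with \<open>Z\<close> one step lower in
  \<open>F'\<close> and one step higher in \<open>K\<close>. If phi(Z) = delta(U) + d(V), then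
  phi(Y) and delta(V) have the same image under d, because delta(delta(U)) = 0; so they differ by
  some d(W). The old \<open>V\<close> thus plays the part of the new \<open>U\<close>.\<close>

lemma zigzag:
  assumes "adic_lifting (K (Suc (j + l))) (K (j + l)) (\<delta> (j + l))"
    and "\<And>b. b < r l \<Longrightarrow> Y b \<in> carrier (F' j)" and "extends j l Y"
  shows "\<exists>U V. (\<forall>b<r (Suc l). U b \<in> carrier (F j)) \<and> (\<forall>b<r l. V b \<in> carrier (F (Suc j)) \<and>
    \<phi> j (Y b) = K.tensor_d (F j) l U b \<oplus>\<^bsub>F j\<^esub> d j (V b))"
  using assms
proof (induct j arbitrary: l Y)
  case 0
  then show ?case using zigzag_0[of l Y] by (simp add: extends_def)
next
  case (Suc j)
  note Y = Suc(3)
  obtain Z where Z: "\<And>b. b < r (Suc l) \<Longrightarrow> Z b \<in> carrier (F' j)"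
    "\<And>b. b < r l \<Longrightarrow> d' j (Y b) = K.tensor_d (F' j) l Z b"
    using Suc(4) by (auto simp: extends_def)
  \<comment> \<open>The sum of the two indices is the total degree, which the descent preserves, so
    the same hypothesis on \<open>K\<close> serves throughout.\<close>
  have "adic_lifting (K (Suc (j + Suc l))) (K (j + Suc l)) (\<delta> (j + Suc l))" using Suc(2) by simp
  from Suc(1)[OF this Z(1) extends_descend[OF Z(1) Y Z(2)]]
  obtain U V where U: "\<And>b. b < r (Suc (Suc l)) \<Longrightarrow> U b \<in> carrier (F j)"
    and V: "\<And>b. b < r (Suc l) \<Longrightarrow> V b \<in> carrier (F (Suc j))"
    and UV: "\<And>b. b < r (Suc l) \<Longrightarrow> \<phi> j (Z b) = K.tensor_d (F j) (Suc l) U b \<oplus>\<^bsub>F j\<^esub> d j (V b)"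
    by blast
  have "\<exists>w. w \<in> carrier (F (Suc (Suc j))) \<and>
    \<phi> (Suc j) (Y b) = K.tensor_d (F (Suc j)) l V b \<oplus>\<^bsub>F (Suc j)\<^esub> d (Suc j) w" if b: "b < r l" for b
  proof -
    let ?t = "K.tensor_d (F (Suc j)) l V b"
    have tc: "?t \<in> carrier (F (Suc j))" by (rule K.tensor_d_closed[OF F.mod V b])
    have dtc: "d j (\<phi> (Suc j) (Y b)) \<in> carrier (F j)" "d j ?t \<in> carrier (F j)" using Y[OF b] tc by simp_all
    \<comment> \<open>The equation is checked after applying a functional, so that both sides become
      coordinates of elements of \<open>K\<close>, where \<open>K.d_d\<close> removes the
      contribution of \<open>U\<close>.\<close>
    have "d j (\<phi> (Suc j) (Y b)) = d j ?t"
    proof (rule K.fin_free_eqI[OF F.free dtc])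
      fix f assume f: "linear_map R (F j) (self_module R) f"
      interpret f: linear_map R "F j" "self_module R" f by (rule f)
      interpret dl: linear_map R "K (Suc l)" "K l" "\<delta> l" by (rule K.d_linear)
      have fc: "f x \<in> carrier R" if "x \<in> carrier (F j)" for x using f.closed[OF that] by simp
      have fp: "linear_map R (F' j) (self_module R) (\<lambda>x. f (\<phi> j x))"
        by (rule linear_map_comp[OF \<phi>_linear f])
      have fd: "linear_map R (F (Suc j)) (self_module R) (\<lambda>x. f (d j x))"
        by (rule linear_map_comp[OF F.d_linear f])
      let ?u = "\<lambda>b. K.tensor_d (self_module R) (Suc l) (\<lambda>b. f (U b)) b"
      have uc: "?u b \<in> carrier R" if "b < r (Suc l)" for b
        using K.tensor_d_closed[OF module_self, of "Suc l" "\<lambda>b. f (U b)" b] fc U that by simp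
      have vc: "f (d j (V b)) \<in> carrier R" if "b < r (Suc l)" for b using fc V that by simp
      have "f (d j (\<phi> (Suc j) (Y b))) = f (\<phi> j (K.tensor_d (F' j) l Z b))"
        using Y[OF b] Z(2)[OF b] by (simp add: \<phi>_chain)
      also have "\<dots> = K.tensor_d (self_module R) l (\<lambda>b. f (\<phi> j (Z b))) b"
        by (rule K.tensor_d_natural[OF fp Z(1) b])
      also have "\<dots> = c l b (\<delta> l (K.total (Suc l) (\<lambda>b. f (\<phi> j (Z b)))))"
        by (rule K.tensor_d_self[OF _ b]) (use fc Z(1) in simp)
      also have "K.total (Suc l) (\<lambda>b. f (\<phi> j (Z b))) = K.total (Suc l) (\<lambda>b. ?u b \<oplus> f (d j (V b)))"
      proof (rule K.total_cong)
        show "f (\<phi> j (Z b)) = ?u b \<oplus> f (d j (V b))" if "b < r (Suc l)" for b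
          using UV[OF that] V[OF that] K.tensor_d_closed[OF F.mod U that]
            K.tensor_d_natural[OF f U that] by simp
      qed (use uc vc in simp)
      also have "\<dots> = K.total (Suc l) ?u \<oplus>\<^bsub>K (Suc l)\<^esub> K.total (Suc l) (\<lambda>b. f (d j (V b)))"
        by (rule K.total_add[OF uc vc])
      also have "\<delta> l \<dots> = \<delta> l (K.total (Suc l) ?u) \<oplus>\<^bsub>K l\<^esub> \<delta> l (K.total (Suc l) (\<lambda>b. f (d j (V b))))"
        by (rule dl.add[OF K.total_closed[OF uc] K.total_closed[OF vc]])
      also have "K.total (Suc l) ?u = \<delta> (Suc l) (K.total (Suc (Suc l)) (\<lambda>b. f (U b)))"
        by (rule K.total_tensor_d) (use fc U in simp)
      also have "\<delta> l \<dots> = \<zero>\<^bsub>K l\<^esub>"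
        by (rule K.d_d[OF K.total_closed]) (use fc U in simp)
      also have "\<zero>\<^bsub>K l\<^esub> \<oplus>\<^bsub>K l\<^esub> \<delta> l (K.total (Suc l) (\<lambda>b. f (d j (V b))))
        = \<delta> l (K.total (Suc l) (\<lambda>b. f (d j (V b))))"
        by (rule dl.cod.l_zero[OF dl.closed[OF K.total_closed[OF vc]]])
      also have "c l b \<dots> = K.tensor_d (self_module R) l (\<lambda>b. f (d j (V b))) b"
        by (rule K.tensor_d_self[OF vc b, symmetric])
      also have "\<dots> = f (d j ?t)" by (rule K.tensor_d_natural[OF fd V b, symmetric])
      finally show "f (d j (\<phi> (Suc j) (Y b))) = f (d j ?t)" .
    qed
    then have "d j (\<phi> (Suc j) (Y b) \<ominus>\<^bsub>F (Suc j)\<^esub> ?t) = \<zero>\<^bsub>F j\<^esub>"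
      using Y[OF b] tc by (simp add: d.cod.r_neg a_minus_def)
    then obtain w where w: "w \<in> carrier (F (Suc (Suc j)))" "d (Suc j) w = \<phi> (Suc j) (Y b) \<ominus>\<^bsub>F (Suc j)\<^esub> ?t"
      using F.cycle_is_boundary[of "\<phi> (Suc j) (Y b) \<ominus>\<^bsub>F (Suc j)\<^esub> ?t" j] Y[OF b] tc by auto
    have "?t \<oplus>\<^bsub>F (Suc j)\<^esub> d (Suc j) w = \<phi> (Suc j) (Y b)"
      unfolding w(2) a_minus_def using tc Y[OF b] by (simp add: d.dom.a_ac d.dom.r_neg)
    then show ?thesis using w(1) by metis
  qed
  then obtain W where "\<And>b. b < r l \<Longrightarrow> W b \<in> carrier (F (Suc (Suc j))) \<and>
    \<phi> (Suc j) (Y b) = K.tensor_d (F (Suc j)) l V b \<oplus>\<^bsub>F (Suc j)\<^esub> d (Suc j) (W b)" by metis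
  then show ?case using V by blast
qed

text \<open>The matrix of \<open>\<delta> 0\<close> has its entries in I, since the image of
  \<open>\<delta> 0\<close> lies in I K_0.\<close>

lemma tensor_d_adic:
  assumes "module R M" "\<And>b. b < r (Suc 0) \<Longrightarrow> U b \<in> carrier M" "b < r 0"
  shows "K.tensor_d M 0 U b \<in> adic (Suc 0) M"
proof -
  have "K.tensor_d M 0 U b \<in> adic (Suc 0 + 0) M"
    unfolding K.tensor_d_def
  proof (rule adic_lin_comb[OF assms(1)])
    show "c 0 b (\<delta> 0 (e (Suc 0) b')) \<in> pow (Suc 0)" if "b' \<in> {..<r (Suc 0)}" for b'
      using K.e_closed[of b' "Suc 0"] that K_start
      by (intro adic_functional[OF K.c_linear[OF assms(3)]]) auto
    show "U b' \<in> adic 0 M" if "b' \<in> {..<r (Suc 0)}" for b'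
      using assms(2) that by (simp add: adic_0[OF assms(1)])
  qed
  then show ?thesis by simp
qed

lemma total_0_adic:
  assumes "\<And>b. b < r 0 \<Longrightarrow> a b \<in> pow (Suc 0)"
  shows "K.total 0 a \<in> \<delta> 0 ` carrier (K (Suc 0))"
proof -
  have "K.total 0 a \<in> adic (Suc 0 + 0) (K 0)"
    unfolding K.total_def
    by (rule adic_lin_comb[OF K.mod]) (use assms K.e_closed in \<open>auto simp: adic_0[OF K.mod]\<close>)
  then show ?thesis by (simp add: K_start)
qed

text \<open>This says that the map from \<open>Tor\<^sub>i(\<mm>\<^sup>n\<^sup>+\<^sup>1, k)\<close> to \<open>Tor\<^sub>i(\<mm>\<^sup>n, k)\<close> vanishes; the hypothesis on
  \<open>K\<close> says this for \<open>Tor\<close> computed from the resolution \<open>K\<close> of \<open>k\<close>.\<close>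

lemma \<phi>_adic:
  assumes K: "adic_lifting (K (Suc i)) (K i) (\<delta> i)" and r0: "0 < r 0" and y: "y \<in> carrier (F' i)"
  shows "\<phi> i y \<in> adic (Suc 0) (F i)"
proof -
  \<comment> \<open>The tensor of \<open>y\<close> with the basis vector number 0 of
    \<open>K 0\<close>, which exists because \<open>0 < r 0\<close>.\<close>
  let ?Y = "\<lambda>b. if b = 0 then y else \<zero>\<^bsub>F' i\<^esub>"
  have Y: "?Y b \<in> carrier (F' i)" for b using y by simp
  \<comment> \<open>At the end l = 0 every multiple of I is a boundary for the differential of
    \<open>K\<close>. So the condition follows from the minimality of \<open>F'\<close>, or for i =
    0 from the augmentation having its values in I.\<close>
  have "extends i 0 ?Y"
  proof (cases i)
    case 0
    have "\<epsilon>' (?Y b) \<in> pow (Suc 0)" for b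
    proof -
      have "\<epsilon>' (?Y b) \<in> pow (Suc n)" using Y[of b] eps_image(2) unfolding 0 by blast
      then show ?thesis
        using ideal_prod_inter[OF pow_ideal I.ideal_axioms, of n] unfolding pow_1 pow_Suc[of n] by blast
    qed
    then have "K.total 0 (\<lambda>b. \<epsilon>' (?Y b)) \<in> \<delta> 0 ` carrier (K (Suc 0))" by (intro total_0_adic)
    then show ?thesis by (simp only: extends_def 0 nat.case)
  next
    case (Suc j)
    have dY: "d' j (?Y b) \<in> carrier (F' j)" for b using Y[of b] by (simp only: Suc d'.closed)
    have "\<exists>U. (\<forall>b<r (Suc 0). U b \<in> carrier (F' j)) \<and>
      (\<forall>b<r 0. d' j (?Y b) = K.tensor_d (F' j) 0 U b)"
    proof (rule K.tensor_boundary[OF F'.free dY])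
      fix f assume f: "linear_map R (F' j) (self_module R) f"
      show "K.total 0 (\<lambda>b. f (d' j (?Y b))) \<in> \<delta> 0 ` carrier (K (Suc 0))"
        by (rule total_0_adic, rule adic_functional[OF f], rule d'_adic) (use Y in \<open>simp only: Suc\<close>)
    qed
    then show ?thesis by (simp only: extends_def Suc nat.case)
  qed
  moreover have "adic_lifting (K (Suc (i + 0))) (K (i + 0)) (\<delta> (i + 0))" using K by simp
  ultimately obtain U V where U: "\<And>b. b < r (Suc 0) \<Longrightarrow> U b \<in> carrier (F i)"
    and V: "\<And>b. b < r 0 \<Longrightarrow> V b \<in> carrier (F (Suc i))"
    and UV: "\<And>b. b < r 0 \<Longrightarrow> \<phi> i (?Y b) = K.tensor_d (F i) 0 U b \<oplus>\<^bsub>F i\<^esub> d i (V b)"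
    using zigzag[of i 0 ?Y, OF _ Y] by blast
  have "K.tensor_d (F i) 0 U 0 \<oplus>\<^bsub>F i\<^esub> d i (V 0) \<in> adic (Suc 0) (F i)"
    by (rule adic_add[OF F.mod tensor_d_adic[OF F.mod U r0] d_adic[OF V[OF r0]]])
  then show ?thesis using UV[OF r0] by simp
qed

end

section \<open>Finitely generated submodules of free modules\<close>

text \<open>These are the modules that the element type in \<open>linearity_defect\<close> is meant
  to accommodate. The functions are extensional, so that equal coordinates mean equal
  elements.\<close>

definition free_module :: "('a, 'm) ring_scheme \<Rightarrow> nat \<Rightarrow> ('a, nat \<Rightarrow> 'a) module" where
  "free_module R b = \<lparr>carrier = {..<b} \<rightarrow>\<^sub>E carrier R, monoid.mult = (\<lambda>x y. x), one = (\<lambda>i\<in>{..<b}. \<zero>\<^bsub>R\<^esub>),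
    ring.zero = (\<lambda>i\<in>{..<b}. \<zero>\<^bsub>R\<^esub>), ring.add = (\<lambda>x y. \<lambda>i\<in>{..<b}. x i \<oplus>\<^bsub>R\<^esub> y i),
    smult = (\<lambda>a x. \<lambda>i\<in>{..<b}. a \<otimes>\<^bsub>R\<^esub> x i)\<rparr>"

lemma free_module_simps [simp]:
  "carrier (free_module R b) = {..<b} \<rightarrow>\<^sub>E carrier R"
  "\<zero>\<^bsub>free_module R b\<^esub> = (\<lambda>i\<in>{..<b}. \<zero>\<^bsub>R\<^esub>)"
  "x \<oplus>\<^bsub>free_module R b\<^esub> y = (\<lambda>i\<in>{..<b}. x i \<oplus>\<^bsub>R\<^esub> y i)"
  "a \<odot>\<^bsub>free_module R b\<^esub> x = (\<lambda>i\<in>{..<b}. a \<otimes>\<^bsub>R\<^esub> x i)"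
  by (auto simp: free_module_def)

definition unit_vector :: "('a, 'm) ring_scheme \<Rightarrow> nat \<Rightarrow> nat \<Rightarrow> nat \<Rightarrow> 'a" where
  "unit_vector R b j = (\<lambda>i\<in>{..<b}. if i = j then \<one>\<^bsub>R\<^esub> else \<zero>\<^bsub>R\<^esub>)"

context cring
begin

lemma free_module_eqI:
  assumes "x \<in> carrier (free_module R b)" "y \<in> carrier (free_module R b)"
    "\<And>i. i < b \<Longrightarrow> x i = y i"
  shows "x = y"
  using assms by (auto intro: PiE_ext)

lemma module_free_module: "module R (free_module R b)"
proof (rule moduleI)
  have cl: "x i \<in> carrier R" if "x \<in> {..<b} \<rightarrow>\<^sub>E carrier R" "i < b" for x i using that by auto
  show "abelian_group (free_module R b)"
  proof (rule abelian_groupI)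
    fix x y z
    assume x: "x \<in> carrier (free_module R b)" and y: "y \<in> carrier (free_module R b)"
      and z: "z \<in> carrier (free_module R b)"
    show "(x \<oplus>\<^bsub>free_module R b\<^esub> y) \<oplus>\<^bsub>free_module R b\<^esub> z = x \<oplus>\<^bsub>free_module R b\<^esub> (y \<oplus>\<^bsub>free_module R b\<^esub> z)"
      by (rule free_module_eqI[of _ b]) (use x y z in \<open>auto simp: cl a_assoc\<close>)
  next
    fix x y
    assume x: "x \<in> carrier (free_module R b)" and y: "y \<in> carrier (free_module R b)"
    show "x \<oplus>\<^bsub>free_module R b\<^esub> y \<in> carrier (free_module R b)" using x y by (auto simp: cl)
    show "x \<oplus>\<^bsub>free_module R b\<^esub> y = y \<oplus>\<^bsub>free_module R b\<^esub> x"
      by (rule free_module_eqI[of _ b]) (use x y in \<open>auto simp: cl a_comm\<close>)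
  next
    fix x
    assume x: "x \<in> carrier (free_module R b)"
    show "\<zero>\<^bsub>free_module R b\<^esub> \<oplus>\<^bsub>free_module R b\<^esub> x = x"
      by (rule free_module_eqI[of _ b]) (use x in \<open>auto simp: cl\<close>)
    show "\<exists>y\<in>carrier (free_module R b). y \<oplus>\<^bsub>free_module R b\<^esub> x = \<zero>\<^bsub>free_module R b\<^esub>"
    proof (rule bexI[of _ "\<lambda>i\<in>{..<b}. \<ominus> x i"])
      show "(\<lambda>i\<in>{..<b}. \<ominus> x i) \<oplus>\<^bsub>free_module R b\<^esub> x = \<zero>\<^bsub>free_module R b\<^esub>"
        by (rule free_module_eqI[of _ b]) (use x in \<open>auto simp: cl l_neg\<close>)
    qed (use x in \<open>auto simp: cl\<close>)
  qed auto
next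
  fix a c x y
  assume a: "a \<in> carrier R" and c: "c \<in> carrier R" and x: "x \<in> carrier (free_module R b)"
  have xc: "x i \<in> carrier R" if "i < b" for i using x that by auto
  show "(a \<oplus> c) \<odot>\<^bsub>free_module R b\<^esub> x = a \<odot>\<^bsub>free_module R b\<^esub> x \<oplus>\<^bsub>free_module R b\<^esub> c \<odot>\<^bsub>free_module R b\<^esub> x"
    by (rule free_module_eqI[of _ b]) (use a c xc in \<open>auto simp: l_distr\<close>)
  show "(a \<otimes> c) \<odot>\<^bsub>free_module R b\<^esub> x = a \<odot>\<^bsub>free_module R b\<^esub> (c \<odot>\<^bsub>free_module R b\<^esub> x)"
    by (rule free_module_eqI[of _ b]) (use a c xc in \<open>auto simp: m_assoc\<close>)
next
  fix a x y
  assume a: "a \<in> carrier R" and x: "x \<in> carrier (free_module R b)" and y: "y \<in> carrier (free_module R b)"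
  have xc: "x i \<in> carrier R" "y i \<in> carrier R" if "i < b" for i using x y that by auto
  show "a \<odot>\<^bsub>free_module R b\<^esub> (x \<oplus>\<^bsub>free_module R b\<^esub> y) =
    a \<odot>\<^bsub>free_module R b\<^esub> x \<oplus>\<^bsub>free_module R b\<^esub> a \<odot>\<^bsub>free_module R b\<^esub> y"
    by (rule free_module_eqI[of _ b]) (use a xc in \<open>auto simp: r_distr\<close>)
next
  fix x
  assume x: "x \<in> carrier (free_module R b)"
  have xc: "x i \<in> carrier R" if "i < b" for i using x that by auto
  show "\<one> \<odot>\<^bsub>free_module R b\<^esub> x = x"
    by (rule free_module_eqI[of _ b]) (use x xc in \<open>simp_all add: PiE_iff\<close>)
qed (simp_all add: is_cring PiE_iff)

lemma linear_map_coordinate: "i < b \<Longrightarrow> linear_map R (free_module R b) (self_module R) (\<lambda>x. x i)"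
  by (rule linear_mapI) (auto simp: module_free_module module_self)

lemma unit_vector_closed: "unit_vector R b j \<in> carrier (free_module R b)"
  by (auto simp: unit_vector_def)

lemma free_basis_free_module: "free_basis R (free_module R b) {..<b} (unit_vector R b) (\<lambda>i x. x i)"
  unfolding free_basis_def
proof (intro conjI ballI)
  interpret V: module R "free_module R b" by (rule module_free_module)
  show "x = (\<Oplus>\<^bsub>free_module R b\<^esub>i\<in>{..<b}. x i \<odot>\<^bsub>free_module R b\<^esub> unit_vector R b i)"
    if x: "x \<in> carrier (free_module R b)" for x
  proof (rule free_module_eqI[OF x])
    have xc: "x i \<in> carrier R" if "i < b" for i using x that by auto
    show "(\<Oplus>\<^bsub>free_module R b\<^esub>i\<in>{..<b}. x i \<odot>\<^bsub>free_module R b\<^esub> unit_vector R b i) \<in> carrier (free_module R b)"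
      using unit_vector_closed xc by (intro V.finsum_closed) (auto simp del: free_module_simps)
    fix k assume k: "k < b"
    interpret c: linear_map R "free_module R b" "self_module R" "\<lambda>x. x k"
      by (rule linear_map_coordinate[OF k])
    have "lin_comb (free_module R b) {..<b} x (unit_vector R b) k
      = lin_comb (self_module R) {..<b} x (\<lambda>i. unit_vector R b i k)"
      by (rule c.lin_comb[of "{..<b}" x "unit_vector R b"]) (use xc unit_vector_closed in auto)
    also have "\<dots> = lin_comb (self_module R) {..<b} (\<lambda>i. if i = k then \<one> else \<zero>) x"
      unfolding lin_comb_def using xc k by (intro c.cod.finsum_cong') (auto simp: unit_vector_def)
    also have "\<dots> = x k" using k xc by (intro lin_comb_kronecker module_self) auto
    finally show "x k = (\<Oplus>\<^bsub>free_module R b\<^esub>i\<in>{..<b}. x i \<odot>\<^bsub>free_module R b\<^esub> unit_vector R b i) k"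
      by (simp only: lin_comb_def)
  qed
qed (auto simp: unit_vector_closed[simplified] linear_map_coordinate, auto simp: unit_vector_def)

text \<open>Since one differs from zero, the coordinates tell the basis vectors apart, so the index
  set can be replaced by the set of vectors.\<close>

lemma free_basis_imp_finite_basis:
  assumes fb: "free_basis R M J e c" and M: "module R M" and nt: "\<one> \<noteq> \<zero>"
  shows "finite_basis R M (e ` J)"
proof -
  interpret M: module R M by (rule M)
  note b = free_basisD[OF fb]
  have inj: "inj_on e J"
    by (rule inj_onI) (use b(5) nt in metis)
  have sum: "(\<Oplus>\<^bsub>M\<^esub>v\<in>e ` J. k v \<odot>\<^bsub>M\<^esub> v) = lin_comb M J (\<lambda>i. k (e i)) e"
    if "\<And>v. v \<in> e ` J \<Longrightarrow> k v \<in> carrier R" for k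
    unfolding lin_comb_def using that b(2) inj by (intro M.finsum_reindex) auto
  have "\<exists>!k. k \<in> e ` J \<rightarrow>\<^sub>E carrier R \<and> x = (\<Oplus>\<^bsub>M\<^esub>v\<in>e ` J. k v \<odot>\<^bsub>M\<^esub> v)" if x: "x \<in> carrier M" for x
  proof (rule ex1I)
    define k where "k = (\<lambda>v\<in>e ` J. c (the_inv_into J e v) x)"
    have ke: "k (e i) = c i x" if "i \<in> J" for i
      using that inj by (simp add: k_def the_inv_into_f_f)
    have kc: "k \<in> e ` J \<rightarrow>\<^sub>E carrier R"
      using inj b(6)[OF _ x] by (auto simp: k_def the_inv_into_f_f)
    have "lin_comb M J (\<lambda>i. k (e i)) e = lin_comb M J (\<lambda>i. c i x) e"
      using ke b(2,6) x by (intro lin_comb_cong[OF M]) auto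
    then have "x = (\<Oplus>\<^bsub>M\<^esub>v\<in>e ` J. k v \<odot>\<^bsub>M\<^esub> v)"
      using sum[of k, OF PiE_mem[OF kc]] free_basis_expand[OF fb x] by simp
    then show "k \<in> e ` J \<rightarrow>\<^sub>E carrier R \<and> x = (\<Oplus>\<^bsub>M\<^esub>v\<in>e ` J. k v \<odot>\<^bsub>M\<^esub> v)" using kc by blast
    fix k' assume k': "k' \<in> e ` J \<rightarrow>\<^sub>E carrier R \<and> x = (\<Oplus>\<^bsub>M\<^esub>v\<in>e ` J. k' v \<odot>\<^bsub>M\<^esub> v)"
    then have x': "lin_comb M J (\<lambda>i. k' (e i)) e = x"
      using sum[of k', OF PiE_mem[OF conjunct1[OF k']]] by simp
    have kc': "k' (e i) \<in> carrier R" if "i \<in> J" for i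
      using PiE_mem[OF conjunct1[OF k']] that by blast
    have "k' (e i) = k (e i)" if i: "i \<in> J" for i
    proof -
      have "c i (lin_comb M J (\<lambda>i. k' (e i)) e) = k' (e i)" by (rule free_basis_coord[OF fb M i kc'])
      then show ?thesis by (simp only: x' ke[OF i])
    qed
    then show "k' = k" using k' kc by (auto intro: PiE_ext)
  qed
  then show ?thesis using b(1,2) by (auto simp: finite_basis_def)
qed

text \<open>With generation phrased through submodules, using it means exhibiting a submodule that
  contains \<open>S\<close>, and linear combinations need not be handled.\<close>

definition generates :: "('a, 'c) module \<Rightarrow> 'c set \<Rightarrow> 'c set \<Rightarrow> bool" where
  "generates M S N \<longleftrightarrow> finite S \<and> S \<subseteq> N \<and> (\<forall>L. submodule L R M \<longrightarrow> S \<subseteq> L \<longrightarrow> N \<subseteq> L)"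

lemma submodule_Int:
  assumes "module R M" "submodule N R M" "submodule L R M" shows "submodule (N \<inter> L) R M"
proof -
  interpret M: module R M by fact
  show ?thesis
    using M.submoduleE[OF assms(2)] M.submoduleE[OF assms(3)] M.submodule_zero[OF assms(2)]
      M.submodule_zero[OF assms(3)] by (intro M.submoduleI) auto
qed

lemma submodule_imp_ideal:
  assumes "submodule J R (ideal_module R L)" "ideal L R" shows "ideal J R"
proof -
  interpret L: module R "ideal_module R L" by (rule module_ideal_module[OF assms(2)])
  note s = L.submoduleE[OF assms(1), simplified]
  have sc: "x \<in> carrier R" if "x \<in> J" for x using s(1) that ideal.Icarr[OF assms(2)] by blast
  have z: "\<zero> \<in> J" using L.submodule_zero[OF assms(1)] by simp
  have inv: "\<ominus> x \<in> J" if "x \<in> J" for x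
    using s(4)[of "\<ominus> \<one>" x] sc[OF that] that by (simp add: l_minus)
  show ?thesis
  proof (rule idealI[OF ring_axioms])
    show "subgroup J (add_monoid R)"
      by (rule subgroup.intro) (use sc z inv s(5) in \<open>auto simp: a_inv_def\<close>)
    fix a x assume ax: "a \<in> J" "x \<in> carrier R"
    show "x \<otimes> a \<in> J" by (rule s(4)[OF ax(2,1)])
    then show "a \<otimes> x \<in> J" using ax(2) sc[OF ax(1)] by (simp add: m_comm)
  qed
qed

end

sublocale noetherian_local_ring \<subseteq> cring_ideal R \<mm> ..

context noetherian_local_ring
begin

lemma ideal_generates:
  assumes J: "ideal J R" shows "\<exists>S. generates (ideal_module R J) S J"
proof -
  obtain A where A: "A \<subseteq> carrier R" "finite A" "J = Idl A" using finetely_gen[OF J] by blast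
  have "generates (ideal_module R J) A J"
    unfolding generates_def
  proof (intro conjI allI impI)
    show "A \<subseteq> J" using genideal_self[OF A(1)] A(3) by simp
    show "J \<subseteq> L" if "submodule L R (ideal_module R J)" "A \<subseteq> L" for L
      using genideal_minimal[OF submodule_imp_ideal[OF that(1) J] that(2)] A(3) by simp
  qed (rule A(2))
  then show ?thesis by blast
qed

text \<open>\<open>k\<close> bounds the positions at which vectors of \<open>N\<close> may be
  nonzero. The entries at the last of these positions form an ideal. Lifts of finitely many
  generators of it, together with generators of the vectors that vanish there, generate
  \<open>N\<close>.\<close>

lemma free_module_submodule_generates:
  assumes "submodule N R (free_module R b)" "\<And>v i. v \<in> N \<Longrightarrow> k \<le> i \<Longrightarrow> i < b \<Longrightarrow> v i = \<zero>"
  shows "\<exists>S. generates (free_module R b) S N"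
  using assms
proof (induct k arbitrary: N)
  case 0
  interpret V: module R "free_module R b" by (rule module_free_module)
  have "N \<subseteq> {\<zero>\<^bsub>free_module R b\<^esub>}"
  proof
    fix v assume v: "v \<in> N"
    then have "v \<in> carrier (free_module R b)" using V.submoduleE(1)[OF 0(1)] by blast
    then have "v = \<zero>\<^bsub>free_module R b\<^esub>"
      using 0(2)[OF v] by (intro free_module_eqI[of _ b]) auto
    then show "v \<in> {\<zero>\<^bsub>free_module R b\<^esub>}" by simp
  qed
  then have "generates (free_module R b) {} N"
    unfolding generates_def using V.submodule_zero by blast
  then show ?case by blast
next
  case (Suc k)
  interpret V: module R "free_module R b" by (rule module_free_module)
  show ?case
  proof (cases "k < b")
    case False
    then show ?thesis using Suc(1)[OF Suc(2)] by simp
  next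
    case True
    note lin = linear_map_coordinate[OF True]
    interpret c: linear_map R "free_module R b" "self_module R" "\<lambda>x. x k" by (rule lin)
    let ?V = "free_module R b"
    note N = V.submoduleE[OF Suc(2)]
    have J: "ideal ((\<lambda>v. v k) ` N) R"
      by (rule submodule_imp_ideal[OF c.image_submodule[OF Suc(2)] oneideal])
    obtain A where A: "A \<subseteq> carrier R" "finite A" "(\<lambda>v. v k) ` N = Idl A" using finetely_gen[OF J] by blast
    have "A \<subseteq> (\<lambda>v. v k) ` N" using genideal_self[OF A(1)] A(3) by simp
    then have "\<forall>a\<in>A. \<exists>v\<in>N. v k = a" by (auto simp: image_iff subset_eq)
    then obtain w where w: "\<And>a. a \<in> A \<Longrightarrow> w a \<in> N" "\<And>a. a \<in> A \<Longrightarrow> w a k = a" by metis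
    have "submodule {\<zero>\<^bsub>self_module R\<^esub>} R (self_module R)"
      by (rule c.cod.submoduleI) (auto simp del: ideal_module_simps)
    then have z: "submodule {\<zero>} R (self_module R)" by simp
    let ?N0 = "N \<inter> {x \<in> carrier ?V. x k \<in> {\<zero>}}"
    have N0: "submodule ?N0 R ?V"
      by (rule submodule_Int[OF V.module_axioms Suc(2) c.vimage_submodule[OF z]])
    have "\<exists>S. generates ?V S ?N0"
    proof (rule Suc(1)[OF N0])
      show "v i = \<zero>" if "v \<in> ?N0" "k \<le> i" "i < b" for v i
        using that Suc(3)[of v i] by (cases "i = k") auto
    qed
    then obtain S0 where S0: "generates ?V S0 ?N0" by blast
    have "generates ?V (w ` A \<union> S0) N"
      unfolding generates_def
    proof (intro conjI allI impI)
      show "finite (w ` A \<union> S0)" using A(2) S0 by (simp add: generates_def)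
      show "w ` A \<union> S0 \<subseteq> N" using w(1) S0 by (auto simp: generates_def)
      fix L assume L: "submodule L R ?V" and sub: "w ` A \<union> S0 \<subseteq> L"
      \<comment> \<open>Intersecting with \<open>N\<close> ensures that the vector \<open>u\<close>
        found below lies in \<open>N\<close>, so that the difference of \<open>v\<close> and
        \<open>u\<close> falls into \<open>?N0\<close>.\<close>
      have "ideal ((\<lambda>v. v k) ` (L \<inter> N)) R"
        by (rule submodule_imp_ideal[OF c.image_submodule oneideal])
          (rule submodule_Int[OF V.module_axioms L Suc(2)])
      moreover have "A \<subseteq> (\<lambda>v. v k) ` (L \<inter> N)"
      proof
        fix a assume a: "a \<in> A"
        show "a \<in> (\<lambda>v. v k) ` (L \<inter> N)"
          by (rule image_eqI[of _ _ "w a"]) (use w(1,2)[OF a] a sub in auto)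
      qed
      ultimately have IA: "Idl A \<subseteq> (\<lambda>v. v k) ` (L \<inter> N)" by (rule genideal_minimal)
      show "N \<subseteq> L"
      proof
        fix v assume v: "v \<in> N"
        then have "v k \<in> (\<lambda>v. v k) ` (L \<inter> N)" using IA A(3) by blast
        then obtain u where u: "u \<in> L" "u \<in> N" "u k = v k" by auto
        have cl: "u \<in> carrier ?V" "v \<in> carrier ?V" using u(2) v N(1) by blast+
        have "(v \<ominus>\<^bsub>?V\<^esub> u) k = v k \<ominus>\<^bsub>self_module R\<^esub> u k" using cl by (rule c.minus[rotated])
        also have "\<dots> = \<zero>"
          using c.closed[OF cl(2)] c.cod.r_neg[of "v k"] by (simp add: u(3) a_minus_def)
        finally have "v \<ominus>\<^bsub>?V\<^esub> u \<in> ?N0"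
          using V.submodule_minus[OF Suc(2) v u(2)] V.minus_closed[OF cl(2,1)] by blast
        then have "v \<ominus>\<^bsub>?V\<^esub> u \<in> L" using S0 L sub by (auto simp: generates_def)
        then have "v \<ominus>\<^bsub>?V\<^esub> u \<oplus>\<^bsub>?V\<^esub> u \<in> L" using V.submoduleE(5)[OF L] u(1) by blast
        moreover have "v \<ominus>\<^bsub>?V\<^esub> u \<oplus>\<^bsub>?V\<^esub> u = v"
          using cl unfolding a_minus_def by (simp only: V.M.a_assoc V.M.a_inv_closed V.M.l_neg V.M.r_zero)
        ultimately show "v \<in> L" by simp
      qed
    qed
    then show ?thesis by blast
  qed
qed

section \<open>Existence of minimal free resolutions\<close>

lemma one_notin: "\<one> \<notin> \<mm>"
  using max.one_imp_carrier max.I_notcarr by blast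

lemma one_neq_zero: "\<one> \<noteq> \<zero>"
  using one_notin additive_subgroup.zero_closed[OF ideal.axioms(1)[OF max.is_ideal]] by metis

text \<open>A non-unit generates a proper ideal, which lies in a maximal one, and this can only be
  \<open>\<mm>\<close>. In the appeal to Zorn's lemma the union of a chain of ideals belongs to the
  chain, by the Noetherian condition.\<close>

lemma unit_if_notin:
  assumes a: "a \<in> carrier R" "a \<notin> \<mm>" shows "\<exists>u\<in>carrier R. u \<otimes> a = \<one>"
proof (rule ccontr)
  assume no: "\<not> (\<exists>u\<in>carrier R. u \<otimes> a = \<one>)"
  let ?A = "{J. ideal J R \<and> a \<in> J \<and> \<one> \<notin> J}"
  have "\<one> \<notin> PIdl a" using no by (auto simp: cgenideal_def)
  then have ne: "?A \<noteq> {}" using cgenideal_ideal[OF a(1)] cgenideal_self[OF a(1)] by blast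
  have "\<exists>M\<in>?A. \<forall>J\<in>?A. M \<subseteq> J \<longrightarrow> J = M"
  proof (rule subset_Zorn_nonempty[OF ne])
    fix C assume C: "C \<noteq> {}" "subset.chain ?A C"
    then have "subset.chain {I. ideal I R} C" by (auto simp: subset_chain_def)
    then have "\<Union>C \<in> C" by (rule ideal_chain_is_trivial[OF C(1)])
    then show "\<Union>C \<in> ?A" using C(2) by (auto simp: subset_chain_def)
  qed
  then obtain M where M: "ideal M R" "a \<in> M" "\<one> \<notin> M"
    and max: "\<And>J. ideal J R \<Longrightarrow> a \<in> J \<Longrightarrow> \<one> \<notin> J \<Longrightarrow> M \<subseteq> J \<Longrightarrow> J = M" by blast
  have "maximalideal M R"
  proof (rule maximalidealI[OF M(1)])
    show "carrier R \<noteq> M" using M(3) by blast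
    show "J = M \<or> J = carrier R" if "ideal J R" "M \<subseteq> J" for J
      using max[OF that(1) _ _ that(2)] M(2) that ideal.one_imp_carrier by blast
  qed
  then show False using maximal_unique M(2) a(2) by blast
qed

text \<open>A generating set of minimal size yields a cover with kernel in \<open>\<mm>\<close>: a relation with a unit
  coefficient would make one of the generators superfluous.\<close>

lemma minimal_cover:
  assumes M: "module R M" and N: "submodule N R M" and S: "generates M S N"
  shows "\<exists>b f. linear_map R (free_module R b) M f \<and> f ` carrier (free_module R b) = N \<and>
    (\<forall>x\<in>carrier (free_module R b). f x = \<zero>\<^bsub>M\<^esub> \<longrightarrow> x \<in> adic (Suc 0) (free_module R b))"
proof -
  interpret M: module R M by (rule M)
  note Ns = M.submoduleE[OF N]
  obtain T where T: "generates M T N" and least: "\<And>S. generates M S N \<Longrightarrow> card T \<le> card S"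
    using S ex_has_least_nat[of "\<lambda>S. generates M S N" S card] by blast
  have Tf: "finite T" and TN: "T \<subseteq> N" and Tg: "\<And>L. submodule L R M \<Longrightarrow> T \<subseteq> L \<Longrightarrow> N \<subseteq> L"
    using T by (auto simp: generates_def)
  obtain h where "bij_betw h {0..<card T} T" using ex_bij_betw_nat_finite[OF Tf] by blast
  then have h: "inj_on h {..<card T}" "h ` {..<card T} = T"
    by (auto simp: bij_betw_def atLeast0LessThan)
  have hN: "h i \<in> N" if "i < card T" for i using h(2) TN that by blast
  have hM: "h i \<in> carrier M" if "i < card T" for i using hN[OF that] Ns(1) by blast
  let ?b = "card T" and ?V = "free_module R (card T)"
  define f where "f x = lin_comb M {..<?b} x h" for x
  have xc: "x i \<in> carrier R" if "x \<in> carrier ?V" "i < ?b" for x i using that by auto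
  have f: "linear_map R ?V M f"
    using linear_map_lin_comb[OF module_free_module[of ?b] M, where c = "\<lambda>i x. x i" and I = "{..<?b}" and y = h]
      linear_map_coordinate hM by (simp add: f_def[abs_def])
  interpret f: linear_map R ?V M f by (rule f)
  have "f (unit_vector R ?b j) = h j" if j: "j < ?b" for j
  proof -
    have "f (unit_vector R ?b j) = lin_comb M {..<?b} (\<lambda>i. if i = j then \<one> else \<zero>) h"
      unfolding f_def by (rule lin_comb_cong[OF M]) (auto simp: unit_vector_def hM)
    then show ?thesis using lin_comb_kronecker[OF M, of "{..<?b}" j h] j hM by simp
  qed
  then have "T \<subseteq> f ` carrier ?V"
    using unit_vector_closed h(2) by (metis (no_types, lifting) image_iff lessThan_iff subsetI)
  then have "N \<subseteq> f ` carrier ?V"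
    by (intro Tg f.image_submodule f.dom.carrier_is_submodule)
  moreover have "f ` carrier ?V \<subseteq> N"
    unfolding f_def lin_comb_def
    by (intro image_subsetI M.finsum_mem_submodule[OF N]) (use Ns(4) hN xc in blast)
  moreover have "x \<in> adic (Suc 0) ?V" if x: "x \<in> carrier ?V" and fx: "f x = \<zero>\<^bsub>M\<^esub>" for x
  proof -
    have "x i \<in> \<mm>" if i: "i < ?b" for i
    proof (rule ccontr)
      assume "x i \<notin> \<mm>"
      then obtain u where u: "u \<in> carrier R" "u \<otimes> x i = \<one>" using unit_if_notin xc[OF x i] by blast
      have "generates M (T - {h i}) N"
        unfolding generates_def
      proof (intro conjI allI impI)
        fix L assume L: "submodule L R M" and sub: "T - {h i} \<subseteq> L"
        note Ls = M.submoduleE[OF L]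
        let ?rest = "\<Oplus>\<^bsub>M\<^esub>j\<in>{..<?b} - {i}. x j \<odot>\<^bsub>M\<^esub> h j"
        \<comment> \<open>As \<open>h\<close> is injective, removing its value at \<open>i\<close>
          from \<open>T\<close> keeps all the other generators.\<close>
        have "h j \<in> L" if "j \<in> {..<?b} - {i}" for j
          using that h sub i by (auto simp: inj_on_def)
        then have rest: "?rest \<in> L"
          by (intro M.finsum_mem_submodule[OF L]) (use Ls(4) xc[OF x] in blast)
        have rc: "?rest \<in> carrier M" using rest Ls(1) by blast
        have xh: "x i \<odot>\<^bsub>M\<^esub> h i \<in> carrier M" using xc[OF x i] hM[OF i] by simp
        have "f x = (\<Oplus>\<^bsub>M\<^esub>j\<in>insert i ({..<?b} - {i}). x j \<odot>\<^bsub>M\<^esub> h j)"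
          using i by (simp add: f_def lin_comb_def insert_absorb)
        also have "\<dots> = x i \<odot>\<^bsub>M\<^esub> h i \<oplus>\<^bsub>M\<^esub> ?rest"
          by (rule M.finsum_insert) (use xc[OF x] hM i in auto)
        finally have "x i \<odot>\<^bsub>M\<^esub> h i \<oplus>\<^bsub>M\<^esub> ?rest = \<zero>\<^bsub>M\<^esub>" using fx by simp
        then have "x i \<odot>\<^bsub>M\<^esub> h i = \<ominus>\<^bsub>M\<^esub> ?rest" using xh rc by (metis M.minus_equality)
        then have "x i \<odot>\<^bsub>M\<^esub> h i \<in> L" using Ls(3)[OF rest] by simp
        then have "u \<odot>\<^bsub>M\<^esub> (x i \<odot>\<^bsub>M\<^esub> h i) \<in> L" using Ls(4) u(1) by blast
        then have "h i \<in> L"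
          using M.smult_assoc1[OF u(1) xc[OF x i] hM[OF i]] u(2) hM[OF i] by simp
        then show "N \<subseteq> L" using Tg[OF L] sub by blast
      qed (use Tf TN in auto)
      then have "card T \<le> card (T - {h i})" by (rule least)
      then show False using Tf h(2) i by (metis card_Diff1_less image_eqI lessThan_iff not_le)
    qed
    then have "lin_comb ?V {..<?b} x (unit_vector R ?b) \<in> adic (Suc 0 + 0) ?V"
      by (intro adic_lin_comb[OF module_free_module])
        (auto simp only: pow_1 adic_0[OF module_free_module] unit_vector_closed lessThan_iff)
    then show ?thesis using free_basis_expand[OF free_basis_free_module x] by simp
  qed
  ultimately show ?thesis using f by blast
qed

lemma minimal_free_resolution_exists:
  assumes M: "module R M" and S: "generates M S (carrier M)"
  shows "\<exists>(F :: nat \<Rightarrow> ('a, nat \<Rightarrow> 'a) module) d \<epsilon>. minimal_free_resolution R \<mm> M F d \<epsilon>"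
proof -
  interpret M: module R M by (rule M)
  let ?V = "\<lambda>b. free_module R b"
  let ?ker = "\<lambda>b f z. {x \<in> carrier (?V b). f x = z}"
  have kersub: "submodule (?ker b f \<zero>\<^bsub>P\<^esub>) R (?V b)" if "linear_map R (?V b) P f" for b P and f :: "(nat \<Rightarrow> 'a) \<Rightarrow> 'z"
  proof -
    interpret f: linear_map R "?V b" P f by (rule that)
    have z: "submodule {\<zero>\<^bsub>P\<^esub>} R P" by (rule f.cod.submoduleI) auto
    show ?thesis using f.vimage_submodule[OF z] by simp
  qed
  obtain b0 \<epsilon> where e: "linear_map R (?V b0) M \<epsilon>" "\<epsilon> ` carrier (?V b0) = carrier M"
    "\<And>x. x \<in> carrier (?V b0) \<Longrightarrow> \<epsilon> x = \<zero>\<^bsub>M\<^esub> \<Longrightarrow> x \<in> adic (Suc 0) (?V b0)"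
    using minimal_cover[OF M M.carrier_is_submodule S] by blast
  \<comment> \<open>A state consists of the rank of F_i and the submodule that the next differential
    has to cover; its containment in m F_i is the minimality of that differential. The differentials
    themselves are chosen at the end, since each links two consecutive states.\<close>
  let ?inv = "\<lambda>(i::nat) s. submodule (snd s) R (?V (fst s)) \<and> snd s \<subseteq> adic (Suc 0) (?V (fst s)) \<and>
    (i = 0 \<longrightarrow> s = (b0, ?ker b0 \<epsilon> \<zero>\<^bsub>M\<^esub>))"
  let ?step = "\<lambda>s s' f. linear_map R (?V (fst s')) (?V (fst s)) f \<and> f ` carrier (?V (fst s')) = snd s \<and>
    snd s' = ?ker (fst s') f \<zero>\<^bsub>?V (fst s)\<^esub>"
  have "\<exists>s. \<forall>i. ?inv i (s i) \<and> (\<exists>f. ?step (s i) (s (Suc i)) f)"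
  proof (rule dependent_nat_choice)
    show "\<exists>s. ?inv 0 s"
      by (rule exI[of _ "(b0, ?ker b0 \<epsilon> \<zero>\<^bsub>M\<^esub>)"]) (use kersub[OF e(1)] e(3) in \<open>auto simp del: free_module_simps\<close>)
    fix s :: "nat \<times> (nat \<Rightarrow> 'a) set" and i :: nat
    assume s: "?inv i s"
    have sub: "submodule (snd s) R (?V (fst s))" using s by simp
    obtain T where T: "generates (?V (fst s)) T (snd s)"
      using free_module_submodule_generates[of "snd s" "fst s" "fst s"] sub by auto
    obtain b f where f: "linear_map R (?V b) (?V (fst s)) f" "f ` carrier (?V b) = snd s"
      "\<And>x. x \<in> carrier (?V b) \<Longrightarrow> f x = \<zero>\<^bsub>?V (fst s)\<^esub> \<Longrightarrow> x \<in> adic (Suc 0) (?V b)"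
      using minimal_cover[OF module_free_module sub T] by (elim exE conjE) (rule that, assumption+, blast)
    have i1: "?inv (Suc i) (b, ?ker b f \<zero>\<^bsub>?V (fst s)\<^esub>)" using kersub[OF f(1)] f(3) by (auto simp del: free_module_simps)
    have i2: "?step s (b, ?ker b f \<zero>\<^bsub>?V (fst s)\<^esub>) f" using f(1,2) by simp
    show "\<exists>s'. ?inv (Suc i) s' \<and> (\<exists>f. ?step s s' f)"
      by (rule exI[of _ "(b, ?ker b f \<zero>\<^bsub>?V (fst s)\<^esub>)"], rule conjI[OF i1], rule exI[of _ f], rule i2)
  qed
  then obtain s where S: "\<forall>i. ?inv i (s i) \<and> (\<exists>f. ?step (s i) (s (Suc i)) f)" by (rule exE)
  have s: "?inv i (s i)" for i by (rule conjunct1[OF spec[OF S]])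
  have "\<forall>i. \<exists>f. ?step (s i) (s (Suc i)) f" by (rule allI, rule conjunct2[OF spec[OF S]])
  from choice[OF this] obtain d where D: "\<forall>i. ?step (s i) (s (Suc i)) (d i)" by (rule exE)
  have d: "linear_map R (?V (fst (s (Suc i)))) (?V (fst (s i))) (d i)"
    "d i ` carrier (?V (fst (s (Suc i)))) = snd (s i)"
    "snd (s (Suc i)) = ?ker (fst (s (Suc i))) (d i) \<zero>\<^bsub>?V (fst (s i))\<^esub>" for i
    by (rule conjunct1[OF spec[OF D]], rule conjunct1[OF conjunct2[OF spec[OF D]]],
        rule conjunct2[OF conjunct2[OF spec[OF D]]])
  have s0: "s 0 = (b0, ?ker b0 \<epsilon> \<zero>\<^bsub>M\<^esub>)" using s[of 0] by (elim conjE mp) (rule refl)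
  have "minimal_free_resolution R \<mm> M (\<lambda>i. ?V (fst (s i))) d \<epsilon>"
  proof (rule minimal_free_resolution.intro)
    show "module R (?V (fst (s i)))" for i by (rule module_free_module)
    show "\<exists>B. finite_basis R (?V (fst (s i))) B" for i
      using free_basis_imp_finite_basis[OF free_basis_free_module module_free_module one_neq_zero] by blast
    show "d i \<in> module_hom R (?V (fst (s (Suc i)))) (?V (fst (s i)))" for i
      using d(1)[of i] by (simp only: linear_map_iff)
    show "\<epsilon> \<in> module_hom R (?V (fst (s 0))) M" using e(1) s0 by (simp add: linear_map_iff)
    show "\<epsilon> ` carrier (?V (fst (s 0))) = carrier M" using e(2) by (simp only: s0 fst_conv)
    show "a_kernel (?V (fst (s 0))) M \<epsilon> = d 0 ` carrier (?V (fst (s 1)))"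
    proof -
      have "d 0 ` carrier (?V (fst (s (Suc 0)))) = snd (s 0)" by (rule d(2))
      then show ?thesis by (simp only: One_nat_def s0 fst_conv snd_conv a_kernel_def')
    qed
    show "a_kernel (?V (fst (s (Suc i)))) (?V (fst (s i))) (d i) = d (Suc i) ` carrier (?V (fst (s (Suc (Suc i)))))" for i
    proof -
      show ?thesis unfolding d(2) d(3) by (simp only: a_kernel_def')
    qed
    show "d i ` carrier (?V (fst (s (Suc i)))) \<subseteq> ideal_smult \<mm> (?V (fst (s i)))" for i
    proof -
      have "snd (s i) \<subseteq> adic (Suc 0) (?V (fst (s i)))" using s[of i] by (elim conjE)
      then show ?thesis unfolding d(2) by (simp only: adic_1[OF module_free_module])
    qed
  qed
  then show ?thesis by blast
qed

section \<open>The residue field\<close>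

lemma module_quotient: "module R (quotient_module R \<mm>)"
proof -
  interpret Q: cring "R Quot \<mm>" by (rule max.quotient_is_cring[OF is_cring])
  interpret h: ring_hom_ring R "R Quot \<mm>" "(+>) \<mm>" by (rule max.rcos_ring_hom_ring)
  show ?thesis
  proof (rule moduleI[OF is_cring])
    show "abelian_group (quotient_module R \<mm>)"
      by (rule abelian_groupI) (auto simp: quotient_module_def restrict_scalars_def Q.a_ac
        intro!: bexI[of _ "\<ominus>\<^bsub>R Quot \<mm>\<^esub> x" for x] Q.l_neg)
  qed (auto simp: quotient_module_def restrict_scalars_def Q.l_distr Q.r_distr Q.m_assoc)
qed

lemma quotient_smult_zero:
  assumes "a \<in> \<mm>" "x \<in> carrier (quotient_module R \<mm>)"
  shows "a \<odot>\<^bsub>quotient_module R \<mm>\<^esub> x = \<zero>\<^bsub>quotient_module R \<mm>\<^esub>"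
proof -
  interpret Q: cring "R Quot \<mm>" by (rule max.quotient_is_cring[OF is_cring])
  have "\<mm> +> a = \<zero>\<^bsub>R Quot \<mm>\<^esub>" using assms(1) max.a_rcos_const by (simp add: FactRing_def)
  then show ?thesis using assms(2) by (simp add: quotient_module_def restrict_scalars_def)
qed

lemma quotient_carrier: "carrier (quotient_module R \<mm>) = (+>) \<mm> ` carrier R"
  by (auto simp: quotient_module_def restrict_scalars_def FactRing_def A_RCOSETS_def')

lemma quotient_generates:
  "generates (quotient_module R \<mm>) {\<mm> +> \<one>} (carrier (quotient_module R \<mm>))"
  unfolding generates_def
proof (intro conjI allI impI)
  show "{\<mm> +> \<one>} \<subseteq> carrier (quotient_module R \<mm>)" unfolding quotient_carrier by blast
  fix L assume L: "submodule L R (quotient_module R \<mm>)" "{\<mm> +> \<one>} \<subseteq> L"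
  show "carrier (quotient_module R \<mm>) \<subseteq> L"
  proof
    fix x assume "x \<in> carrier (quotient_module R \<mm>)"
    then obtain a where a: "a \<in> carrier R" "x = \<mm> +> a" unfolding quotient_carrier by blast
    have "\<mm> +> (a \<otimes> \<one>) = (\<mm> +> a) \<otimes>\<^bsub>R Quot \<mm>\<^esub> (\<mm> +> \<one>)"
      by (rule ring_hom_mult[OF max.rcos_ring_hom a(1) one_closed])
    then have "x = a \<odot>\<^bsub>quotient_module R \<mm>\<^esub> (\<mm> +> \<one>)"
      using a by (simp add: quotient_module_def restrict_scalars_def)
    then show "x \<in> L" using module.submoduleE(4)[OF module_quotient L(1) a(1)] L(2) by simp
  qed
qed simp

lemma quotient_nontrivial: "carrier (quotient_module R \<mm>) \<noteq> {\<zero>\<^bsub>quotient_module R \<mm>\<^esub>}"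
proof
  assume 0: "carrier (quotient_module R \<mm>) = {\<zero>\<^bsub>quotient_module R \<mm>\<^esub>}"
  have "\<mm> +> \<one> \<in> carrier (quotient_module R \<mm>)" unfolding quotient_carrier by blast
  then have "\<mm> +> \<one> = \<mm>"
    unfolding 0 by (simp add: quotient_module_def restrict_scalars_def FactRing_def)
  then show False using max.a_rcos_self[OF one_closed] one_notin by simp
qed

end

section \<open>Homology of the linear part\<close>

lemma trivial_group_Mod_carrier:
  assumes "group G" shows "trivial_group (G Mod carrier G)"
proof -
  interpret group G by fact
  have id: "carrier G <#>\<^bsub>G\<^esub> carrier G = carrier G" by (rule subgroup_mult_id[OF subgroup_self])
  have car: "carrier (G Mod carrier G) = {carrier G}"
    using coset_join2[OF _ subgroup_self] one_closed by (auto simp: FactGroup_def RCOSETS_def)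
  have ops: "u \<otimes>\<^bsub>G Mod carrier G\<^esub> v = u <#>\<^bsub>G\<^esub> v" "\<one>\<^bsub>G Mod carrier G\<^esub> = carrier G" for u v
    by (simp_all add: FactGroup_def)
  have "group (G Mod carrier G)"
    by (rule groupI) (auto simp: car ops id)
  then show ?thesis by (simp add: trivial_group_def car ops)
qed

context cring_ideal
begin

section \<open>The associated graded group of a module\<close>

abbreviation cls :: "nat \<Rightarrow> ('a, 'c) module \<Rightarrow> 'c \<Rightarrow> 'c set" where
  "cls n M x \<equiv> adic (Suc n) M +>\<^bsub>M\<^esub> x"

lemma gr_part_simps:
  "carrier (gr_part R I M n) = cls n M ` adic n M"
  "\<one>\<^bsub>gr_part R I M n\<^esub> = adic (Suc n) M"
  "u \<otimes>\<^bsub>gr_part R I M n\<^esub> v = u <+>\<^bsub>M\<^esub> v"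
  by (auto simp: gr_part_def A_FactGroup_def FactGroup_def RCOSETS_def a_r_coset_def r_coset_def
      set_add_def set_mult_def)

lemma adic_abelian_subgroup: assumes "module R M" shows "abelian_subgroup (adic q M) M"
proof -
  interpret M: module R M by fact
  show ?thesis
    using submodule.axioms(1)[OF adic_submodule[OF assms]] M.M.abelian_group_axioms
    by (intro abelian_subgroupI3 additive_subgroupI)
qed

lemma cls_eq_iff:
  assumes M: "module R M" and x: "x \<in> carrier M" and y: "y \<in> carrier M"
  shows "cls n M x = cls n M y \<longleftrightarrow> x \<ominus>\<^bsub>M\<^esub> y \<in> adic (Suc n) M"
proof -
  interpret S: abelian_subgroup "adic (Suc n) M" M by (rule adic_abelian_subgroup[OF M])
  have "cls n M x = cls n M y \<longleftrightarrow> x \<in> cls n M y"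
    using S.a_repr_independence'[OF _ y] S.a_repr_independenceD[OF x] by metis
  then show ?thesis using S.a_rcos_module[OF y x] by (simp add: a_minus_def)
qed

lemma cls_zero: assumes M: "module R M" shows "cls n M \<zero>\<^bsub>M\<^esub> = adic (Suc n) M"
proof -
  interpret S: abelian_subgroup "adic (Suc n) M" M by (rule adic_abelian_subgroup[OF M])
  show ?thesis by (rule S.a_rcos_const[OF adic_zero[OF M]])
qed

lemma cls_eq_one_iff:
  assumes M: "module R M" and x: "x \<in> carrier M"
  shows "cls n M x = adic (Suc n) M \<longleftrightarrow> x \<in> adic (Suc n) M"
proof -
  interpret M: module R M by (rule M)
  have z: "\<ominus>\<^bsub>M\<^esub> \<zero>\<^bsub>M\<^esub> = \<zero>\<^bsub>M\<^esub>" by (rule M.M.minus_equality) simp_all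
  have "x \<ominus>\<^bsub>M\<^esub> \<zero>\<^bsub>M\<^esub> = x" unfolding a_minus_def z using x by simp
  then show ?thesis using cls_eq_iff[OF M x M.M.zero_closed, of n] unfolding cls_zero[OF M] by simp
qed

lemma cls_add:
  assumes M: "module R M" and x: "x \<in> carrier M" and y: "y \<in> carrier M"
  shows "cls n M x <+>\<^bsub>M\<^esub> cls n M y = cls n M (x \<oplus>\<^bsub>M\<^esub> y)"
proof -
  interpret S: abelian_subgroup "adic (Suc n) M" M by (rule adic_abelian_subgroup[OF M])
  show ?thesis by (rule S.a_rcos_sum[OF x y])
qed

lemma gr_part_group: assumes M: "module R M" shows "group (gr_part R I M n)"
proof -
  interpret M: module R M by (rule M)
  note c = adic_carr[OF M, of _ n]
  show ?thesis
  proof (rule groupI)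
    show "\<one>\<^bsub>gr_part R I M n\<^esub> \<in> carrier (gr_part R I M n)"
      unfolding gr_part_simps by (rule image_eqI, rule cls_zero[OF M, symmetric], rule adic_zero[OF M])
  next
    fix u v assume "u \<in> carrier (gr_part R I M n)" "v \<in> carrier (gr_part R I M n)"
    then obtain x y where x: "x \<in> adic n M" "y \<in> adic n M" "u = cls n M x" "v = cls n M y"
      unfolding gr_part_simps by (elim imageE) simp
    show "u \<otimes>\<^bsub>gr_part R I M n\<^esub> v \<in> carrier (gr_part R I M n)"
      unfolding x gr_part_simps cls_add[OF M c[OF x(1)] c[OF x(2)]]
      by (rule imageI[OF adic_add[OF M x(1,2)]])
  next
    fix u v w
    assume "u \<in> carrier (gr_part R I M n)" "v \<in> carrier (gr_part R I M n)" "w \<in> carrier (gr_part R I M n)"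
    then obtain x y z where x: "x \<in> adic n M" "y \<in> adic n M" "z \<in> adic n M"
      "u = cls n M x" "v = cls n M y" "w = cls n M z"
      unfolding gr_part_simps by (elim imageE) simp
    note cc = c[OF x(1)] c[OF x(2)] c[OF x(3)]
    show "(u \<otimes>\<^bsub>gr_part R I M n\<^esub> v) \<otimes>\<^bsub>gr_part R I M n\<^esub> w =
      u \<otimes>\<^bsub>gr_part R I M n\<^esub> (v \<otimes>\<^bsub>gr_part R I M n\<^esub> w)"
      using cc by (simp add: x gr_part_simps cls_add[OF M] M.M.a_assoc)
  next
    fix u assume "u \<in> carrier (gr_part R I M n)"
    then obtain x where x: "x \<in> adic n M" "u = cls n M x"
      unfolding gr_part_simps by (elim imageE) simp
    note cc = c[OF x(1)]
    show "\<one>\<^bsub>gr_part R I M n\<^esub> \<otimes>\<^bsub>gr_part R I M n\<^esub> u = u"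
      using cls_add[OF M M.M.zero_closed cc, of n] cc unfolding x gr_part_simps cls_zero[OF M] by simp
    show "\<exists>v\<in>carrier (gr_part R I M n). v \<otimes>\<^bsub>gr_part R I M n\<^esub> u = \<one>\<^bsub>gr_part R I M n\<^esub>"
    proof (rule bexI[of _ "cls n M (\<ominus>\<^bsub>M\<^esub> x)"])
      show "cls n M (\<ominus>\<^bsub>M\<^esub> x) \<otimes>\<^bsub>gr_part R I M n\<^esub> u = \<one>\<^bsub>gr_part R I M n\<^esub>"
        using cls_add[OF M M.M.a_inv_closed[OF cc] cc, of n] cc unfolding x gr_part_simps
        by (simp add: M.M.l_neg cls_zero[OF M])
      show "cls n M (\<ominus>\<^bsub>M\<^esub> x) \<in> carrier (gr_part R I M n)"
        unfolding gr_part_simps by (rule imageI[OF adic_neg[OF M x(1)]])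
    qed
  qed
qed

lemma gr_group: "module R M \<Longrightarrow> group (gr R I M)"
  unfolding gr_def by (rule sum_group) (rule gr_part_group)

lemma gr_one: "\<one>\<^bsub>gr R I M\<^esub> = (\<lambda>n. adic (Suc n) M)"
  by (simp add: gr_def gr_part_simps restrict_def)

lemma gr_mult: "u \<otimes>\<^bsub>gr R I M\<^esub> v = (\<lambda>n. u n <+>\<^bsub>M\<^esub> v n)"
  by (simp add: gr_def gr_part_simps restrict_def)

lemma gr_carrier:
  assumes "module R M"
  shows "u \<in> carrier (gr R I M) \<longleftrightarrow>
    (\<forall>n. \<exists>x\<in>adic n M. u n = cls n M x) \<and> finite {n. u n \<noteq> adic (Suc n) M}"
  unfolding gr_def
  by (subst carrier_sum_group[OF gr_part_group[OF assms]])
    (auto simp: gr_part_simps PiE_UNIV_domain Pi_iff image_iff)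

section \<open>The maps of the linear part and their homology\<close>

lemma lin_map_0: "lin_map R I N f u 0 = adic (Suc 0) N"
  by (simp add: lin_map_def gr_part_simps)

context
  fixes M :: "('a, 'c) module" and N :: "('a, 'd) module" and f
  assumes f: "linear_map R M N f" and f_adic: "\<And>x. x \<in> carrier M \<Longrightarrow> f x \<in> adic (Suc 0) N"
begin

interpretation f: linear_map R M N f by (rule f)

lemma f_shift: "x \<in> adic n M \<Longrightarrow> f x \<in> adic (Suc n) N"
  using linear_map_adic_shift[OF f f_adic, of x n] by simp

text \<open>The union over representatives is a single coset: two of them differ by an element of
  filtration j + 1, and \<open>f\<close> takes this to filtration j + 2.\<close>

lemma lin_map_Suc:
  assumes x: "x \<in> adic j M" and u: "u j = cls j M x"
  shows "lin_map R I N f u (Suc j) = cls (Suc j) N (f x)"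
proof -
  interpret S: abelian_subgroup "adic (Suc j) M" M by (rule adic_abelian_subgroup[OF f.dom.module_axioms])
  have xc: "x \<in> carrier M" by (rule adic_carr[OF f.dom.module_axioms x])
  have "cls (Suc j) N (f y) = cls (Suc j) N (f x)" if y: "y \<in> u j" for y
  proof -
    have yc: "y \<in> carrier M" using y xc adic_carr[OF f.dom.module_axioms, of _ "Suc j"] unfolding u a_r_coset_def' by auto
    have "y \<ominus>\<^bsub>M\<^esub> x \<in> adic (Suc j) M"
      using y S.a_rcos_module[OF xc yc] by (simp add: u a_minus_def)
    then have "f (y \<ominus>\<^bsub>M\<^esub> x) \<in> adic (Suc (Suc j)) N" by (rule f_shift)
    then show ?thesis
      using cls_eq_iff[OF f.cod.module_axioms f.closed[OF yc] f.closed[OF xc]] xc yc by simp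
  qed
  moreover have "x \<in> u j" unfolding u by (rule S.a_rcos_self[OF xc])
  ultimately have "(\<Union>y\<in>u j. cls (Suc j) N (f y)) = cls (Suc j) N (f x)" by blast
  then show ?thesis by (simp add: lin_map_def)
qed

lemma lin_map_hom: "lin_map R I N f \<in> hom (gr R I M) (gr R I N)"
proof (rule homI)
  note mods = f.dom.module_axioms f.cod.module_axioms
  fix u assume u: "u \<in> carrier (gr R I M)"
  have "\<exists>y\<in>adic n N. lin_map R I N f u n = cls n N y" for n
  proof (cases n)
    case 0
    then show ?thesis using cls_zero[OF mods(2)] adic_zero[OF mods(2)] lin_map_0 by metis
  next
    case (Suc j)
    obtain x where x: "x \<in> adic j M" "u j = cls j M x" using u gr_carrier[OF mods(1)] by blast
    have "lin_map R I N f u n = cls n N (f x)" unfolding Suc by (rule lin_map_Suc[OF x(1)]) (rule x(2))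
    moreover have "f x \<in> adic n N" unfolding Suc by (rule f_shift[OF x(1)])
    ultimately show ?thesis by blast
  qed
  moreover have "{n. lin_map R I N f u n \<noteq> adic (Suc n) N} \<subseteq> Suc ` {n. u n \<noteq> adic (Suc n) M}"
  proof
    fix n assume "n \<in> {n. lin_map R I N f u n \<noteq> adic (Suc n) N}"
    then have n: "lin_map R I N f u n \<noteq> adic (Suc n) N" by simp
    then obtain j where j: "n = Suc j" using lin_map_0 by (metis not0_implies_Suc)
    have "u j \<noteq> adic (Suc j) M"
    proof
      assume "u j = adic (Suc j) M"
      then have "u j = cls j M \<zero>\<^bsub>M\<^esub>" by (simp only: cls_zero[OF mods(1)])
      then have "lin_map R I N f u (Suc j) = cls (Suc j) N (f \<zero>\<^bsub>M\<^esub>)"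
        by (rule lin_map_Suc[OF adic_zero[OF mods(1)]])
      then show False using n by (simp add: j cls_zero[OF mods(2)])
    qed
    then show "n \<in> Suc ` {n. u n \<noteq> adic (Suc n) M}" by (simp add: j)
  qed
  then have "finite {n. lin_map R I N f u n \<noteq> adic (Suc n) N}"
    by (rule finite_subset) (use u gr_carrier[OF mods(1)] in blast)
  ultimately show "lin_map R I N f u \<in> carrier (gr R I N)" using gr_carrier[OF mods(2)] by blast
next
  note mods = f.dom.module_axioms f.cod.module_axioms
  fix u v assume u: "u \<in> carrier (gr R I M)" and v: "v \<in> carrier (gr R I M)"
  show "lin_map R I N f (u \<otimes>\<^bsub>gr R I M\<^esub> v) = lin_map R I N f u \<otimes>\<^bsub>gr R I N\<^esub> lin_map R I N f v"
  proof
    fix n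
    show "lin_map R I N f (u \<otimes>\<^bsub>gr R I M\<^esub> v) n = (lin_map R I N f u \<otimes>\<^bsub>gr R I N\<^esub> lin_map R I N f v) n"
    proof (cases n)
      case 0
      have "cls 0 N \<zero>\<^bsub>N\<^esub> <+>\<^bsub>N\<^esub> cls 0 N \<zero>\<^bsub>N\<^esub> = cls 0 N \<zero>\<^bsub>N\<^esub>" by (simp add: cls_add[OF mods(2)])
      then show ?thesis unfolding 0 gr_mult lin_map_0 cls_zero[OF mods(2)] by simp
    next
      case (Suc j)
      obtain x where x: "x \<in> adic j M" "u j = cls j M x" using u gr_carrier[OF mods(1)] by blast
      obtain y where y: "y \<in> adic j M" "v j = cls j M y" using v gr_carrier[OF mods(1)] by blast
      note c = adic_carr[OF mods(1) x(1)] adic_carr[OF mods(1) y(1)]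
      have xy: "(u \<otimes>\<^bsub>gr R I M\<^esub> v) j = cls j M (x \<oplus>\<^bsub>M\<^esub> y)"
        by (simp only: gr_mult x y cls_add[OF mods(1) c])
      show ?thesis
        unfolding Suc lin_map_Suc[OF adic_add[OF mods(1) x(1) y(1)], of "u \<otimes>\<^bsub>gr R I M\<^esub> v", OF xy]
        using c by (simp add: gr_mult lin_map_Suc[OF x(1), of u, OF x(2)] lin_map_Suc[OF y(1), of v, OF y(2)]
            cls_add[OF mods(2)])
    qed
  qed
qed

end

text \<open>The homology splits by the internal degree \<open>p\<close>. A cycle of degree
  \<open>p\<close> is the class of some \<open>x\<close> whose image gains two powers instead of
  one. Boundaries of degree \<open>p\<close> come from degree p - 1, so for p = 0 there are none,
  and the class itself has to vanish.\<close>

lemma trivial_lin_homology_iff: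
  assumes C: "free_acyclic R F d"
    and min: "\<forall>i. \<forall>x\<in>carrier (F (Suc i)). d i x \<in> adic (Suc 0) (F i)"
  shows "trivial_group (lin_homology R I F d (Suc i)) \<longleftrightarrow>
    (\<forall>p. \<forall>x\<in>adic p (F (Suc i)). d i x \<in> adic (Suc (Suc p)) (F i) \<longrightarrow>
      (case p of 0 \<Rightarrow> x \<in> adic (Suc 0) (F (Suc i))
       | Suc j \<Rightarrow> \<exists>z\<in>adic j (F (Suc (Suc i))). x \<ominus>\<^bsub>F (Suc i)\<^esub> d (Suc i) z \<in> adic (Suc p) (F (Suc i))))"
    (is "_ \<longleftrightarrow> ?E")
proof -
  interpret C: free_acyclic R F d by (rule C)
  note lin = C.d_linear and min = min[rule_format] and dd = C.d_d
  let ?F0 = "F i" and ?F1 = "F (Suc i)" and ?F2 = "F (Suc (Suc i))"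
  let ?l1 = "lin_map R I ?F0 (d i)" and ?l2 = "lin_map R I ?F1 (d (Suc i))"
  interpret d1: linear_map R ?F1 ?F0 "d i" by (rule lin)
  interpret d2: linear_map R ?F2 ?F1 "d (Suc i)" by (rule lin)
  note m = d1.cod.module_axioms d1.dom.module_axioms d2.dom.module_axioms
  let ?Z = "kernel (gr R I ?F1) (gr R I ?F0) ?l1" and ?B = "?l2 ` carrier (gr R I ?F2)"
  let ?C = "(gr R I ?F1)\<lparr>carrier := ?Z\<rparr>"
  have s1: "?l1 u (Suc j) = cls (Suc j) ?F0 (d i x)" if "x \<in> adic j ?F1" "u j = cls j ?F1 x" for u j x
    by (rule lin_map_Suc[OF lin min], assumption, rule that(1), rule that(2))
  have s2: "?l2 u (Suc j) = cls (Suc j) ?F1 (d (Suc i) x)"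
    if "x \<in> adic j ?F2" "u j = cls j ?F2 x" for u j x
    by (rule lin_map_Suc[OF lin min], assumption, rule that(1), rule that(2))
  interpret l1: group_hom "gr R I ?F1" "gr R I ?F0" ?l1
    using lin_map_hom[OF lin min] gr_group m by (intro group_hom.intro group_hom_axioms.intro) auto
  interpret l2: group_hom "gr R I ?F2" "gr R I ?F1" ?l2
    using lin_map_hom[OF lin min] gr_group m by (intro group_hom.intro group_hom_axioms.intro) auto
  have hom: "lin_homology R I F d (Suc i) = ?C Mod ?B"
    by (simp add: lin_homology_def lin_cycles_def)
  have Z_iff: "u \<in> ?Z \<longleftrightarrow> u \<in> carrier (gr R I ?F1) \<and> (\<forall>j. ?l1 u (Suc j) = adic (Suc (Suc j)) ?F0)" for u
  proof -
    have "?l1 u = (\<lambda>n. adic (Suc n) ?F0) \<longleftrightarrow> (\<forall>j. ?l1 u (Suc j) = adic (Suc (Suc j)) ?F0)"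
      using lin_map_0[of ?F0 "d i" u] by (metis (no_types, lifting) ext not0_implies_Suc)
    then show ?thesis by (simp add: kernel_def gr_one)
  qed
  have cycle_iff: "?l1 u (Suc j) = adic (Suc (Suc j)) ?F0 \<longleftrightarrow> d i x \<in> adic (Suc (Suc j)) ?F0"
    if "x \<in> adic j ?F1" "u j = cls j ?F1 x" for u j x
    using s1[OF that(1), of u, OF that(2)] cls_eq_one_iff[OF m(1) d1.closed[OF adic_carr[OF m(2) that(1)]], of "Suc j"]
    by simp
  show ?thesis
  proof
    assume "trivial_group (lin_homology R I F d (Suc i))"
    then have "carrier (?C Mod ?B) = {\<one>\<^bsub>?C Mod ?B\<^esub>}" unfolding hom trivial_group_def by blast
    then have cos: "?B #>\<^bsub>?C\<^esub> u = ?B" if "u \<in> ?Z" for u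
      using that by (auto simp: FactGroup_def RCOSETS_def)
    have B: "u \<in> ?B" if u: "u \<in> ?Z" for u
    proof -
      have uc: "u \<in> carrier (gr R I ?F1)" using u by (simp add: kernel_def)
      have "\<one>\<^bsub>gr R I ?F1\<^esub> \<in> ?B" by (rule image_eqI, rule l2.hom_one[symmetric], rule l2.G.one_closed)
      then have "u \<in> ?B #>\<^bsub>?C\<^esub> u"
        unfolding r_coset_def by (rule UN_I) (simp add: l1.G.l_one[OF uc])
      then show ?thesis using cos[OF u] by simp
    qed
    show ?E
    proof (intro allI ballI impI)
      fix p x assume x: "x \<in> adic p ?F1" and dx: "d i x \<in> adic (Suc (Suc p)) ?F0"
      note xc = adic_carr[OF m(2) x]
      \<comment> \<open>A homogeneous cycle tests the condition in degree \<open>p\<close>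
        alone.\<close>
      define u where "u n = (if n = p then cls p ?F1 x else adic (Suc n) ?F1)" for n
      have un: "u n = cls n ?F1 (if n = p then x else \<zero>\<^bsub>?F1\<^esub>)" for n
        by (simp add: u_def cls_zero[OF m(2)])
      have xn: "(if n = p then x else \<zero>\<^bsub>?F1\<^esub>) \<in> adic n ?F1" for n
        using x adic_zero[OF m(2)] by simp
      have "finite {n. u n \<noteq> adic (Suc n) ?F1}"
        by (rule finite_subset[of _ "{p}"]) (auto simp: u_def)
      then have uc: "u \<in> carrier (gr R I ?F1)" using un xn gr_carrier[OF m(2)] by blast
      have "?l1 u (Suc j) = adic (Suc (Suc j)) ?F0" for j
        unfolding cycle_iff[OF xn un] using dx adic_zero[OF m(1)] by simp
      then have "u \<in> ?B" using uc by (intro B) (simp add: Z_iff)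
      then obtain v where v: "v \<in> carrier (gr R I ?F2)" "u = ?l2 v" by blast
      show "case p of 0 \<Rightarrow> x \<in> adic (Suc 0) ?F1
        | Suc j \<Rightarrow> \<exists>z\<in>adic j ?F2. x \<ominus>\<^bsub>?F1\<^esub> d (Suc i) z \<in> adic (Suc p) ?F1"
      proof (cases p)
        case 0
        have "cls 0 ?F1 x = adic (Suc 0) ?F1"
          using fun_cong[OF v(2), of 0] unfolding lin_map_0 by (simp add: u_def 0)
        then show ?thesis using cls_eq_one_iff[OF m(2) xc] by (simp add: 0)
      next
        case (Suc j)
        obtain z where z: "z \<in> adic j ?F2" "v j = cls j ?F2 z" using v(1) gr_carrier[OF m(3)] by blast
        note zc = adic_carr[OF m(3) z(1)]
        have "cls p ?F1 x = u p" by (simp add: u_def)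
        also have "\<dots> = cls p ?F1 (d (Suc i) z)"
          unfolding v(2) Suc by (rule s2[OF z(1)]) (use z(2) in simp_all)
        finally have "x \<ominus>\<^bsub>?F1\<^esub> d (Suc i) z \<in> adic (Suc p) ?F1"
          using cls_eq_iff[OF m(2) xc d2.closed[OF zc]] by simp
        then show ?thesis using z(1) by (auto simp: Suc)
      qed
    qed
  next
    assume E: ?E
    have "?B \<subseteq> ?Z"
    proof
      fix u assume "u \<in> ?B"
      then obtain v where v: "v \<in> carrier (gr R I ?F2)" "u = ?l2 v" by blast
      have uc: "u \<in> carrier (gr R I ?F1)" unfolding v(2) by (rule l2.hom_closed[OF v(1)])
      have "?l1 u (Suc j) = adic (Suc (Suc j)) ?F0" for j
      proof (cases j)
        case 0
        have "u 0 = cls 0 ?F1 \<zero>\<^bsub>?F1\<^esub>" unfolding v(2) lin_map_0 cls_zero[OF m(2)] ..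
        then show ?thesis unfolding 0
          by (subst cycle_iff[OF adic_zero[OF m(2)]]) (simp_all add: adic_zero[OF m(1)])
      next
        case (Suc k)
        obtain z where z: "z \<in> adic k ?F2" "v k = cls k ?F2 z" using v(1) gr_carrier[OF m(3)] by blast
        have "u j = cls j ?F1 (d (Suc i) z)" unfolding v(2) Suc by (rule s2[OF z(1)]) (use z(2) in simp_all)
        moreover have "d (Suc i) z \<in> adic j ?F1" unfolding Suc by (rule f_shift[OF lin min z(1)])
        ultimately show ?thesis
          using cycle_iff dd[OF adic_carr[OF m(3) z(1)]] adic_zero[OF m(1)] by simp
      qed
      then show "u \<in> ?Z" using uc by (simp add: Z_iff)
    qed
    moreover have "?Z \<subseteq> ?B"
    proof
      fix u assume "u \<in> ?Z"
      then have uc: "u \<in> carrier (gr R I ?F1)" and u0: "\<And>j. ?l1 u (Suc j) = adic (Suc (Suc j)) ?F0"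
        using Z_iff by auto
      have "\<forall>n. \<exists>x. x \<in> adic n ?F1 \<and> u n = cls n ?F1 x"
        using conjunct1[OF iffD1[OF gr_carrier[OF m(2)] uc]] by blast
      from choice[OF this] obtain x where x: "\<And>n. x n \<in> adic n ?F1" "\<And>n. u n = cls n ?F1 (x n)"
        by blast
      have dx: "d i (x n) \<in> adic (Suc (Suc n)) ?F0" for n by (rule iffD1[OF cycle_iff[OF x(1) x(2)] u0])
      have x0: "x 0 \<in> adic (Suc 0) ?F1" using mp[OF bspec[OF spec[OF E] x(1)[of 0]] dx[of 0]] by simp
      have "\<forall>j. \<exists>z. z \<in> adic j ?F2 \<and> x (Suc j) \<ominus>\<^bsub>?F1\<^esub> d (Suc i) z \<in> adic (Suc (Suc j)) ?F1"
      proof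
        fix j
        show "\<exists>z. z \<in> adic j ?F2 \<and> x (Suc j) \<ominus>\<^bsub>?F1\<^esub> d (Suc i) z \<in> adic (Suc (Suc j)) ?F1"
          using mp[OF bspec[OF spec[OF E] x(1)[of "Suc j"]] dx[of "Suc j"]] by auto
      qed
      from choice[OF this] obtain z where z: "\<And>j. z j \<in> adic j ?F2"
        "\<And>j. x (Suc j) \<ominus>\<^bsub>?F1\<^esub> d (Suc i) (z j) \<in> adic (Suc (Suc j)) ?F1" by blast
      \<comment> \<open>Zero wherever \<open>u\<close> vanishes: the \<open>z j\<close> were chosen
        independently and might otherwise give nonzero classes in infinitely many degrees, which
        would put \<open>v\<close> outside the direct sum.\<close>
      define z' where "z' j = (if u (Suc j) = adic (Suc (Suc j)) ?F1 then \<zero>\<^bsub>?F2\<^esub> else z j)" for j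
      define v where "v j = cls j ?F2 (z' j)" for j
      have z': "z' j \<in> adic j ?F2" for j using z(1) adic_zero[OF m(3)] by (simp add: z'_def)
      have "{j. v j \<noteq> adic (Suc j) ?F2} \<subseteq> (\<lambda>n. n - 1) ` {n. u n \<noteq> adic (Suc n) ?F1}"
      proof
        fix j assume "j \<in> {j. v j \<noteq> adic (Suc j) ?F2}"
        then have "u (Suc j) \<noteq> adic (Suc (Suc j)) ?F1" by (auto simp: v_def z'_def cls_zero[OF m(3)])
        then show "j \<in> (\<lambda>n. n - 1) ` {n. u n \<noteq> adic (Suc n) ?F1}"
          by (intro image_eqI[of _ _ "Suc j"]) auto
      qed
      then have "finite {j. v j \<noteq> adic (Suc j) ?F2}"
        by (rule finite_subset) (use uc gr_carrier[OF m(2)] in blast)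
      then have vc: "v \<in> carrier (gr R I ?F2)" using z' gr_carrier[OF m(3)] unfolding v_def by blast
      have "u n = ?l2 v n" for n
      proof (cases n)
        case 0
        have "u 0 = adic (Suc 0) ?F1"
          using x(2)[of 0] cls_eq_one_iff[OF m(2) adic_carr[OF m(2) x(1)[of 0]], of 0] x0 by simp
        then show ?thesis by (simp add: 0 lin_map_0)
      next
        case (Suc j)
        have "?l2 v (Suc j) = cls (Suc j) ?F1 (d (Suc i) (z' j))"
          by (rule s2[OF z']) (simp_all add: v_def)
        also have "\<dots> = u (Suc j)"
        proof (cases "u (Suc j) = adic (Suc (Suc j)) ?F1")
          case True
          then show ?thesis by (simp add: z'_def cls_zero[OF m(2)])
        next
          case False
          note xc = adic_carr[OF m(2) x(1)[of "Suc j"]] and zc = adic_carr[OF m(3) z(1)[of j]]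
          from False show ?thesis
            using z(2)[of j] x(2)[of "Suc j"] cls_eq_iff[OF m(2) xc d2.closed[OF zc], of "Suc j"]
            by (simp add: z'_def)
        qed
        finally show ?thesis by (simp add: Suc)
      qed
      then have "u = ?l2 v" by (rule ext)
      then show "u \<in> ?B" using vc by blast
    qed
    ultimately have BZ: "?B = ?Z" by (rule equalityI)
    have "group ?C" by (rule l1.G.subgroup_imp_group[OF l1.subgroup_kernel])
    then have "trivial_group (?C Mod carrier ?C)" by (rule trivial_group_Mod_carrier)
    then show "trivial_group (lin_homology R I F d (Suc i))" unfolding hom BZ by simp
  qed
qed

end

section \<open>The linearity defect of powers of the maximal ideal\<close>

text \<open>A preimage of filtration p < q represents a cycle of the linear part. As the homology
  vanishes, it can be brought to filtration p + 1 by subtracting a boundary, which leaves its image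
  under \<open>d i\<close> unchanged. Only \<open>q\<close> such corrections are made, so no
  question of convergence arises.\<close>

lemma (in cring_ideal) trivial_lin_homology_imp_adic_lifting:
  assumes C: "free_acyclic R F d"
    and min: "\<forall>i. \<forall>x\<in>carrier (F (Suc i)). d i x \<in> adic (Suc 0) (F i)"
    and triv: "trivial_group (lin_homology R I F d (Suc i))"
  shows "adic_lifting (F (Suc i)) (F i) (d i)"
  unfolding adic_lifting_def
proof (intro allI ballI impI)
  interpret C: free_acyclic R F d by (rule C)
  interpret d1: linear_map R "F (Suc i)" "F i" "d i" by (rule C.d_linear)
  interpret d2: linear_map R "F (Suc (Suc i))" "F (Suc i)" "d (Suc i)" by (rule C.d_linear)
  note E = iffD1[OF trivial_lin_homology_iff[OF C min] triv]
  fix q y assume y: "y \<in> carrier (F (Suc i))" and dy: "d i y \<in> adic (Suc q) (F i)"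
  have "p \<le> q \<Longrightarrow> \<exists>z\<in>adic p (F (Suc i)). d i z = d i y" for p
  proof (induct p)
    case 0
    show ?case using y by (intro bexI[of _ y]) (simp_all add: adic_0[OF C.mod])
  next
    case (Suc p)
    then obtain z where z: "z \<in> adic p (F (Suc i))" "d i z = d i y" by auto
    note zc = adic_carr[OF C.mod z(1)]
    have "d i z \<in> adic (Suc (Suc p)) (F i)"
      using dy adic_antimono[OF C.mod, of "Suc (Suc p)" "Suc q" i] Suc(2) z(2) by auto
    then have E': "case p of 0 \<Rightarrow> z \<in> adic (Suc 0) (F (Suc i))
      | Suc j \<Rightarrow> \<exists>w\<in>adic j (F (Suc (Suc i))). z \<ominus>\<^bsub>F (Suc i)\<^esub> d (Suc i) w \<in> adic (Suc p) (F (Suc i))"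
      by (rule mp[OF bspec[OF spec[OF E] z(1)]])
    show ?case
    proof (cases p)
      case 0
      then show ?thesis using E' z(2) by auto
    next
      case (Suc j)
      then obtain w where w: "w \<in> adic j (F (Suc (Suc i)))"
        "z \<ominus>\<^bsub>F (Suc i)\<^esub> d (Suc i) w \<in> adic (Suc p) (F (Suc i))" using E' by auto
      note wc = adic_carr[OF C.mod w(1)]
      have "d i (z \<ominus>\<^bsub>F (Suc i)\<^esub> d (Suc i) w) \<oplus>\<^bsub>F i\<^esub> d i (d (Suc i) w) = d i z"
        using zc wc by (simp add: a_minus_def d1.cod.a_assoc d1.cod.l_neg)
      then have "d i (z \<ominus>\<^bsub>F (Suc i)\<^esub> d (Suc i) w) = d i z" using zc wc by (simp only: C.d_d[OF wc] d1.cod.r_zero d1.closed d1.dom.minus_closed d2.closed)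
      then show ?thesis using w(2) z(2) by (intro bexI[of _ "z \<ominus>\<^bsub>F (Suc i)\<^esub> d (Suc i) w"]) simp_all
    qed
  qed
  then show "\<exists>z\<in>adic q (F (Suc i)). d i z = d i y" by simp
qed

text \<open>The first lifting replaces \<open>x\<close> by some \<open>y\<close> of higher
  filtration with the same image, so that x - y is a boundary. The second lifting gives this
  boundary a preimage of the right filtration. This is why vanishing in one degree takes the
  property in two.\<close>

lemma (in cring_ideal) adic_lifting_imp_trivial_lin_homology:
  assumes C: "free_acyclic R F d"
    and min: "\<forall>i. \<forall>x\<in>carrier (F (Suc i)). d i x \<in> adic (Suc 0) (F i)"
    and l1: "adic_lifting (F (Suc i)) (F i) (d i)"
    and l2: "adic_lifting (F (Suc (Suc i))) (F (Suc i)) (d (Suc i))"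
  shows "trivial_group (lin_homology R I F d (Suc i))"
proof -
  interpret C: free_acyclic R F d by (rule C)
  interpret d1: linear_map R "F (Suc i)" "F i" "d i" by (rule C.d_linear)
  interpret d2: linear_map R "F (Suc (Suc i))" "F (Suc i)" "d (Suc i)" by (rule C.d_linear)
  have "case p of 0 \<Rightarrow> x \<in> adic (Suc 0) (F (Suc i))
      | Suc j \<Rightarrow> \<exists>z\<in>adic j (F (Suc (Suc i))). x \<ominus>\<^bsub>F (Suc i)\<^esub> d (Suc i) z \<in> adic (Suc p) (F (Suc i))"
    if x: "x \<in> adic p (F (Suc i))" and dx: "d i x \<in> adic (Suc (Suc p)) (F i)" for p x
  proof -
    note xc = adic_carr[OF C.mod x]
    obtain y where y: "y \<in> adic (Suc p) (F (Suc i))" "d i y = d i x"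
      using adic_liftingD[OF l1 xc dx] by blast
    note yc = adic_carr[OF C.mod y(1)]
    have "d i (x \<ominus>\<^bsub>F (Suc i)\<^esub> y) = \<zero>\<^bsub>F i\<^esub>"
      using xc yc y(2) by (simp add: a_minus_def d1.cod.r_neg)
    then obtain w where w: "w \<in> carrier (F (Suc (Suc i)))" "d (Suc i) w = x \<ominus>\<^bsub>F (Suc i)\<^esub> y"
      using C.cycle_is_boundary[OF d1.dom.minus_closed[OF xc yc]] by blast
    show ?thesis
    proof (cases p)
      \<comment> \<open>No boundary may be subtracted in internal degree 0, but minimality puts
        \<open>d (Suc i) w\<close> into the multiples of I.\<close>
      case 0
      have "d (Suc i) w \<oplus>\<^bsub>F (Suc i)\<^esub> y = x"
        unfolding w(2) a_minus_def using xc yc by (simp add: d1.dom.a_assoc d1.dom.l_neg)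
      then show ?thesis using adic_add[OF C.mod min[rule_format, OF w(1)], of y] y(1) 0 by simp
    next
      case (Suc j)
      have "y \<in> adic p (F (Suc i))" using adic_Suc_subset[OF C.mod] y(1) by blast
      then have "d (Suc i) w \<in> adic (Suc j) (F (Suc i))"
        unfolding w(2) using adic_minus[OF C.mod x] by (simp add: Suc)
      then obtain z where z: "z \<in> adic j (F (Suc (Suc i)))" "d (Suc i) z = d (Suc i) w"
        using adic_liftingD[OF l2 w(1)] by blast
      have "x \<ominus>\<^bsub>F (Suc i)\<^esub> d (Suc i) z = y"
        unfolding z(2) w(2) a_minus_def using xc yc
        by (simp add: d1.dom.minus_add d1.dom.minus_minus d1.dom.r_neg2 d1.dom.r_neg1 d1.dom.a_assoc[symmetric] d1.dom.r_neg)
      then have "x \<ominus>\<^bsub>F (Suc i)\<^esub> d (Suc i) z \<in> adic (Suc p) (F (Suc i))" using y(1) by simp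
      then show ?thesis using z(1) by (auto simp: Suc)
    qed
  qed
  then show ?thesis
    unfolding trivial_lin_homology_iff[OF C min] by blast
qed

context noetherian_local_ring
begin

lemma resolution_minimal:
  assumes "minimal_free_resolution R \<mm> M F d \<epsilon>"
  shows "\<forall>i. \<forall>x\<in>carrier (F (Suc i)). d i x \<in> adic (Suc 0) (F i)"
proof -
  interpret F: minimal_free_resolution R \<mm> M F d \<epsilon> by (rule assms)
  show ?thesis using F.minimal by (auto simp: adic_1[OF F.module])
qed

lemma adic_lifting_unit_ideal:
  assumes "minimal_free_resolution R \<mm> (ideal_module R (pow 0)) F d \<epsilon>"
  shows "adic_lifting (F (Suc i)) (F i) (d i)"
proof -
  interpret F: minimal_free_resolution R \<mm> "self_module R" F d \<epsilon> using assms by (simp only: pow_0)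
  interpret C: free_acyclic_adic R \<mm> F d
    by (intro free_acyclic_adic.intro cring_ideal_axioms F.complex)
  have "\<one> \<in> \<epsilon> ` carrier (F 0)" by (simp only: F.aug_surj ideal_module_simps one_closed)
  then obtain s where s: "s \<in> carrier (F 0)" "\<epsilon> s = \<one>" by (elim imageE) simp
  show ?thesis
    by (rule C.adic_lifting_split[OF F.aug_linear[OF module_self] s])
      (simp only: F.exact_0 One_nat_def)
qed

text \<open>The maximal ideal annihilates the residue field, so the kernel of the augmentation
  contains all multiples of it; the other inclusion is minimality.\<close>

lemma residue_resolution_start:
  assumes "minimal_free_resolution R \<mm> (quotient_module R \<mm>) K \<delta> \<eta>"
  shows "\<delta> 0 ` carrier (K (Suc 0)) = adic (Suc 0) (K 0)"
proof
  interpret K: minimal_free_resolution R \<mm> "quotient_module R \<mm>" K \<delta> \<eta> by (rule assms)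
  interpret e: linear_map R "K 0" "quotient_module R \<mm>" \<eta> by (rule K.aug_linear[OF module_quotient])
  show "\<delta> 0 ` carrier (K (Suc 0)) \<subseteq> adic (Suc 0) (K 0)"
    using resolution_minimal[OF assms] by blast
  show "adic (Suc 0) (K 0) \<subseteq> \<delta> 0 ` carrier (K (Suc 0))"
  proof
    fix x assume x: "x \<in> adic (Suc 0) (K 0)"
    have "\<eta> x = \<zero>\<^bsub>quotient_module R \<mm>\<^esub>"
      using x
    proof (induct rule: adic_induct[OF K.module, consumes 1, case_names smult add])
      case (smult a x)
      have a: "a \<in> \<mm>" using smult(1) by (simp only: pow_1)
      have "\<eta> (a \<odot>\<^bsub>K 0\<^esub> x) = a \<odot>\<^bsub>quotient_module R \<mm>\<^esub> \<eta> x"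
        by (rule e.smult[OF pow_carr[OF smult(1)] smult(2)])
      then show ?case using quotient_smult_zero[OF a e.closed[OF smult(2)]] by simp
    next
      case (add x y)
      then show ?case using adic_carr[OF K.module add(1)] adic_carr[OF K.module add(3)] by simp
    qed
    then have "x \<in> a_kernel (K 0) (quotient_module R \<mm>) \<eta>"
      using adic_carr[OF K.module x] by (simp add: a_kernel_def')
    then show "x \<in> \<delta> 0 ` carrier (K (Suc 0))" by (simp only: K.exact_0 One_nat_def)
  qed
qed

text \<open>Two degrees of \<open>K\<close> are spent: degree \<open>i\<close> on the inclusion of
  phi(F'_i) in m F_i, and degree i + 1 on the cone.\<close>

lemma adic_lifting_next_power:
  assumes K: "minimal_free_resolution R \<mm> (quotient_module R \<mm>) K \<delta> \<eta>"
    and F: "minimal_free_resolution R \<mm> (ideal_module R (pow n)) F d \<epsilon>"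
    and F': "minimal_free_resolution R \<mm> (ideal_module R (pow (Suc n))) F' d' \<epsilon>'"
    and Ki: "adic_lifting (K (Suc i)) (K i) (\<delta> i)"
    and Ki': "adic_lifting (K (Suc (Suc i))) (K (Suc i)) (\<delta> (Suc i))"
    and Fi: "adic_lifting (F (Suc i)) (F i) (d i)"
  shows "adic_lifting (F' (Suc i)) (F' i) (d' i)"
proof -
  interpret K: minimal_free_resolution R \<mm> "quotient_module R \<mm>" K \<delta> \<eta> by (rule K)
  interpret F: minimal_free_resolution R \<mm> "ideal_module R (pow n)" F d \<epsilon> by (rule F)
  interpret F': minimal_free_resolution R \<mm> "ideal_module R (pow (Suc n))" F' d' \<epsilon>' by (rule F')
  interpret CF': free_acyclic R F' d' by (rule F'.complex)
  have e: "linear_map R (F 0) (ideal_module R (pow n)) \<epsilon>"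
    by (rule F.aug_linear[OF module_ideal_module[OF pow_ideal]])
  have e': "linear_map R (F' 0) (ideal_module R (pow (Suc n))) \<epsilon>'"
    by (rule F'.aug_linear[OF module_ideal_module[OF pow_ideal]])
  interpret e': linear_map R "F' 0" "ideal_module R (pow (Suc n))" \<epsilon>' by (rule e')
  have e'_n: "linear_map R (F' 0) (ideal_module R (pow n)) \<epsilon>'"
  proof (rule linear_mapI[OF F'.module module_ideal_module[OF pow_ideal]])
    show "\<epsilon>' x \<in> carrier (ideal_module R (pow n))" if "x \<in> carrier (F' 0)" for x
      using e'.closed[OF that] pow_Suc_subset by (auto simp only: ideal_module_simps)
  qed (simp_all only: e'.add e'.smult ideal_module_simps)
  have "\<epsilon>' ` carrier (F' 0) \<subseteq> \<epsilon> ` carrier (F 0)"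
    using pow_Suc_subset by (simp only: F.aug_surj F'.aug_surj ideal_module_simps)
  then obtain \<phi>0 where \<phi>0: "linear_map R (F' 0) (F 0) \<phi>0" "\<And>x. x \<in> carrier (F' 0) \<Longrightarrow> \<epsilon> (\<phi>0 x) = \<epsilon>' x"
    using fin_free_lift[OF CF'.free e'_n e] by blast
  have "\<phi>0 (d' 0 x) \<in> d 0 ` carrier (F (Suc 0))" if x: "x \<in> carrier (F' (Suc 0))" for x
  proof -
    have dx: "d' 0 x \<in> carrier (F' 0)" by (rule linear_map.closed[OF CF'.d_linear x])
    have "d' 0 x \<in> a_kernel (F' 0) (ideal_module R (pow (Suc n))) \<epsilon>'"
      unfolding F'.exact_0 using x by simp
    then have "\<epsilon>' (d' 0 x) = \<zero>" by (simp add: a_kernel_def')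
    then have "\<phi>0 (d' 0 x) \<in> a_kernel (F 0) (ideal_module R (pow n)) \<epsilon>"
      using \<phi>0(2)[OF dx] linear_map.closed[OF \<phi>0(1) dx] by (simp add: a_kernel_def')
    then show ?thesis unfolding F.exact_0 by simp
  qed
  then obtain \<phi> where \<phi>: "\<phi> 0 = \<phi>0" "\<And>i. linear_map R (F' i) (F i) (\<phi> i)"
    "\<And>i x. x \<in> carrier (F' (Suc i)) \<Longrightarrow> d i (\<phi> (Suc i) x) = \<phi> i (d' i x)"
    using CF'.comparison[OF F.complex \<phi>0(1)] by blast
  have aug: "\<epsilon> (\<phi> 0 y) = \<epsilon>' y" if "y \<in> carrier (F' 0)" for y
    using \<phi>0(2)[OF that] by (simp only: \<phi>(1))
  interpret CK: free_acyclic R K \<delta> by (rule K.complex)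
  have "\<forall>l. \<exists>m e c. free_basis R (K l) {..<m::nat} e c" using CK.free by (auto simp: fin_free_def)
  then obtain r e c where b: "\<And>l. free_basis R (K l) {..<r l::nat} (e l) (c l)" by metis
  interpret PR: power_resolutions R \<mm> n F d \<epsilon> F' d' \<epsilon>' \<phi>
    by (intro power_resolutions.intro power_resolutions_axioms.intro cring_ideal_axioms F F' \<phi> aug)
  interpret TR: tensor_resolutions R \<mm> n F d \<epsilon> F' d' \<epsilon>' \<phi> K \<delta> r e c
    by (intro tensor_resolutions.intro tensor_resolutions_axioms.intro PR.power_resolutions_axioms
        based_complex.intro based_complex_axioms.intro free_acyclic_adic.intro cring_ideal_axioms
        K.complex b residue_resolution_start[OF K])
  \<comment> \<open>\<open>K 0\<close> maps onto the nonzero residue field and therefore has a basis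
    vector. This vector and its coordinate serve as \<open>g\<close> and \<open>\<rho>\<close> in
    the transfer to the cone.\<close>
  have r0: "0 < r 0"
  proof (rule ccontr)
    assume "\<not> 0 < r 0"
    then have b0: "free_basis R (K 0) {} (e 0) (c 0)" using b[of 0] by simp
    interpret K0: module R "K 0" by (rule K.module)
    interpret et: linear_map R "K 0" "quotient_module R \<mm>" \<eta> by (rule K.aug_linear[OF module_quotient])
    have "x = \<zero>\<^bsub>K 0\<^esub>" if "x \<in> carrier (K 0)" for x
      using free_basisD(4)[OF b0 that] by simp
    then have "carrier (K 0) = {\<zero>\<^bsub>K 0\<^esub>}" using K0.M.zero_closed by blast
    then have "\<eta> ` carrier (K 0) = {\<zero>\<^bsub>quotient_module R \<mm>\<^esub>}" by simp
    then show False using quotient_nontrivial K.aug_surj by simp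
  qed
  have "c 0 0 (e 0 0) = \<one>" using free_basisD(5)[OF b, of 0 0 0] r0 by simp
  then have "adic_lifting (PR.cone (Suc (Suc i))) (PR.cone (Suc i)) (PR.cone_d (Suc i))"
    by (rule PR.cone.adic_lifting_transfer[OF K.complex PR.cone_start residue_resolution_start[OF K]
          TR.K.e_closed[OF r0] TR.K.c_linear[OF r0] _ Ki'])
  then show ?thesis
    by (intro PR.adic_lifting_step TR.\<phi>_adic Ki r0 Fi)
qed

lemma power_resolution_exists:
  "\<exists>(F :: nat \<Rightarrow> ('a, nat \<Rightarrow> 'a) module) d \<epsilon>.
    minimal_free_resolution R \<mm> (ideal_module R (pow n)) F d \<epsilon>"
proof -
  obtain S where S: "generates (ideal_module R (pow n)) S (pow n)"
    using ideal_generates[OF pow_ideal] by blast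
  show ?thesis
    by (rule minimal_free_resolution_exists[OF module_ideal_module[OF pow_ideal], where S = S])
      (use S in \<open>simp only: ideal_module_simps\<close>)
qed

text \<open>The induction on \<open>n\<close> stays in a single degree \<open>i\<close>; the next
  degree enters through \<open>K\<close> alone. \<open>F\<close> is kept arbitrary because the
  previous power comes with a resolution of its own.\<close>

lemma adic_lifting_powers:
  fixes F :: "nat \<Rightarrow> ('a, nat \<Rightarrow> 'a) module"
  assumes K: "minimal_free_resolution R \<mm> (quotient_module R \<mm>) K \<delta> \<eta>"
    and Ki: "\<And>i. D \<le> i \<Longrightarrow> adic_lifting (K (Suc i)) (K i) (\<delta> i)"
    and F: "minimal_free_resolution R \<mm> (ideal_module R (pow n)) F d \<epsilon>"
    and i: "D \<le> i"
  shows "adic_lifting (F (Suc i)) (F i) (d i)"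
  using F
proof (induct n arbitrary: F d \<epsilon>)
  case 0
  then show ?case by (rule adic_lifting_unit_ideal)
next
  case (Suc n)
  obtain G :: "nat \<Rightarrow> ('a, nat \<Rightarrow> 'a) module" and g \<gamma>
    where G: "minimal_free_resolution R \<mm> (ideal_module R (pow n)) G g \<gamma>"
    using power_resolution_exists by blast
  have "adic_lifting (K (Suc (Suc i))) (K (Suc i)) (\<delta> (Suc i))" using Ki i by simp
  then show ?case
    by (rule adic_lifting_next_power[OF K G Suc(2) Ki[OF i] _ Suc(1)[OF G]])
qed

text \<open>The choice in the definition is known to be a resolution once one exists whose elements
  have the type prescribed there.\<close>

lemma linearity_defect_resolution:
  assumes "\<exists>(F :: nat \<Rightarrow> ('a, nat \<Rightarrow> 'a) module) d \<epsilon>. minimal_free_resolution R \<mm> M F d \<epsilon>"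
  obtains F :: "nat \<Rightarrow> ('a, nat \<Rightarrow> 'a) module" and d \<epsilon> where "minimal_free_resolution R \<mm> M F d \<epsilon>"
    "linearity_defect R \<mm> M = Sup {enat i | i. \<not> trivial_group (lin_homology R \<mm> F d i)}"
proof -
  let ?P = "\<lambda>(F :: nat \<Rightarrow> ('a, nat \<Rightarrow> 'a) module, d). \<exists>\<epsilon>. minimal_free_resolution R \<mm> M F d \<epsilon>"
  have ex: "\<exists>x. ?P x" using assms by auto
  obtain F d where Fd: "(SOME x. ?P x) = (F, d)" by (cases "SOME x. ?P x")
  have "?P (F, d)" using someI_ex[OF ex] unfolding Fd .
  then obtain \<epsilon> where "minimal_free_resolution R \<mm> M F d \<epsilon>" by auto
  moreover have "linearity_defect R \<mm> M = Sup {enat i | i. \<not> trivial_group (lin_homology R \<mm> F d i)}"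
    unfolding linearity_defect_def Fd by simp
  ultimately show ?thesis by (rule that)
qed

end

theorem proposition3p2:
  fixes R :: "('a, 'm) ring_scheme" and \<mm> :: "'a set" and n :: nat
  assumes "noetherian_local_ring R \<mm>"
    and "\<mm> \<noteq> {\<zero>\<^bsub>R\<^esub>}"
  shows "linearity_defect R \<mm> (ideal_module R (ideal_pow R \<mm> n))
    \<le> linearity_defect R \<mm> (quotient_module R \<mm>)"
proof -
  interpret noetherian_local_ring R \<mm> by (rule assms(1))
  obtain K :: "nat \<Rightarrow> ('a, nat \<Rightarrow> 'a) module" and \<delta> \<eta>
    where K: "minimal_free_resolution R \<mm> (quotient_module R \<mm>) K \<delta> \<eta>"
      and ldK: "linearity_defect R \<mm> (quotient_module R \<mm>) =
        Sup {enat i | i. \<not> trivial_group (lin_homology R \<mm> K \<delta> i)}"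
    using linearity_defect_resolution[OF minimal_free_resolution_exists[OF module_quotient quotient_generates]]
    by blast
  obtain F :: "nat \<Rightarrow> ('a, nat \<Rightarrow> 'a) module" and d \<epsilon>
    where F: "minimal_free_resolution R \<mm> (ideal_module R (pow n)) F d \<epsilon>"
      and ldF: "linearity_defect R \<mm> (ideal_module R (pow n)) =
        Sup {enat i | i. \<not> trivial_group (lin_homology R \<mm> F d i)}"
    using linearity_defect_resolution[OF power_resolution_exists] by blast
  show ?thesis
  proof (cases "linearity_defect R \<mm> (quotient_module R \<mm>)")
    case infinity
    then show ?thesis by simp
  next
    case (enat D)
    have Ki: "adic_lifting (K (Suc i)) (K i) (\<delta> i)" if i: "D \<le> i" for i
    proof (rule trivial_lin_homology_imp_adic_lifting)
      show "trivial_group (lin_homology R \<mm> K \<delta> (Suc i))"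
      proof (rule ccontr)
        assume "\<not> trivial_group (lin_homology R \<mm> K \<delta> (Suc i))"
        then have "enat (Suc i) \<le> enat D" unfolding enat[symmetric] ldK by (intro Sup_upper) blast
        then show False using i by simp
      qed
    qed (rule minimal_free_resolution.complex[OF K], rule resolution_minimal[OF K])
    show ?thesis
      unfolding enat ldF
    proof (rule Sup_least)
      fix x assume "x \<in> {enat i | i. \<not> trivial_group (lin_homology R \<mm> F d i)}"
      then obtain i where i: "x = enat i" "\<not> trivial_group (lin_homology R \<mm> F d i)" by blast
      show "x \<le> enat D"
      proof (rule ccontr)
        assume "\<not> x \<le> enat D"
        \<comment> \<open>A degree above \<open>D\<close> is a successor j + 1 with j \<ge> D, so
          the lifting property is available in both degrees j and j + 1.\<close>
        then obtain j where j: "i = Suc j" "D \<le> j" using i(1) by (cases i) auto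
        have "trivial_group (lin_homology R \<mm> F d (Suc j))"
          by (rule adic_lifting_imp_trivial_lin_homology[OF minimal_free_resolution.complex[OF F] resolution_minimal[OF F]])
            (use adic_lifting_powers[OF K Ki F] j(2) in auto)
        then show False using i(2) j(1) by simp
      qed
    qed
  qed
qed

end
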